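(* Let $d\ge2$ and let $A\in L^1_{\mathrm{loc}}(\mathbb{R})^{d\times d}$ be such that the propagator of $y'=A(x)y$ is exponentially bounded on $\mathbb{R}$ and $y'=A(x)y$ has an exponential dichotomy $Q$ on $\mathbb{R}$. Suppose that for some $2\le d'\le d$ and $1\le k_0\le d'-1$ there is an exponential splitting $\{Q_j\}_{j=1}^{d'}$ on $\mathbb{R}$ with $Q=\sum_{j=1}^{k_0}Q_j$, $I_d-Q=\sum_{j=k_0+1}^{d'}Q_j$ and $\varkappa'(Q_j)\le\varkappa(Q_j)<\varkappa'(Q_{j+1})\le\varkappa(Q_{j+1})$ for $1\le j\le d'-1$. Let $R$ satisfy $\|R\|_{\mathbb{C}^{d\times d}}\in L^1(\mathbb{R};e^{\beta|x|}dx)$ with some $$\beta>\max\Big\{\max_{1\le j\le k_0}\{\lambda_+(Q_j)-\varkappa_+'(Q_j)\},\ \max_{k_0+1\le j\le d'}\{\varkappa_-(Q_j)-\lambda_-'(Q_j)\}\Big\}.$$ Then, with generalized matrix-valued Jost solutions and the projections $P_j$ as defined in the context: (i) The perturbed equation $y'=(A(x)+R(x))y$ has generalized matrix-valued Jost solutions $Y_+^{(j)}$, $j=1,\dots,k_0$, on $\mathbb{R}_+$ and $Y_-^{(j)}$, $j=k_0+1,\dots,d'$, on $\mathbb{R}_-$ associated with $\{Q_j\}_{j=1}^{d'}$. Moreover, for any set of generalized matrix-valued Jost solutions: (ii) $Y_+^{(1)}$ and $Y_-^{(d')}$ are uniquely determined and satisfy $\operatorname{ran}(Y_+^{(1)}(0))\subseteq\operatorname{ran}(P_1)$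 and $\operatorname{ran}(Y_-^{(d')}(0))\subseteq\operatorname{ran}(P_{d'})$. (iii) $$\operatorname{ran}(Y_+^{(j)}(0))\setminus\{0\}\subseteq\operatorname{ran}\Big(\sum_{k=1}^jP_k\Big)\setminus\operatorname{ran}\Big(\sum_{k=1}^{j-1}P_k\Big),\quad j=2,\dots,k_0,$$ $$\operatorname{ran}(Y_-^{(j)}(0))\setminus\{0\}\subseteq\operatorname{ran}\Big(\sum_{k=j}^{d'}P_k\Big)\setminus\operatorname{ran}\Big(\sum_{k=j+1}^{d'}P_k\Big),\quad j=k_0+1,\dots,d'-1.$$ (iv) If $Y_+^{(j)},\widetilde Y_+^{(j)}$ are any two generalized matrix-valued Jost solutions associated with $Q_j$ for $j=2,\dots,k_0$, and $Y_-^{(j)},\widetilde Y_-^{(j)}$ any two associated with $Q_j$ for $j=k_0+1,\dots,d'-1$, then $$\operatorname{ran}\big(Y_+^{(j)}(0)-\widetilde Y_+^{(j)}(0)\big)\subseteq\operatorname{ran}\Big(\sum_{k=1}^{j-1}P_k\Big),\quad j=2,\dots,k_0,$$ $$\operatorname{ran}\big(Y_-^{(j)}(0)-\widetilde Y_-^{(j)}(0)\big)\subseteq\operatorname{ran}\Big(\sum_{k=j+1}^{d'}P_k\Big),\quad j=k_0+1,\dots,d'-1.$$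
   Context: $\mathbb{R}_+=[0,\infty)$, $\mathbb{R}_-=(-\infty,0]$, $\log0=-\infty$. $\Phi'=A\Phi$ a.e., $\Phi(0)=I_d$. The propagator is exponentially bounded on $\mathbb{R}$ if $\sup_{|x-x'|\le1}\|\Phi(x)\Phi(x')^{-1}\|<\infty$. A projection $Q$ in $\mathbb{C}^d$ is an exponential dichotomy on $\mathbb{R}$ if there are constants $\varkappa,\varkappa'>0$, $C,C'\ge1$ with $\|\Phi(x)Q\Phi(x')^{-1}\|\le Ce^{-\varkappa(x-x')}$ for $x\ge x'$ and $\|\Phi(x)(I_d-Q)\Phi(x')^{-1}\|\le C'e^{\varkappa'(x-x')}$ for $x\le x'$. Exponents: a projection $P$ is uniformly conjugated by $\Phi$ on $J\in\{\mathbb{R},\mathbb{R}_+,\mathbb{R}_-\}$ if $\sup_{x\in J}\|\Phi(x)P\Phi(x)^{-1}\|<\infty$. The upper (resp. lower) Bohl exponent of such $P$ on $J$ is the infimum (resp. supremum) of all $\varkappa\in\mathbb{R}$ for which there is a constant $C(\varkappa)$ with $\|\Phi(x)P\Phi(x')^{-1}\|\le C(\varkappa)e^{\varkappa(x-x')}$ for all $x,x'\in J$ with $x\ge x'$ (resp. $x\le x'$); it is denoted $\varkappa(P),\varkappa_+(P),\varkappa_-(P)$ (resp. $\varkappa'(P),\varkappa_+'(P),\varkappa_-'(P)$) for $J=\mathbb{R},\mathbb{R}_+,\mathbb{R}_-$. Lyapunov exponents: $\lambda_+(P)=\limsup_{x\to\infty}x^{-1}\log\|\Phi(x)P\|$,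 $\lambda_-'(P)=-\limsup_{x\to-\infty}|x|^{-1}\log\|\Phi(x)P\|$. An exponential splitting on $J$ is a system of disjoint projections ($Q_iQ_j=0$, $i\neq j$) with sum $I_d$, each uniformly conjugated by $\Phi$ on $J$, with pairwise disjoint Bohl segments [lower, upper Bohl exponent on $J$], numbered in increasing order. The same notions are used for the perturbed equation, with its own fundamental matrix solution. Generalized matrix-valued Jost solutions associated with $\{Q_j\}_{j=1}^{d'}$: $d\times d$ matrix-valued solutions $Y_+^{(j)}$, $j=1,\dots,k_0$, on $\mathbb{R}_+$ and $Y_-^{(j)}$, $j=k_0+1,\dots,d'$, on $\mathbb{R}_-$ of $Y'=(A+R)Y$ with $$\limsup_{x\to\infty}x^{-1}\log\|Y_+^{(j)}(x)-\Phi(x)Q_j\|<\varkappa_+'(Q_j),\quad Y_+^{(j)}(0)=Y_+^{(j)}(0)Q_j,\quad j=1,\dots,k_0,$$ $$\liminf_{x\to-\infty}x^{-1}\log\|Y_-^{(j)}(x)-\Phi(x)Q_j\|>\varkappa_-(Q_j),\quad Y_-^{(j)}(0)=Y_-^{(j)}(0)Q_j,\quad j=k_0+1,\dots,d'.$$ Projections $P_j$: since $\|R\|\in L^1(\mathbb{R})$, the perturbed equation has an exponential splitting on $\mathbb{R}_+$ (and one on $\mathbb{R}_-$) consisting of $d'$ projections whose $j$th member has the same rank and the same Bohl segment on $\mathbb{R}_+$ (resp. $\mathbb{R}_-$) as $Q_j$. $P_1,\dots,P_{k_0}$ denote the first $k_0$ members of such a splitting on $\mathbb{R}_+$ (their sum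 $P_+$ has as range the set of initial values $y(0)$ of solutions bounded on $\mathbb{R}_+$), and $P_{k_0+1},\dots,P_{d'}$ denote the last $d'-k_0$ members of such a splitting on $\mathbb{R}_-$ (their sum $P_-$ has as range the set of initial values of solutions bounded on $\mathbb{R}_-$). Empty sums are $0$. *)

theory Defs
  imports "HOL-Analysis.Analysis"
begin

text \<open>
  Matrices in \<open>\<complex>\<^sup>d\<^sup>\<times>\<^sup>d\<close> have type \<open>complex ^ 'n ^ 'n\<close>, with \<open>d = CARD('n)\<close>. Their library
  \<open>norm\<close> is the Frobenius norm; replacing it by an equivalent norm changes none of the notions below.
\<close>

type_synonym 'n cmatrix = "complex ^ 'n ^ 'n"

subsection \<open>Linear differential equations with locally integrable coefficients\<close>

text \<open>A division is a finite family of non-overlapping compact intervals \<open>K = {Inf K..Sup K}\<close>.\<close>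

definition abs_continuous_on :: "real set \<Rightarrow> (real \<Rightarrow> 'a::real_normed_vector) \<Rightarrow> bool" where
  "abs_continuous_on S f \<longleftrightarrow>
     (\<forall>\<epsilon>>0. \<exists>\<delta>>0. \<forall>D T. D division_of T \<and> T \<subseteq> S \<and> (\<Sum>K\<in>D. Sup K - Inf K) < \<delta> \<longrightarrow>
        (\<Sum>K\<in>D. norm (f (Sup K) - f (Inf K))) < \<epsilon>)"

definition locally_abs_continuous_on :: "real set \<Rightarrow> (real \<Rightarrow> 'a::real_normed_vector) \<Rightarrow> bool" where
  "locally_abs_continuous_on J f \<longleftrightarrow> (\<forall>a b. {a..b} \<subseteq> J \<longrightarrow> abs_continuous_on {a..b} f)"

definition loc_integrable :: "(real \<Rightarrow> 'n::finite cmatrix) \<Rightarrow> bool" where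
  "loc_integrable A \<longleftrightarrow> (\<forall>a b. A absolutely_integrable_on {a..b})"

definition is_solution :: "(real \<Rightarrow> 'n::finite cmatrix) \<Rightarrow> real set \<Rightarrow> (real \<Rightarrow> 'n cmatrix) \<Rightarrow> bool" where
  "is_solution A J Y \<longleftrightarrow> locally_abs_continuous_on J Y \<and>
     (AE x in lebesgue. x \<in> J \<longrightarrow> (Y has_vector_derivative (A x ** Y x)) (at x within J))"

definition fundamental_solution :: "(real \<Rightarrow> 'n::finite cmatrix) \<Rightarrow> (real \<Rightarrow> 'n cmatrix) \<Rightarrow> bool" where
  "fundamental_solution A \<Phi> \<longleftrightarrow> is_solution A UNIV \<Phi> \<and> \<Phi> 0 = mat 1"

definition exp_bounded :: "(real \<Rightarrow> 'n::finite cmatrix) \<Rightarrow> bool" where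
  "exp_bounded \<Phi> \<longleftrightarrow>
     bdd_above {norm (\<Phi> x ** matrix_inv (\<Phi> x')) | x x'. \<bar>x - x'\<bar> \<le> 1}"

definition is_projection :: "'n::finite cmatrix \<Rightarrow> bool" where
  "is_projection P \<longleftrightarrow> P ** P = P"

definition mat_range :: "'n::finite cmatrix \<Rightarrow> (complex ^ 'n) set" where
  "mat_range M = range (\<lambda>v. M *v v)"

definition exp_dichotomy :: "(real \<Rightarrow> 'n::finite cmatrix) \<Rightarrow> 'n cmatrix \<Rightarrow> bool" where
  "exp_dichotomy \<Phi> Q \<longleftrightarrow> is_projection Q \<and>
     (\<exists>\<kappa>>0. \<exists>\<kappa>'>0. \<exists>C\<ge>1. \<exists>C'\<ge>1.
        (\<forall>x x'. x \<ge> x' \<longrightarrow>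
           norm (\<Phi> x ** Q ** matrix_inv (\<Phi> x')) \<le> C * exp (- \<kappa> * (x - x'))) \<and>
        (\<forall>x x'. x \<le> x' \<longrightarrow>
           norm (\<Phi> x ** (mat 1 - Q) ** matrix_inv (\<Phi> x')) \<le> C' * exp (\<kappa>' * (x - x'))))"

subsection \<open>Bohl and Lyapunov exponents\<close>

definition uniformly_conjugated :: "(real \<Rightarrow> 'n::finite cmatrix) \<Rightarrow> real set \<Rightarrow> 'n cmatrix \<Rightarrow> bool" where
  "uniformly_conjugated \<Phi> J P \<longleftrightarrow> is_projection P \<and>
     bdd_above ((\<lambda>x. norm (\<Phi> x ** P ** matrix_inv (\<Phi> x))) ` J)"

text \<open>Infimum and supremum are taken in \<open>[-\<infinity>, \<infinity>]\<close>, so that they are always meaningful.\<close>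

definition upper_bohl :: "(real \<Rightarrow> 'n::finite cmatrix) \<Rightarrow> real set \<Rightarrow> 'n cmatrix \<Rightarrow> ereal" where
  "upper_bohl \<Phi> J P = Inf (ereal ` {\<kappa>. \<exists>C. \<forall>x\<in>J. \<forall>x'\<in>J. x \<ge> x' \<longrightarrow>
     norm (\<Phi> x ** P ** matrix_inv (\<Phi> x')) \<le> C * exp (\<kappa> * (x - x'))})"

definition lower_bohl :: "(real \<Rightarrow> 'n::finite cmatrix) \<Rightarrow> real set \<Rightarrow> 'n cmatrix \<Rightarrow> ereal" where
  "lower_bohl \<Phi> J P = Sup (ereal ` {\<kappa>. \<exists>C. \<forall>x\<in>J. \<forall>x'\<in>J. x \<le> x' \<longrightarrow>
     norm (\<Phi> x ** P ** matrix_inv (\<Phi> x')) \<le> C * exp (\<kappa> * (x - x'))})"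

definition bohl_segment :: "(real \<Rightarrow> 'n::finite cmatrix) \<Rightarrow> real set \<Rightarrow> 'n cmatrix \<Rightarrow> ereal set" where
  "bohl_segment \<Phi> J P = {lower_bohl \<Phi> J P .. upper_bohl \<Phi> J P}"

definition log_norm :: "'n::finite cmatrix \<Rightarrow> ereal" where
  "log_norm M = (if norm M = 0 then - \<infinity> else ereal (ln (norm M)))"

definition lyapunov_plus :: "(real \<Rightarrow> 'n::finite cmatrix) \<Rightarrow> 'n cmatrix \<Rightarrow> ereal" where
  "lyapunov_plus \<Phi> P = Limsup at_top (\<lambda>x. ereal (1 / x) * log_norm (\<Phi> x ** P))"

definition lyapunov_minus' :: "(real \<Rightarrow> 'n::finite cmatrix) \<Rightarrow> 'n cmatrix \<Rightarrow> ereal" where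
  "lyapunov_minus' \<Phi> P = - Limsup at_bot (\<lambda>x. ereal (1 / \<bar>x\<bar>) * log_norm (\<Phi> x ** P))"

subsection \<open>Exponential splittings\<close>

definition exp_splitting ::
    "(real \<Rightarrow> 'n::finite cmatrix) \<Rightarrow> real set \<Rightarrow> nat \<Rightarrow> (nat \<Rightarrow> 'n cmatrix) \<Rightarrow> bool" where
  "exp_splitting \<Phi> J m Q \<longleftrightarrow>
     (\<forall>i\<in>{1..m}. uniformly_conjugated \<Phi> J (Q i)) \<and>
     (\<forall>i\<in>{1..m}. \<forall>j\<in>{1..m}. i \<noteq> j \<longrightarrow> Q i ** Q j = 0) \<and>
     (\<Sum>i=1..m. Q i) = mat 1 \<and>
     disjoint_family_on (\<lambda>i. bohl_segment \<Phi> J (Q i)) {1..m} \<and>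
     (\<forall>i\<in>{1..m}. \<forall>j\<in>{1..m}. i < j \<longrightarrow>
        (\<forall>s\<in>bohl_segment \<Phi> J (Q i). \<forall>t\<in>bohl_segment \<Phi> J (Q j). s < t))"

text \<open>
  \<open>\<Psi>\<close> is the fundamental solution of the perturbed equation. The splittings are not unique;
  \<open>P\<close> is composed of an arbitrary splitting on each half-line.
\<close>

definition matching_splitting ::
    "(real \<Rightarrow> 'n::finite cmatrix) \<Rightarrow> (real \<Rightarrow> 'n cmatrix) \<Rightarrow> real set \<Rightarrow> nat
      \<Rightarrow> (nat \<Rightarrow> 'n cmatrix) \<Rightarrow> (nat \<Rightarrow> 'n cmatrix) \<Rightarrow> bool" where
  "matching_splitting \<Phi> \<Psi> J m Q P \<longleftrightarrow> exp_splitting \<Psi> J m P \<and>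
     (\<forall>j\<in>{1..m}. rank (P j) = rank (Q j) \<and> bohl_segment \<Psi> J (P j) = bohl_segment \<Phi> J (Q j))"

definition perturbed_projections ::
    "(real \<Rightarrow> 'n::finite cmatrix) \<Rightarrow> (real \<Rightarrow> 'n cmatrix) \<Rightarrow> nat \<Rightarrow> nat
      \<Rightarrow> (nat \<Rightarrow> 'n cmatrix) \<Rightarrow> (nat \<Rightarrow> 'n cmatrix) \<Rightarrow> bool" where
  "perturbed_projections \<Phi> \<Psi> k\<^sub>0 m Q P \<longleftrightarrow>
     (\<exists>P\<^sub>p P\<^sub>m. matching_splitting \<Phi> \<Psi> {0..} m Q P\<^sub>p \<and> matching_splitting \<Phi> \<Psi> {..0} m Q P\<^sub>m \<and>
        (\<forall>j\<in>{1..k\<^sub>0}. P j = P\<^sub>p j) \<and> (\<forall>j\<in>{k\<^sub>0+1..m}. P j = P\<^sub>m j))"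

subsection \<open>Generalized matrix-valued Jost solutions\<close>

definition jost_plus ::
    "(real \<Rightarrow> 'n::finite cmatrix) \<Rightarrow> (real \<Rightarrow> 'n cmatrix) \<Rightarrow> (real \<Rightarrow> 'n cmatrix)
      \<Rightarrow> 'n cmatrix \<Rightarrow> (real \<Rightarrow> 'n cmatrix) \<Rightarrow> bool" where
  "jost_plus A R \<Phi> Q Y \<longleftrightarrow> is_solution (\<lambda>x. A x + R x) {0..} Y \<and>
     Limsup at_top (\<lambda>x. ereal (1 / x) * log_norm (Y x - \<Phi> x ** Q)) < lower_bohl \<Phi> {0..} Q \<and>
     Y 0 = Y 0 ** Q"

definition jost_minus ::
    "(real \<Rightarrow> 'n::finite cmatrix) \<Rightarrow> (real \<Rightarrow> 'n cmatrix) \<Rightarrow> (real \<Rightarrow> 'n cmatrix)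
      \<Rightarrow> 'n cmatrix \<Rightarrow> (real \<Rightarrow> 'n cmatrix) \<Rightarrow> bool" where
  "jost_minus A R \<Phi> Q Y \<longleftrightarrow> is_solution (\<lambda>x. A x + R x) {..0} Y \<and>
     Liminf at_bot (\<lambda>x. ereal (1 / x) * log_norm (Y x - \<Phi> x ** Q)) > upper_bohl \<Phi> {..0} Q \<and>
     Y 0 = Y 0 ** Q"

end

theory Submission
  imports Defs
begin

text \<open>
  On \<open>[0, \<infinity>)\<close> put \<open>Q\<^sup>- = Q\<^sub>1 + \<dots> + Q\<^sub>j\<^sub>-\<^sub>1\<close> and \<open>Q\<^sup>+ = Q\<^sub>j + \<dots> + Q\<^sub>d\<^sub>'\<close>, and choose \<open>\<mu>\<close> slightly below the
  lower Bohl exponent of \<open>Q\<^sub>j\<close>. Then \<open>Z = Y - \<Phi> Q\<^sub>j\<close> is constructed as the fixed point of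
  \<open>Z(x) = \<integral>\<^sub>a\<^sup>x \<Phi>(x) Q\<^sup>- \<Phi>(t)\<^sup>-\<^sup>1 R(t) (\<Phi>(t) Q\<^sub>j + Z(t)) dt - \<integral>\<^sub>x\<^sup>\<infinity> \<Phi>(x) Q\<^sup>+ \<Phi>(t)\<^sup>-\<^sup>1 R(t) (\<Phi>(t) Q\<^sub>j + Z(t)) dt\<close>
  for large \<open>a\<close>: the condition on \<open>\<beta>\<close> is what makes \<open>e\<^sup>-\<^sup>\<mu>\<^sup>t \<parallel>R(t)\<parallel> \<parallel>\<Phi>(t) Q\<^sub>j\<parallel>\<close> integrable. A second
  weight \<open>exp (K \<integral>\<^sub>x\<^sup>a \<parallel>R\<parallel>)\<close> on \<open>[0, a]\<close> makes the operator a contraction on the whole half-line.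
  Multiplying \<open>Y\<close> by \<open>Q\<^sub>j\<close> from the right gives \<open>Y(0) = Y(0) Q\<^sub>j\<close>.

  The range statements compare growth rates: \<open>P\<^sub>i \<Psi>(x)\<^sup>-\<^sup>1\<close> decays at any rate below the lower Bohl
  exponent of \<open>P\<^sub>i\<close>, so \<open>P\<^sub>i\<close> kills the initial value of every solution growing more slowly than
  that. The half-line \<open>(-\<infinity>, 0]\<close> is
  reduced to \<open>[0, \<infinity>)\<close> by \<open>x \<mapsto> -x\<close>, which reverses the order of the splitting.
\<close>

subsection \<open>Absolutely continuous functions\<close>

text \<open>The coefficients are only locally integrable, so a solution is an absolutely continuous
  function that satisfies the equation almost everywhere. Both halves of the fundamental theorem of
  calculus are therefore needed in their Lebesgue form. The contraction is set up on all of the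
  half-line because a solution found on \<open>[a, \<infinity>)\<close> alone would still have to be
  continued to \<open>0\<close>, which calls for a separate existence theorem. The role of \<beta>:
  for \<open>l\<close> slightly above the Lyapunov exponent, \<open>\<Phi>(t) Q\<^sub>j\<close> is
  eventually bounded by \<open>exp (l t)\<close>, and the source term is integrable as soon as
  \<open>l - \<mu> < \<beta>\<close>. The condition on \<beta> says that \<open>l - \<beta>\<close>
  can be kept below the lower Bohl exponent of \<open>Q\<^sub>j\<close>, which leaves room for
  \<mu>. It also forces \<beta> to be positive, since a lower Bohl exponent never exceeds the
  Lyapunov exponent; hence \<open>R\<close> itself is integrable. Exponents are infima, suprema and
  upper limits, so no constant is controlled at the exponent itself. Each comparison uses two real
  rates \<mu> < \<nu>, whose gap absorbs all constants.\<close>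

lemma abs_continuous_on_subset:
  "abs_continuous_on S f \<Longrightarrow> T \<subseteq> S \<Longrightarrow> abs_continuous_on T f"
  unfolding abs_continuous_on_def by (meson order_trans)

lemma division_of_real_intervals:
  fixes K :: "real set"
  assumes "D division_of T" "K \<in> D"
  obtains u v where "u \<le> v" "K = {u..v}" "K \<subseteq> T"
proof -
  obtain u v where "K = cbox u v" "K \<noteq> {}" "K \<subseteq> T"
    using division_ofD(2,3,4)[OF assms(1)] assms(2) by metis
  then show ?thesis using that[of u v] by (auto simp: cbox_interval)
qed

text \<open>For \<open>U\<close> an open set of small measure around an exceptional null set, this
  puts every division inside \<open>U\<close> under the threshold of absolute continuity.\<close>

lemma sum_length_division_le_measure:
  fixes T :: "real set"
  assumes D: "D division_of T" and TU: "T \<subseteq> U" and U: "U \<in> lmeasurable"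
  shows "(\<Sum>K\<in>D. Sup K - Inf K) \<le> measure lebesgue U"
proof -
  have "(\<Sum>K\<in>D. Sup K - Inf K) = (\<Sum>K\<in>D. measure lebesgue K)"
  proof (rule sum.cong[OF refl])
    fix K assume "K \<in> D"
    with D obtain u v where "u \<le> v" "K = {u..v}" by (rule division_of_real_intervals)
    then show "Sup K - Inf K = measure lebesgue K" by simp
  qed
  also have "\<dots> = measure lebesgue T"
    using content_division[OF D] by (simp add: division_of_closed[OF D])
  also have "\<dots> \<le> measure lebesgue U"
    using TU U by (intro measure_mono_fmeasurable) (auto simp: lmeasurable_division[OF D] fmeasurableD)
  finally show ?thesis .
qed

text \<open>A direct gauge argument. At tags where \<open>f\<close> is differentiable the straddle
  estimate compares \<open>g x\<close> times the length with the increment of \<open>f\<close>. At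
  tags in the exceptional null set the gauge confines the intervals to an open set of measure less
  than \<delta>, so absolute continuity makes the sum of increments small.\<close>

lemma abs_continuous_has_integral:
  fixes f g :: "real \<Rightarrow> 'a::euclidean_space"
  assumes "a \<le> b" and ac: "abs_continuous_on {a..b} f"
    and der: "AE x in lebesgue. x \<in> {a..b} \<longrightarrow> (f has_vector_derivative g x) (at x within {a..b})"
  shows "(g has_integral (f b - f a)) {a..b}"
proof -
  obtain N where N: "negligible N"
    and dN: "\<And>x. x \<in> {a..b} - N \<Longrightarrow> (f has_vector_derivative g x) (at x within {a..b})"
    using der unfolding eventually_ae_filter negligible_iff_null_sets by auto
  \<comment> \<open>With the value 0 on \<open>N\<close> the Riemann terms at exceptional tags
    vanish, and only increments of \<open>f\<close> remain there.\<close>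
  define h where "h x = (if x \<in> N then 0 else g x)" for x
  have "(h has_integral (f b - f a)) (cbox a b)"
    unfolding has_integral
  proof (intro allI impI)
    fix e :: real assume "e > 0"
    \<comment> \<open>The good tags contribute at most \<open>e' * (b - a) < e / 2\<close>; the
      other half of \<open>e\<close> is reserved for \<open>N\<close>. The summand 1 covers
      \<open>a = b\<close>.\<close>
    define e' where "e' = e / (2 * (b - a + 1))"
    have "e' > 0" using \<open>e > 0\<close> \<open>a \<le> b\<close> by (simp add: e'_def)
    have "e' * (b - a) < e / 2"
      using \<open>e > 0\<close> \<open>a \<le> b\<close> unfolding e'_def by (simp add: field_simps)
    have "\<exists>d>0. x \<in> {a..b} - N \<longrightarrow>
         (\<forall>y\<in>{a..b}. norm (y-x) < d \<longrightarrow> norm (f y - f x - (y-x) *\<^sub>R g x) \<le> e' * norm (y-x))" for x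
      using dN[of x] \<open>e' > 0\<close>
      unfolding has_vector_derivative_def has_derivative_within_alt by (metis zero_less_one)
    then obtain d where d: "\<And>x. 0 < d x"
        "\<And>x y. \<lbrakk>x \<in> {a..b} - N; y \<in> {a..b}; norm (y-x) < d x\<rbrakk>
                        \<Longrightarrow> norm (f y - f x - (y-x) *\<^sub>R g x) \<le> e' * norm (y-x)"
      by metis
    have "e / 2 > 0" using \<open>e > 0\<close> by simp
    then obtain \<delta> where "\<delta> > 0" and \<delta>:
      "\<forall>D T. D division_of T \<and> T \<subseteq> {a..b} \<and> (\<Sum>K\<in>D. Sup K - Inf K) < \<delta> \<longrightarrow>
       (\<Sum>K\<in>D. norm (f (Sup K) - f (Inf K))) < e / 2"
      using ac[unfolded abs_continuous_on_def] by blast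
    obtain U where "open U" "N \<subseteq> U" "U \<in> lmeasurable" "measure lebesgue U < \<delta>"
    proof -
      obtain T where T: "open T" "N \<subseteq> T" "T - N \<in> lmeasurable" "emeasure lebesgue (T - N) < ennreal \<delta>"
        using sets_lebesgue_outer_open[OF negligible_imp_sets[OF N] \<open>\<delta> > 0\<close>] by metis
      have "T = (T - N) \<union> N" using T by auto
      then have "T \<in> lmeasurable" "measure lebesgue T = measure lebesgue (T - N)"
        using T(3) negligible_imp_measurable[OF N] measure_Un_null_set[of "T - N" lebesgue N] N
        by (metis fmeasurable.Un, metis fmeasurableD negligible_iff_null_sets)
      moreover have "measure lebesgue (T - N) < \<delta>"
        using T(3,4) \<open>\<delta> > 0\<close> by (simp add: emeasure_eq_measure2 ennreal_less_iff)
      ultimately show ?thesis using that[of T] T by simp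
    qed
    define \<gamma> where "\<gamma> x = (if x \<in> N then U else ball x (d x))" for x
    have "gauge \<gamma>"
      unfolding gauge_def \<gamma>_def using d(1) \<open>open U\<close> \<open>N \<subseteq> U\<close> by auto
    show "\<exists>\<gamma>. gauge \<gamma> \<and> (\<forall>\<D>. \<D> tagged_division_of cbox a b \<and> \<gamma> fine \<D> \<longrightarrow>
            norm ((\<Sum>(x, k)\<in>\<D>. measure lborel k *\<^sub>R h x) - (f b - f a)) < e)"
    proof (rule exI[of _ \<gamma>], intro conjI allI impI)
      show "gauge \<gamma>" by fact
      fix p assume "p tagged_division_of cbox a b \<and> \<gamma> fine p"
      then have ptag: "p tagged_division_of cbox a b" and fin: "\<gamma> fine p" by auto
      have finp: "finite p" using ptag by blast
      have pK: "\<exists>u v. K = {u..v} \<and> u \<le> v \<and> x \<in> K \<and> K \<subseteq> {a..b} \<and> K \<subseteq> \<gamma> x" if xK: "(x,K) \<in> p" for x K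
      proof -
        obtain u v where "K = cbox u v" using tagged_division_ofD(4)[OF ptag xK] by blast
        moreover have "x \<in> K" "K \<subseteq> cbox a b" "K \<subseteq> \<gamma> x"
          using tagged_division_ofD(2,3)[OF ptag xK] fin xK by (auto simp: fine_def)
        ultimately show ?thesis by (auto simp: cbox_interval)
      qed
      have ba: "f b - f a = (\<Sum>(x,K)\<in>p. f(Sup K) - f(Inf K))" "b - a = (\<Sum>(x,K)\<in>p. Sup K - Inf K)"
        using additive_tagged_division_1[OF \<open>a \<le> b\<close>, of p f] additive_tagged_division_1[OF \<open>a \<le> b\<close>, of p "\<lambda>x. x"]
          ptag by auto
      define pN where "pN = {(x,K) \<in> p. x \<in> N}"
      have pNp: "pN \<subseteq> p" by (auto simp: pN_def)
      have good: "norm (measure lborel K *\<^sub>R h x - (f (Sup K) - f (Inf K))) \<le> e' * (Sup K - Inf K)"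
        if xK: "(x,K) \<in> p - pN" for x K
      proof -
        obtain u v where K: "K = {u..v}" "u \<le> v" "x \<in> K" "K \<subseteq> {a..b}" "K \<subseteq> \<gamma> x"
          using pK xK by blast
        have "x \<notin> N" using xK by (auto simp: pN_def)
        then have bx: "K \<subseteq> ball x (d x)" and hx: "h x = g x" using K by (auto simp: \<gamma>_def h_def)
        have uvK: "u \<in> K" "v \<in> K" using K by auto
        have uv: "u \<in> {a..b}" "v \<in> {a..b}" "u \<in> ball x (d x)" "v \<in> ball x (d x)"
          using uvK K(4) bx by blast+
        have x: "x \<in> {a..b} - N" using \<open>x \<notin> N\<close> K by auto
        have du: "norm (f u - f x - (u - x) *\<^sub>R g x) \<le> e' * norm (u - x)"
          using d(2)[OF x, of u] uv by (simp only: mem_ball dist_norm norm_minus_commute)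
        have dv: "norm (f v - f x - (v - x) *\<^sub>R g x) \<le> e' * norm (v - x)"
          using d(2)[OF x, of v] uv by (simp only: mem_ball dist_norm norm_minus_commute)
        \<comment> \<open>Straddle estimate: since the tag lies between \<open>u\<close> and
          \<open>v\<close>, the two errors measured from \<open>x\<close> add up to
          \<open>e'\<close> times the length.\<close>
        have "norm ((v - u) *\<^sub>R g x - (f v - f u)) =
              norm ((f u - f x - (u - x) *\<^sub>R g x) - (f v - f x - (v - x) *\<^sub>R g x))"
          by (simp add: algebra_simps)
        also have "\<dots> \<le> e' * norm (u - x) + e' * norm (v - x)"
          using norm_triangle_ineq4 du dv by (meson add_mono order_trans)
        also have "\<dots> = e' * (v - u)" using K by (simp add: algebra_simps)
        finally show ?thesis using K hx by simp
      qed
      have "norm (\<Sum>(x,K)\<in>p - pN. measure lborel K *\<^sub>R h x - (f (Sup K) - f (Inf K))) \<le> (\<Sum>(x,K)\<in>p - pN. e' * (Sup K - Inf K))"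
        by (rule sum_norm_le) (use good in auto)
      also have "\<dots> \<le> (\<Sum>(x,K)\<in>p. e' * (Sup K - Inf K))"
      proof (intro sum_mono2 finp)
        fix z assume "z \<in> p - (p - pN)"
        then obtain x K where "z = (x, K)" "(x, K) \<in> p" by (cases z) auto
        with pK[of x K] obtain u v where "z = (x, {u..v})" "u \<le> v" by blast
        then show "0 \<le> (case z of (x, K) \<Rightarrow> e' * (Sup K - Inf K))" using \<open>e' > 0\<close> by simp
      qed auto
      also have "\<dots> = e' * (b - a)"
        by (simp add: ba(2) sum_distrib_left split_def)
      also have "\<dots> < e / 2" by fact
      finally have 1: "norm (\<Sum>(x,K)\<in>p - pN. measure lborel K *\<^sub>R h x - (f (Sup K) - f (Inf K))) < e / 2" .
      have pNtag: "pN tagged_partial_division_of cbox a b"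
        by (rule tagged_partial_division_subset[OF _ pNp]) (use ptag in \<open>simp add: tagged_division_of_def\<close>)
      then have pNtag': "pN tagged_division_of \<Union>(snd ` pN)"
        by (rule tagged_partial_division_of_Union_self)
      have div: "snd ` pN division_of \<Union>(snd ` pN)"
        using division_of_tagged_division[OF pNtag'] .
      have sub: "K \<subseteq> U \<inter> {a..b}" if "(x, K) \<in> pN" for x K
      proof -
        have "(x, K) \<in> p" "x \<in> N" using that by (auto simp: pN_def)
        then show ?thesis using pK[of x K] by (simp add: \<gamma>_def) blast
      qed
      have "\<Union>(snd ` pN) \<subseteq> U \<inter> {a..b}"
      proof (rule Union_least)
        fix K assume "K \<in> snd ` pN"
        then obtain x where "(x, K) \<in> pN" by force
        then show "K \<subseteq> U \<inter> {a..b}" by (rule sub)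
      qed
      then have subU: "\<Union>(snd ` pN) \<subseteq> U" "\<Union>(snd ` pN) \<subseteq> {a..b}" by blast+
      have "(\<Sum>K\<in>snd ` pN. Sup K - Inf K) < \<delta>"
        using sum_length_division_le_measure[OF div subU(1) \<open>U \<in> lmeasurable\<close>] \<open>measure lebesgue U < \<delta>\<close> by linarith
      then have "(\<Sum>K\<in>snd ` pN. norm (f (Sup K) - f (Inf K))) < e / 2"
        using \<delta> div subU(2) by blast
      \<comment> \<open>Several tags can share an interval only if it is degenerate, so passing from
        intervals to tagged pairs needs a summand that vanishes on degenerate intervals. The
        \<open>if\<close> settles the empty one, whose \<open>Sup\<close> and \<open>Inf\<close>
        carry no information.\<close>
      also have "(\<Sum>K\<in>snd ` pN. norm (f (Sup K) - f (Inf K))) =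
          (\<Sum>K\<in>snd ` pN. if K = {} then 0 else norm (f (Sup K) - f (Inf K)))"
      proof (rule sum.cong[OF refl])
        fix K assume "K \<in> snd ` pN"
        then have "K \<noteq> {}" using division_ofD(3)[OF div] by blast
        then show "norm (f (Sup K) - f (Inf K)) = (if K = {} then 0 else norm (f (Sup K) - f (Inf K)))" by simp
      qed
      also have "\<dots> = (\<Sum>(x,K)\<in>pN. if K = {} then 0 else norm (f (Sup K) - f (Inf K)))"
      proof (rule sum.over_tagged_division_lemma[OF pNtag', symmetric])
        fix u v :: real assume "box u v = {}"
        then have "cbox u v = {} \<or> cbox u v = {u}" by (auto simp: box_real cbox_interval)
        then show "(if cbox u v = {} then 0 else norm (f (Sup (cbox u v)) - f (Inf (cbox u v)))) = 0"
          by auto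
      qed
      also have "\<dots> = (\<Sum>(x,K)\<in>pN. norm (f (Sup K) - f (Inf K)))"
      proof (rule sum.cong[OF refl], safe)
        fix x K assume "(x, K) \<in> pN"
        then have "K \<noteq> {}" using tagged_division_ofD(2)[OF pNtag'] by blast
        then show "(if K = {} then 0 else norm (f (Sup K) - f (Inf K))) = norm (f (Sup K) - f (Inf K))" by simp
      qed
      finally have "(\<Sum>(x,K)\<in>pN. norm (f (Sup K) - f (Inf K))) < e / 2" .
      moreover have "norm (\<Sum>(x,K)\<in>pN. measure lborel K *\<^sub>R h x - (f (Sup K) - f (Inf K)))
           \<le> (\<Sum>(x,K)\<in>pN. norm (f (Sup K) - f (Inf K)))"
        by (rule sum_norm_le) (auto simp: pN_def h_def norm_minus_commute)
      ultimately have 2: "norm (\<Sum>(x,K)\<in>pN. measure lborel K *\<^sub>R h x - (f (Sup K) - f (Inf K))) < e / 2"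
        by linarith
      have "(\<Sum>(x, k)\<in>p. measure lborel k *\<^sub>R h x) - (f b - f a) =
            (\<Sum>(x,K)\<in>p. measure lborel K *\<^sub>R h x - (f (Sup K) - f (Inf K)))"
        unfolding ba(1) by (simp add: split_def sum_subtractf)
      also have "\<dots> = (\<Sum>(x,K)\<in>p - pN. measure lborel K *\<^sub>R h x - (f (Sup K) - f (Inf K))) +
          (\<Sum>(x,K)\<in>pN. measure lborel K *\<^sub>R h x - (f (Sup K) - f (Inf K)))"
        by (rule sum.subset_diff[OF pNp finp])
      finally have eq: "(\<Sum>(x, k)\<in>p. measure lborel k *\<^sub>R h x) - (f b - f a) =
          (\<Sum>(x,K)\<in>p - pN. measure lborel K *\<^sub>R h x - (f (Sup K) - f (Inf K))) +
          (\<Sum>(x,K)\<in>pN. measure lborel K *\<^sub>R h x - (f (Sup K) - f (Inf K)))" .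
      show "norm ((\<Sum>(x, k)\<in>p. measure lborel k *\<^sub>R h x) - (f b - f a)) < e"
        unfolding eq by (rule norm_triangle_lt) (use 1 2 in linarith)
    qed
  qed
  then have "(g has_integral (f b - f a)) (cbox a b)"
    by (rule has_integral_spike[OF N, rotated]) (auto simp: h_def)
  then show ?thesis by (simp add: cbox_interval)
qed

text \<open>Truncation: cutting the norm of \<open>g\<close> at a level \<open>n\<close> loses less
  than \<open>e / 2\<close> over the whole interval, and the truncated part contributes at most
  \<open>n\<close> times the total length of the division.\<close>

lemma abs_continuous_on_integral:
  fixes g :: "real \<Rightarrow> 'a::euclidean_space"
  assumes g: "g absolutely_integrable_on {a..b}"
  shows "abs_continuous_on {a..b} (\<lambda>x. integral {a..x} g)"
  unfolding abs_continuous_on_def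
proof (intro allI impI)
  fix e :: real assume "e > 0"
  define f where "f x = norm (g x)" for x
  have f: "f absolutely_integrable_on {a..b}"
    unfolding f_def using absolutely_integrable_norm[OF g] by (simp add: o_def)
  have fi: "f integrable_on {a..b}"
    using f by (rule set_lebesgue_integral_eq_integral(1))
  define t where "t n x = min (f x) (real n)" for n x
  have ti: "t n integrable_on {a..b}" for n
    unfolding t_def
    by (intro set_lebesgue_integral_eq_integral(1) absolutely_integrable_min_1 f
        absolutely_integrable_continuous_real continuous_on_const)
  have "(\<lambda>n. integral {a..b} (t n)) \<longlonglongrightarrow> integral {a..b} f"
  proof (rule dominated_convergence(2)[OF ti fi])
    show "norm (t n x) \<le> f x" for n x by (auto simp: t_def f_def)
    show "(\<lambda>n. t n x) \<longlonglongrightarrow> f x" for x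
    proof (rule tendsto_eventually)
      show "\<forall>\<^sub>F n in sequentially. t n x = f x"
        unfolding t_def using eventually_ge_at_top[of "nat \<lceil>f x\<rceil>"]
        by eventually_elim linarith
    qed
  qed
  then have "\<forall>\<^sub>F n in sequentially. dist (integral {a..b} (t n)) (integral {a..b} f) < e / 2"
    using \<open>e > 0\<close> by (intro tendstoD) auto
  then obtain n where n: "dist (integral {a..b} (t n)) (integral {a..b} f) < e / 2"
    by (meson eventually_sequentially order_refl)
  define r where "r x = f x - t n x" for x
  have ri: "r integrable_on {a..b}" unfolding r_def by (intro integrable_diff fi ti)
  have "integral {a..b} r = integral {a..b} f - integral {a..b} (t n)"
    unfolding r_def by (intro integral_diff fi ti)
  then have r: "integral {a..b} r < e / 2" using n unfolding dist_real_def by linarith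
  have r0: "r x \<ge> 0" for x by (simp add: r_def t_def)
  show "\<exists>\<delta>>0. \<forall>D T. D division_of T \<and> T \<subseteq> {a..b} \<and> (\<Sum>K\<in>D. Sup K - Inf K) < \<delta> \<longrightarrow>
        (\<Sum>K\<in>D. norm (integral {a..Sup K} g - integral {a..Inf K} g)) < e"
 
  \<comment> \<open>Chosen so that \<open>n\<close> times the total length stays at most
    \<open>e / 2\<close>; the summand 1 allows \<open>n = 0\<close>.\<close>
  proof (rule exI[of _ "e / (2 * (real n + 1))"], intro conjI allI impI, goal_cases)
    case 1
    show ?case using \<open>e > 0\<close> by simp
  next
    case (2 D T)
    then have D: "D division_of T" and T: "T \<subseteq> {a..b}"
      and len: "(\<Sum>K\<in>D. Sup K - Inf K) < e / (2 * (real n + 1))" by auto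
    have "norm (integral {a..Sup K} g - integral {a..Inf K} g) \<le> integral K r + real n * (Sup K - Inf K)"
      if KD: "K \<in> D" for K
    proof -
      obtain u v where K: "u \<le> v" "K = {u..v}" "K \<subseteq> T"
        using division_of_real_intervals[OF D KD] by metis
      have "{u..v} \<subseteq> {a..b}" using order_trans[OF K(3) T] unfolding K(2) .
      then have sub: "{u..v} \<subseteq> {a..b}" "a \<le> u" "v \<le> b" using K(1) by auto
      have gi: "g integrable_on {a..v}"
        using K sub(2,3) by (intro integrable_on_subinterval[OF set_lebesgue_integral_eq_integral(1)[OF g]]) auto
      have gk: "g integrable_on {u..v}" "r integrable_on {u..v}" "f integrable_on {u..v}"
        using sub(1) by (auto intro!: integrable_on_subinterval[OF _ sub(1)] set_lebesgue_integral_eq_integral(1)[OF g] fi ri)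
      have "integral {a..u} g + integral {u..v} g = integral {a..v} g"
        using K sub(2,3) gi by (intro Henstock_Kurzweil_Integration.integral_combine) auto
      then have "integral {a..Sup K} g - integral {a..Inf K} g = integral {u..v} g"
        using K by (simp add: algebra_simps)
      moreover have "norm (integral {u..v} g) \<le> integral {u..v} f"
        by (rule integral_norm_bound_integral[OF gk(1,3)]) (simp add: f_def)
      moreover have "integral {u..v} f \<le> integral {u..v} (\<lambda>x. r x + real n)"
        by (intro integral_le gk integrable_add) (auto simp: r_def t_def)
      moreover have "integral {u..v} (\<lambda>x. r x + real n) = integral {u..v} r + real n * (v - u)"
        using K by (subst integral_add) (auto intro: gk)
      ultimately show ?thesis using K by simp
    qed
    then have "(\<Sum>K\<in>D. norm (integral {a..Sup K} g - integral {a..Inf K} g)) \<le>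
        (\<Sum>K\<in>D. integral K r + real n * (Sup K - Inf K))"
      by (rule sum_mono)
    also have "\<dots> = (\<Sum>K\<in>D. integral K r) + real n * (\<Sum>K\<in>D. Sup K - Inf K)"
      by (simp add: sum.distrib sum_distrib_left)
    also have "(\<Sum>K\<in>D. integral K r) = integral T r"
      using integrable_on_subdivision[OF D ri T] by (rule integral_combine_division_topdown[OF _ D, symmetric])
    also have "\<dots> \<le> integral {a..b} r"
      by (intro integral_subset_le T integrable_on_subdivision[OF D ri T] ri) (simp add: r0)
    also have "integral {a..b} r + real n * (\<Sum>K\<in>D. Sup K - Inf K) < e / 2 + e / 2"
    proof -
      have "real n * (\<Sum>K\<in>D. Sup K - Inf K) \<le> real n * (e / (2 * (real n + 1)))"
        using len by (intro mult_left_mono) auto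
      also have "\<dots> \<le> e / 2" using \<open>e > 0\<close> by (simp add: field_simps)
      finally show ?thesis using r by linarith
    qed
    finally show ?case by simp
  qed
qed

text \<open>Vitali covering combined with Henstock's lemma. Each bad point is an endpoint of
  arbitrarily short intervals whose Riemann error exceeds \<open>e\<close> times their length. For a
  finite disjoint family of them, fine for a suitable gauge, Henstock's lemma bounds the total error
  by \<open>e * \<eta>\<close>, so the total length is below \<eta>. Vitali extracts a disjoint
  family that covers \<open>S\<close> up to a null set.\<close>

lemma negligible_not_differentiable_indefinite_integral_aux:
  fixes g :: "real \<Rightarrow> 'a::euclidean_space"
  assumes g: "g integrable_on {a..b}" and "e > 0"
    and S: "S \<subseteq> {a<..<b}"
    and bad: "\<And>x d. x \<in> S \<Longrightarrow> d > 0 \<Longrightarrow> \<exists>y. 0 < \<bar>y - x\<bar> \<and> \<bar>y - x\<bar> < d \<and>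
         norm (integral {a..y} g - integral {a..x} g - (y - x) *\<^sub>R g x) > e * \<bar>y - x\<bar>"
  shows "negligible S"
  unfolding negligible_outer_le
proof (intro allI impI)
  fix \<eta> :: real assume "\<eta> > 0"
  \<comment> \<open>The interval with endpoints \<open>x\<close> and \<open>y\<close> in either
    order, written as a ball about its midpoint because the covering theorem speaks of balls. The
    tag will be the endpoint \<open>x\<close>, not the centre.\<close>
  define I where "I = (\<lambda>(x::real, y). cball ((x + y) / 2) (\<bar>y - x\<bar> / 2))"
  have I_eq: "I (x, y) = {min x y..max x y}" for x y
    by (auto simp: I_def cball_eq_atLeastAtMost min_def max_def field_simps abs_if)
  have "e * \<eta> > 0" using \<open>e > 0\<close> \<open>\<eta> > 0\<close> by simp
  then obtain \<gamma> where "gauge \<gamma>"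
    and \<gamma>: "\<And>p. \<lbrakk>p tagged_partial_division_of (cbox a b); \<gamma> fine p\<rbrakk> \<Longrightarrow>
             sum (\<lambda>(x,k). norm (measure lborel k *\<^sub>R g x - integral k g)) p < e * \<eta>"
    using Henstock_lemma[of g a b "e * \<eta>"] g by (auto simp: cbox_interval)
  define K where "K = {(x, y). x \<in> S \<and> x \<noteq> y \<and> I (x, y) \<subseteq> \<gamma> x \<inter> {a..b} \<and>
     norm (integral {a..y} g - integral {a..x} g - (y - x) *\<^sub>R g x) > e * \<bar>y - x\<bar>}"
  have cover: "\<exists>i. i \<in> K \<and> x \<in> cball ((\<lambda>(x, y). (x + y) / 2) i) ((\<lambda>(x, y). \<bar>y - x\<bar> / 2) i) \<and> (\<lambda>(x, y). \<bar>y - x\<bar> / 2) i < d"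
    if "x \<in> S" "d > 0" for x d
  proof -
    have "open (\<gamma> x \<inter> {a<..<b})" "x \<in> \<gamma> x \<inter> {a<..<b}"
      using \<open>gauge \<gamma>\<close> S that by (auto simp: gauge_def)
    then obtain r where "r > 0" and r: "ball x r \<subseteq> \<gamma> x \<inter> {a<..<b}"
      using open_contains_ball by metis
    have "min r d > 0" using \<open>r > 0\<close> \<open>d > 0\<close> by simp
    then obtain y where y: "0 < \<bar>y - x\<bar>" "\<bar>y - x\<bar> < min r d"
      "norm (integral {a..y} g - integral {a..x} g - (y - x) *\<^sub>R g x) > e * \<bar>y - x\<bar>"
      using bad[OF \<open>x \<in> S\<close>, of "min r d"] by blast
    have "I (x, y) \<subseteq> ball x r"
      using y unfolding I_eq by (auto simp: dist_real_def)
    then have "(x, y) \<in> K" using y r \<open>x \<in> S\<close> unfolding K_def by auto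
    moreover have "x \<in> I (x, y)" by (auto simp: I_eq)
    ultimately show ?thesis using y by (intro exI[of _ "(x, y)"]) (auto simp: I_def)
  qed
  have "\<And>i. i \<in> K \<Longrightarrow> 0 < (\<lambda>(x, y). \<bar>y - x\<bar> / 2) i" by (auto simp: K_def)
  then obtain C where C: "countable C" "C \<subseteq> K" "pairwise (\<lambda>i j. disjnt (I i) (I j)) C"
     "negligible (S - (\<Union>i \<in> C. I i))"
    using Vitali_covering_theorem_cballs[of K "\<lambda>(x, y). \<bar>y - x\<bar> / 2" S "\<lambda>(x, y). (x + y) / 2"] cover
    unfolding I_def split_def by (metis (no_types, lifting))
  have fin: "measure lebesgue (\<Union>(I ` F)) \<le> \<eta>" if F: "F \<subseteq> C" "finite F" for F
  proof -
    define p where "p = (\<lambda>i. (fst i, I i)) ` F"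
    have FK: "F \<subseteq> K" using F C by auto
    have disj: "I i \<inter> I j = {}" if "i \<in> F" "j \<in> F" "i \<noteq> j" for i j
      using C(3) F(1) that unfolding pairwise_def disjnt_def by blast
    have I_ne: "fst i \<in> I i" for i by (cases i) (auto simp: I_eq)
    have "inj_on (\<lambda>i. (fst i, I i)) F"
    proof (rule inj_onI, rule ccontr)
      fix i j assume ij: "i \<in> F" "j \<in> F" "(fst i, I i) = (fst j, I j)" "i \<noteq> j"
      then show False using disj[OF ij(1,2,4)] I_ne[of i] by auto
    qed
    have "p tagged_partial_division_of cbox a b"
      unfolding tagged_partial_division_of_def
    proof (intro conjI allI impI)
      show "finite p" using F by (simp add: p_def)
    next
      fix x k assume "(x, k) \<in> p"
      then obtain i where i: "i \<in> F" "x = fst i" "k = I i" by (auto simp: p_def)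
      show "x \<in> k" unfolding i by (rule I_ne)
      show "k \<subseteq> cbox a b" using FK i(1) by (cases i) (auto simp: i K_def cbox_interval)
      show "\<exists>a b. k = cbox a b" unfolding i by (cases i) (metis I_eq cbox_interval)
    next
      fix x1 k1 x2 k2 assume "(x1, k1) \<in> p \<and> (x2, k2) \<in> p \<and> (x1, k1) \<noteq> (x2, k2)"
      then obtain i j where ij: "i \<in> F" "j \<in> F" "i \<noteq> j" "k1 = I i" "k2 = I j" unfolding p_def by blast
      have "k1 \<inter> k2 = {}" using disj[OF ij(1,2,3)] ij(4,5) by simp
      then show "interior k1 \<inter> interior k2 = {}" using interior_subset by blast
    qed
    moreover have "\<gamma> fine p"
            unfolding fine_def
    proof (safe)
      fix x k y assume "(x, k) \<in> p" "y \<in> k"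
      then obtain i where "i \<in> K" "x = fst i" "k = I i" using FK unfolding p_def by blast
      with \<open>y \<in> k\<close> show "y \<in> \<gamma> x" unfolding K_def by auto
    qed
    ultimately have "(\<Sum>(x,k)\<in>p. norm (measure lborel k *\<^sub>R g x - integral k g)) < e * \<eta>"
      by (rule \<gamma>)
    also have "(\<Sum>(x,k)\<in>p. norm (measure lborel k *\<^sub>R g x - integral k g)) =
       (\<Sum>i\<in>F. norm (measure lborel (I i) *\<^sub>R g (fst i) - integral (I i) g))"
      unfolding p_def by (subst sum.reindex[OF \<open>inj_on _ F\<close>]) simp
    finally have *: "(\<Sum>i\<in>F. norm (measure lborel (I i) *\<^sub>R g (fst i) - integral (I i) g)) < e * \<eta>" .
    have "e * measure lborel (I i) \<le> norm (measure lborel (I i) *\<^sub>R g (fst i) - integral (I i) g)"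
      if "i \<in> F" for i
    proof -
      obtain x y where i: "i = (x, y)" by (cases i)
      have K: "x \<noteq> y" "{min x y..max x y} \<subseteq> {a..b}"
        "norm (integral {a..y} g - integral {a..x} g - (y - x) *\<^sub>R g x) > e * \<bar>y - x\<bar>"
        using FK that i by (auto simp: K_def I_eq)
      have comb: "integral {a..u} g + integral {u..v} g = integral {a..v} g"
        if "a \<le> u" "u \<le> v" "v \<le> b" for u v
        using that by (intro Henstock_Kurzweil_Integration.integral_combine integrable_on_subinterval[OF g]) auto
      show ?thesis
      proof (cases "x < y")
        case True
        then have "integral {a..x} g + integral {x..y} g = integral {a..y} g" using K by (intro comb) auto
        then have "integral {x..y} g = integral {a..y} g - integral {a..x} g"
          by (metis add_diff_cancel_left')
        then have "norm ((y - x) *\<^sub>R g x - integral {x..y} g) = norm (integral {a..y} g - integral {a..x} g - (y - x) *\<^sub>R g x)"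
          by (metis norm_minus_commute)
        then show ?thesis using True K by (simp add: i I_eq min_def max_def)
      next
        case False
        then have "integral {a..y} g + integral {y..x} g = integral {a..x} g" using K by (intro comb) auto
        then have "(x - y) *\<^sub>R g x - integral {y..x} g = integral {a..y} g - integral {a..x} g - (y - x) *\<^sub>R g x"
          by (simp add: algebra_simps)
        then show ?thesis using False K by (simp add: i I_eq min_def max_def)
      qed
    qed
    then have "(\<Sum>i\<in>F. e * measure lborel (I i)) \<le> (\<Sum>i\<in>F. norm (measure lborel (I i) *\<^sub>R g (fst i) - integral (I i) g))"
      by (rule sum_mono)
    with * have "e * (\<Sum>i\<in>F. measure lborel (I i)) < e * \<eta>" by (simp add: sum_distrib_left)
    then have "(\<Sum>i\<in>F. measure lborel (I i)) < \<eta>" using \<open>e > 0\<close> by simp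
    moreover have "measure lebesgue (\<Union>(I ` F)) \<le> (\<Sum>i\<in>F. measure lebesgue (I i))"
      using F by (intro measure_UNION_le) (auto simp: I_def)
    moreover have "measure lebesgue (I i) = measure lborel (I i)" for i
      by (cases i) (simp add: I_eq)
    ultimately show ?thesis by simp
  qed
  have "\<Union>(I ` C) \<in> lmeasurable \<and> measure lebesgue (\<Union>(I ` C)) \<le> \<eta>"
  proof (rule conjI)
    show "\<Union>(I ` C) \<in> lmeasurable"
      by (rule fmeasurable_UN_bound[OF C(1) _ fin]) (auto simp: I_def)
    show "measure lebesgue (\<Union>(I ` C)) \<le> \<eta>"
      by (rule measure_UN_bound[OF C(1) _ fin]) (auto simp: I_def)
  qed
  then show "\<exists>T. S \<subseteq> T \<and> T \<in> lmeasurable \<and> measure lebesgue T \<le> \<eta>"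
  proof (intro exI[of _ "\<Union>(I ` C) \<union> (S - \<Union>(I ` C))"] conjI)
    assume *: "\<Union>(I ` C) \<in> lmeasurable \<and> measure lebesgue (\<Union>(I ` C)) \<le> \<eta>"
    show "\<Union>(I ` C) \<union> (S - \<Union>(I ` C)) \<in> lmeasurable"
      using * C(4) negligible_imp_measurable by blast
    show "measure lebesgue (\<Union>(I ` C) \<union> (S - \<Union>(I ` C))) \<le> \<eta>"
      using * C(4) by (subst measure_Un_null_set) (auto simp: negligible_iff_null_sets)
  qed auto
qed

text \<open>Lebesgue differentiation: the exceptional set is the countable union of the sets where
  the difference quotient misses \<open>g x\<close> by more than \<open>1 / (n + 1)\<close> at
  arbitrarily small scales.\<close>

lemma AE_has_vector_derivative_integral:
  fixes g :: "real \<Rightarrow> 'a::euclidean_space"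
  assumes g: "g integrable_on {a..b}"
  shows "AE x in lebesgue. x \<in> {a<..<b} \<longrightarrow> ((\<lambda>x. integral {a..x} g) has_vector_derivative g x) (at x)"
proof -
  define G where "G x = integral {a..x} g" for x
  define S where "S n = {x \<in> {a<..<b}. \<forall>d>0. \<exists>y. 0 < \<bar>y - x\<bar> \<and> \<bar>y - x\<bar> < d \<and>
         norm (G y - G x - (y - x) *\<^sub>R g x) > inverse (real (Suc n)) * \<bar>y - x\<bar>}" for n
  have "negligible (S n)" for n
    by (rule negligible_not_differentiable_indefinite_integral_aux[OF g, of "inverse (real (Suc n))"])
       (auto simp: S_def G_def)
  then have neg: "negligible (\<Union>n. S n)" by (rule negligible_Union_nat)
  have "(G has_vector_derivative g x) (at x)" if x: "x \<in> {a<..<b}" "x \<notin> (\<Union>n. S n)" for x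
    unfolding has_vector_derivative_def has_derivative_within_alt
  proof (intro conjI allI impI)
    show "bounded_linear (\<lambda>h. h *\<^sub>R g x)" by (rule bounded_linear_scaleR_left)
    fix e :: real assume "e > 0"
    then obtain n where n: "inverse (real (Suc n)) < e" using reals_Archimedean by blast
    have "x \<notin> S n" using x(2) by blast
    then obtain d where "d > 0" and d: "\<And>y. 0 < \<bar>y - x\<bar> \<Longrightarrow> \<bar>y - x\<bar> < d \<Longrightarrow>
         norm (G y - G x - (y - x) *\<^sub>R g x) \<le> inverse (real (Suc n)) * \<bar>y - x\<bar>"
      using x(1) unfolding S_def mem_Collect_eq by (meson not_less)
    show "\<exists>d>0. \<forall>y\<in>UNIV. norm (y - x) < d \<longrightarrow> norm (G y - G x - (y - x) *\<^sub>R g x) \<le> e * norm (y - x)"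
    proof (rule exI[of _ d], intro conjI ballI impI \<open>d > 0\<close>)
      fix y assume "norm (y - x) < d"
      show "norm (G y - G x - (y - x) *\<^sub>R g x) \<le> e * norm (y - x)"
      proof (cases "y = x")
        case False
        then have "norm (G y - G x - (y - x) *\<^sub>R g x) \<le> inverse (real (Suc n)) * \<bar>y - x\<bar>"
          using \<open>norm (y - x) < d\<close> by (intro d) auto
        also have "\<dots> \<le> e * \<bar>y - x\<bar>" using n by (intro mult_right_mono) auto
        finally show ?thesis by simp
      qed simp
    qed
  qed
  then show ?thesis
    using neg unfolding eventually_ae_filter negligible_iff_null_sets G_def
    by (intro bexI[of _ "\<Union>n. S n"]) (auto simp: G_def)
qed

lemma abs_continuous_on_imp_continuous_on:
  assumes ac: "abs_continuous_on {a..b} f"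
  shows "continuous_on {a..b} f"
  unfolding continuous_on_iff
proof (intro ballI allI impI)
  fix x e :: real assume x: "x \<in> {a..b}" and "e > 0"
  then obtain \<delta> where "\<delta> > 0" and \<delta>:
    "\<forall>D T. D division_of T \<and> T \<subseteq> {a..b} \<and> (\<Sum>K\<in>D. Sup K - Inf K) < \<delta> \<longrightarrow>
       (\<Sum>K\<in>D. norm (f (Sup K) - f (Inf K))) < e"
    using ac[unfolded abs_continuous_on_def] by blast
  have *: "norm (f v - f u) < e" if "u \<in> {a..b}" "v \<in> {a..b}" "u \<le> v" "v - u < \<delta>" for u v
  proof -
    have "{{u..v}} division_of {u..v}"
      using division_of_self[of u v] that by (simp add: cbox_interval)
    then show ?thesis
      using \<delta>[rule_format, of "{{u..v}}" "{u..v}"] that by auto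
  qed
  show "\<exists>d>0. \<forall>y\<in>{a..b}. dist y x < d \<longrightarrow> dist (f y) (f x) < e"
  proof (rule exI[of _ \<delta>], intro conjI ballI impI \<open>\<delta> > 0\<close>)
    fix y assume y: "y \<in> {a..b}" "dist y x < \<delta>"
    show "dist (f y) (f x) < e"
    proof (cases "x \<le> y")
      case True
      then show ?thesis using *[OF x y(1)] y(2) by (simp add: dist_norm)
    next
      case False
      then show ?thesis using *[OF y(1) x] y(2) by (simp add: dist_norm norm_minus_commute)
    qed
  qed
qed

text \<open>One criterion for all closure properties in use: sums, differences, products of bounded
  factors, and composition with a function that is Lipschitz on the relevant range.\<close>

lemma abs_continuous_on_dominated:
  assumes f: "abs_continuous_on S f" and g: "abs_continuous_on S g"
    and le: "\<And>x y. x \<in> S \<Longrightarrow> y \<in> S \<Longrightarrow> norm (h y - h x) \<le> L * norm (f y - f x) + M * norm (g y - g x)"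
  shows "abs_continuous_on S h"
  unfolding abs_continuous_on_def
proof (intro allI impI)
  fix e :: real assume "e > 0"
  define e' where "e' = e / (\<bar>L\<bar> + \<bar>M\<bar> + 1)"
  have "e' > 0" using \<open>e > 0\<close> by (simp add: e'_def add_nonneg_pos)
  obtain \<delta>1 where "\<delta>1 > 0" and \<delta>1:
    "\<forall>D T. D division_of T \<and> T \<subseteq> S \<and> (\<Sum>K\<in>D. Sup K - Inf K) < \<delta>1 \<longrightarrow>
       (\<Sum>K\<in>D. norm (f (Sup K) - f (Inf K))) < e'"
    using mp[OF spec[OF f[unfolded abs_continuous_on_def]] \<open>e' > 0\<close>] by (elim exE conjE) (rule that)
  obtain \<delta>2 where "\<delta>2 > 0" and \<delta>2:
    "\<forall>D T. D division_of T \<and> T \<subseteq> S \<and> (\<Sum>K\<in>D. Sup K - Inf K) < \<delta>2 \<longrightarrow>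
       (\<Sum>K\<in>D. norm (g (Sup K) - g (Inf K))) < e'"
    using mp[OF spec[OF g[unfolded abs_continuous_on_def]] \<open>e' > 0\<close>] by (elim exE conjE) (rule that)
  show "\<exists>\<delta>>0. \<forall>D T. D division_of T \<and> T \<subseteq> S \<and> (\<Sum>K\<in>D. Sup K - Inf K) < \<delta> \<longrightarrow>
       (\<Sum>K\<in>D. norm (h (Sup K) - h (Inf K))) < e"
  proof (rule exI[of _ "min \<delta>1 \<delta>2"], intro conjI allI impI)
    show "min \<delta>1 \<delta>2 > 0" using \<open>\<delta>1 > 0\<close> \<open>\<delta>2 > 0\<close> by simp
    fix D T assume DT: "D division_of T \<and> T \<subseteq> S \<and> (\<Sum>K\<in>D. Sup K - Inf K) < min \<delta>1 \<delta>2"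
    let ?F = "\<Sum>K\<in>D. norm (f (Sup K) - f (Inf K))" and ?G = "\<Sum>K\<in>D. norm (g (Sup K) - g (Inf K))"
    have F: "?F < e'" using \<delta>1[rule_format, of D T] DT by simp
    have G: "?G < e'" using \<delta>2[rule_format, of D T] DT by simp
    have "norm (h (Sup K) - h (Inf K)) \<le> \<bar>L\<bar> * norm (f (Sup K) - f (Inf K)) + \<bar>M\<bar> * norm (g (Sup K) - g (Inf K))"
      if KD: "K \<in> D" for K
    proof -
      have D: "D division_of T" using DT by simp
      obtain u v where K: "u \<le> v" "K = {u..v}" "K \<subseteq> T"
        using division_of_real_intervals[OF D KD] by metis
      have "T \<subseteq> S" using DT by simp
      from order_trans[OF K(3) this] have "{u..v} \<subseteq> S" unfolding K(2) .
      then have "u \<in> S" "v \<in> S" using K(1) by auto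
      have "norm (h v - h u) \<le> L * norm (f v - f u) + M * norm (g v - g u)"
        by (rule le) fact+
      also have "\<dots> \<le> \<bar>L\<bar> * norm (f v - f u) + \<bar>M\<bar> * norm (g v - g u)"
        by (intro add_mono mult_right_mono) auto
      finally show ?thesis using K by simp
    qed
    then have "(\<Sum>K\<in>D. norm (h (Sup K) - h (Inf K))) \<le> (\<Sum>K\<in>D. \<bar>L\<bar> * norm (f (Sup K) - f (Inf K)) + \<bar>M\<bar> * norm (g (Sup K) - g (Inf K)))"
      by (rule sum_mono)
    also have "\<dots> = \<bar>L\<bar> * ?F + \<bar>M\<bar> * ?G"
      by (simp add: sum.distrib sum_distrib_left)
    also have "\<dots> \<le> \<bar>L\<bar> * e' + \<bar>M\<bar> * e'"
      using F G by (intro add_mono mult_left_mono) auto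
    also have "\<dots> < e' * (\<bar>L\<bar> + \<bar>M\<bar> + 1)" using \<open>e' > 0\<close> by (simp add: algebra_simps)
    also have "\<dots> = e" by (simp add: e'_def add_nonneg_eq_0_iff)
    finally show "(\<Sum>K\<in>D. norm (h (Sup K) - h (Inf K))) < e" .
  qed
qed

lemma abs_continuous_on_const: "abs_continuous_on S (\<lambda>x. c)"
  unfolding abs_continuous_on_def by (auto intro: exI[of _ 1])

lemma abs_continuous_on_add:
  "abs_continuous_on S f \<Longrightarrow> abs_continuous_on S g \<Longrightarrow> abs_continuous_on S (\<lambda>x. f x + g x)"
  by (rule abs_continuous_on_dominated[of S f g _ 1 1]) (auto simp: add_diff_add norm_triangle_ineq)

section \<open>Frobenius norm, product and inverse of matrices\<close>

lemma norm_matrix_mult_le: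
  fixes A B :: "complex ^ 'n ^ 'n"
  shows "norm (A ** B) \<le> norm A * norm B"
proof -
  have row: "norm ((A ** B) $ i) \<le> norm (A $ i) * norm B" for i
  proof -
    \<comment> \<open>Row \<open>i\<close> of the product is a combination of the rows of
      \<open>B\<close>; the Cauchy-Schwarz inequality over \<open>k\<close> then gives the row
      bound.\<close>
    have "(A ** B) $ i = (\<Sum>k\<in>UNIV. A $ i $ k *s B $ k)"
      by (simp add: vec_eq_iff matrix_matrix_mult_def vector_scalar_mult_def)
    also have "norm \<dots> \<le> (\<Sum>k\<in>UNIV. norm (A $ i $ k) * norm (B $ k))"
    proof (rule sum_norm_le)
      fix k
      show "norm (A $ i $ k *s B $ k) \<le> norm (A $ i $ k) * norm (B $ k)"
        by (simp add: norm_vec_def L2_set_right_distrib norm_mult)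
    qed
    also have "\<dots> \<le> L2_set (\<lambda>k. norm (A $ i $ k)) UNIV * L2_set (\<lambda>k. norm (B $ k)) UNIV"
      using L2_set_mult_ineq[of "\<lambda>k. norm (A $ i $ k)" "\<lambda>k. norm (B $ k)" UNIV] by simp
    finally show ?thesis by (simp add: norm_vec_def)
  qed
  have "norm (A ** B) \<le> L2_set (\<lambda>i. norm (A $ i) * norm B) UNIV"
    unfolding norm_vec_def[of "A ** B"] by (rule L2_set_mono) (auto intro: row)
  also have "\<dots> = norm A * norm B"
    by (simp add: norm_vec_def[of A] L2_set_left_distrib)
  finally show ?thesis .
qed

lemma norm_matrix_vector_mult_le:
  fixes A :: "complex ^ 'n ^ 'n"
  shows "norm (A *v x) \<le> norm A * norm x"
proof -
  have row: "norm ((A *v x) $ i) \<le> norm (A $ i) * norm x" for i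
  proof -
    have "norm ((A *v x) $ i) \<le> (\<Sum>k\<in>UNIV. norm (A $ i $ k) * norm (x $ k))"
      unfolding matrix_vector_mult_def by (simp add: sum_norm_le norm_mult)
    also have "\<dots> \<le> norm (A $ i) * norm x"
      using L2_set_mult_ineq[of "\<lambda>k. norm (A $ i $ k)" "\<lambda>k. norm (x $ k)" UNIV] by (simp add: norm_vec_def)
    finally show ?thesis .
  qed
  have "norm (A *v x) \<le> L2_set (\<lambda>i. norm (A $ i) * norm x) UNIV"
    unfolding norm_vec_def[of "A *v x"] by (rule L2_set_mono) (auto intro: row)
  also have "\<dots> = norm A * norm x"
    by (simp add: norm_vec_def[of A] L2_set_left_distrib)
  finally show ?thesis .
qed

interpretation mat_mult: bounded_bilinear "(**) :: complex ^ 'n ^ 'n \<Rightarrow> complex ^ 'n ^ 'n \<Rightarrow> complex ^ 'n ^ 'n"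
proof
  fix A B C :: "complex ^ 'n ^ 'n" and r :: real
  show "(A + B) ** C = A ** C + B ** C" by (simp add: vec_eq_iff matrix_matrix_mult_def distrib_right sum.distrib)
  show "A ** (B + C) = A ** B + A ** C" by (simp add: matrix_add_ldistrib)
  show "(r *\<^sub>R A) ** B = r *\<^sub>R (A ** B)" "A ** (r *\<^sub>R B) = r *\<^sub>R (A ** B)"
    by (simp_all add: vec_eq_iff matrix_matrix_mult_def scaleR_sum_right)
  show "\<exists>K. \<forall>a b. norm ((a :: complex ^ 'n ^ 'n) ** (b :: complex ^ 'n ^ 'n)) \<le> norm a * norm b * K"
    by (rule exI[of _ 1]) (simp add: norm_matrix_mult_le)
qed

lemma matrix_inv_mult:
  fixes A :: "complex ^ 'n ^ 'n"
  assumes "invertible A"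
  shows "matrix_inv A ** A = mat 1" "A ** matrix_inv A = mat 1"
  using someI_ex[OF assms[unfolded invertible_def]] by (auto simp: matrix_inv_def)

lemma matrix_inv_mult_assoc:
  fixes A :: "complex ^ 'n ^ 'n"
  assumes "invertible A"
  shows "matrix_inv A ** (A ** B) = B" "A ** (matrix_inv A ** B) = B"
  by (simp_all add: matrix_mul_assoc matrix_inv_mult[OF assms])

lemma abs_continuous_on_matrix_mult:
  fixes f g :: "real \<Rightarrow> complex ^ 'n ^ 'n"
  assumes f: "abs_continuous_on {u..v} f" and g: "abs_continuous_on {u..v} g"
  shows "abs_continuous_on {u..v} (\<lambda>x. f x ** g x)"
proof -
  have "bounded (f ` {u..v})" "bounded (g ` {u..v})"
    using compact_continuous_image[OF abs_continuous_on_imp_continuous_on[OF f]]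
      compact_continuous_image[OF abs_continuous_on_imp_continuous_on[OF g]]
    by (auto intro: compact_imp_bounded)
  then obtain F G where F: "\<And>x. x \<in> {u..v} \<Longrightarrow> norm (f x) \<le> F" and G: "\<And>x. x \<in> {u..v} \<Longrightarrow> norm (g x) \<le> G"
    unfolding bounded_iff by (metis imageI)
  show ?thesis
  proof (rule abs_continuous_on_dominated[OF f g, of _ G F])
    fix x y assume x: "x \<in> {u..v}" and y: "y \<in> {u..v}"
    have "f y ** g y - f x ** g x = (f y - f x) ** g y + f x ** (g y - g x)"
      by (simp add: mat_mult.diff_left mat_mult.diff_right)
    also have "norm \<dots> \<le> norm (f y - f x) * norm (g y) + norm (f x) * norm (g y - g x)"
      by (intro order_trans[OF norm_triangle_ineq] add_mono norm_matrix_mult_le)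
    also have "\<dots> \<le> norm (f y - f x) * G + F * norm (g y - g x)"
      using F[OF x] G[OF y] by (intro add_mono mult_right_mono mult_left_mono) auto
    finally show "norm (f y ** g y - f x ** g x) \<le> G * norm (f y - f x) + F * norm (g y - g x)"
      by (simp add: mult_ac)
  qed
qed

text \<open>The identity \<open>inv Y - inv X = inv Y (X - Y) inv X\<close> is used twice: while
  \<open>f y\<close> is within \<open>1 / (2 c)\<close> of \<open>f x\<close> it first bounds the
  inverse at \<open>y\<close> by \<open>2 c\<close>, and then yields a Lipschitz estimate with
  constant \<open>2 c^2\<close>.\<close>

lemma continuous_on_matrix_inv:
  fixes f :: "'a::metric_space \<Rightarrow> complex ^ 'n ^ 'n"
  assumes f: "continuous_on S f" and inv: "\<And>x. x \<in> S \<Longrightarrow> invertible (f x)"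
  shows "continuous_on S (\<lambda>x. matrix_inv (f x))"
  unfolding continuous_on_def
proof
  fix x assume x: "x \<in> S"
  let ?i = "\<lambda>x. matrix_inv (f x)"
  define c where "c = norm (?i x) + 1"
  have "c > 0" by (simp add: c_def add_nonneg_pos)
  have fx: "(f \<longlongrightarrow> f x) (at x within S)" using f x by (simp add: continuous_on_def)
  have "\<forall>\<^sub>F y in at x within S. dist (f y) (f x) < inverse (2 * c)"
    using fx by (rule tendstoD) (use \<open>c > 0\<close> in simp)
  moreover have "\<forall>\<^sub>F y in at x within S. y \<in> S" by (simp add: eventually_at_filter)
  ultimately have ev: "\<forall>\<^sub>F y in at x within S. norm (?i y - ?i x) \<le> 2 * c\<^sup>2 * norm (f y - f x)"
  proof eventually_elim
    case (elim y)
    let ?d = "norm (f x - f y)"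
    have d: "?d \<le> inverse (2 * c)" using elim(1) by (simp add: dist_norm norm_minus_commute)
    have ix: "norm (?i x) \<le> c" by (simp add: c_def)
    have eq: "?i y - ?i x = ?i y ** (f x - f y) ** ?i x"
      using matrix_inv_mult[OF inv[OF x]] matrix_inv_mult[OF inv[OF elim(2)]]
      by (simp add: mat_mult.diff_left mat_mult.diff_right matrix_mul_assoc[symmetric]) 
    have le: "norm (?i y - ?i x) \<le> norm (?i y) * ?d * c"
      unfolding eq
      by (intro order_trans[OF norm_matrix_mult_le] mult_mono ix order_trans[OF norm_matrix_mult_le]) auto
    also have "\<dots> \<le> norm (?i y) * inverse (2 * c) * c"
      using d \<open>c > 0\<close> by (intro mult_right_mono mult_left_mono) auto
    also have "\<dots> = norm (?i y) / 2" using \<open>c > 0\<close> by (simp add: field_simps)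
    finally have "norm (?i y) \<le> 2 * c"
      using ix norm_triangle_sub[of "?i y" "?i x"] by linarith
    then have "norm (?i y) * ?d * c \<le> 2 * c * ?d * c"
      using \<open>c > 0\<close> by (intro mult_right_mono) auto
    with le show ?case by (simp add: power2_eq_square norm_minus_commute mult_ac)
  qed
  have "((\<lambda>y. 2 * c\<^sup>2 * norm (f y - f x)) \<longlongrightarrow> 2 * c\<^sup>2 * norm (f x - f x)) (at x within S)"
    by (intro tendsto_intros fx)
  then have "((\<lambda>y. ?i y - ?i x) \<longlongrightarrow> 0) (at x within S)"
    by (intro Lim_null_comparison[OF ev]) simp
  then show "(?i \<longlongrightarrow> ?i x) (at x within S)"
    by (simp add: LIM_zero_iff)
qed

subsection \<open>Solutions of linear differential equations\<close>

lemma absolutely_integrable_matrix_mult_left: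
  fixes A F :: "real \<Rightarrow> complex ^ 'n ^ 'n"
  assumes A: "A absolutely_integrable_on {a..b}" and F: "continuous_on {a..b} F"
  shows "(\<lambda>x. F x ** A x) absolutely_integrable_on {a..b}"
proof (rule absolutely_integrable_bounded_measurable_product[where h = "(**)" and f = F and g = A])
  show "bilinear ((**) :: complex ^ 'n ^ 'n \<Rightarrow> complex ^ 'n ^ 'n \<Rightarrow> complex ^ 'n ^ 'n)"
    unfolding bilinear_conv_bounded_bilinear by (rule mat_mult.bounded_bilinear_axioms)
  show "F \<in> borel_measurable (lebesgue_on {a..b})"
    using F by (rule continuous_imp_measurable_on_sets_lebesgue) simp
  show "bounded (F ` {a..b})"
    using compact_continuous_image[OF F] by (simp add: compact_imp_bounded)
qed (use A in simp_all)

lemma absolutely_integrable_matrix_mult_right: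
  fixes A F :: "real \<Rightarrow> complex ^ 'n ^ 'n"
  assumes A: "A absolutely_integrable_on {a..b}" and F: "continuous_on {a..b} F"
  shows "(\<lambda>x. A x ** F x) absolutely_integrable_on {a..b}"
proof (rule absolutely_integrable_bounded_measurable_product[where h = "\<lambda>x y. y ** x" and f = F and g = A])
  show "bilinear (\<lambda>x y. (y :: complex ^ 'n ^ 'n) ** (x :: complex ^ 'n ^ 'n))"
    unfolding bilinear_conv_bounded_bilinear by (rule mat_mult.flip)
  show "F \<in> borel_measurable (lebesgue_on {a..b})"
    using F by (rule continuous_imp_measurable_on_sets_lebesgue) simp
  show "bounded (F ` {a..b})"
    using compact_continuous_image[OF F] by (simp add: compact_imp_bounded)
qed (use A in simp_all)

lemma absolutely_integrable_mult_continuous: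
  fixes r y :: "real \<Rightarrow> real"
  assumes "r absolutely_integrable_on {a..b}" "continuous_on {a..b} y"
  shows "(\<lambda>x. r x * y x) absolutely_integrable_on {a..b}"
proof -
  have "(\<lambda>x. y x * r x) absolutely_integrable_on {a..b}"
  proof (rule absolutely_integrable_bounded_measurable_product_real[OF _ _ _ assms(1)])
    show "y \<in> borel_measurable (lebesgue_on {a..b})"
      using assms(2) by (rule continuous_imp_measurable_on_sets_lebesgue) simp
    show "bounded (y ` {a..b})"
      using compact_continuous_image[OF assms(2)] by (simp add: compact_imp_bounded)
  qed simp
  then show ?thesis by (simp add: mult.commute)
qed

lemma absolutely_integrable_norm':
  fixes f :: "real \<Rightarrow> 'a::euclidean_space"
  shows "f absolutely_integrable_on S \<Longrightarrow> (\<lambda>x. norm (f x)) absolutely_integrable_on S"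
  using absolutely_integrable_norm[where f = f and S = S] by (simp add: o_def)

lemmas absolutely_integrable_imp_integrable_on = set_lebesgue_integral_eq_integral(1)

lemma absolutely_integrable_on_half_line:
  fixes f :: "real \<Rightarrow> 'a::euclidean_space" and g :: "real \<Rightarrow> real"
  assumes f: "\<And>b. f integrable_on {0..b}" and g: "g integrable_on {0..}"
    and le: "\<And>t. t \<ge> 0 \<Longrightarrow> norm (f t) \<le> g t"
  shows "f absolutely_integrable_on {0..}"
proof (rule absolutely_integrable_integrable_bound[OF _ _ g])
  show "f integrable_on {0..}"
  proof (rule integrable_on_all_intervals_integrable_bound[OF _ _ g])
    show "(\<lambda>t. if t \<in> {0..} then f t else 0) integrable_on cbox u v" for u v :: real
    proof -
      have "f integrable_on {max 0 u..v}" using f by (rule integrable_on_subinterval) auto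
      moreover have "{0..} \<inter> cbox u v = {max 0 u..v}" by (auto simp: cbox_interval)
      ultimately show ?thesis unfolding integrable_restrict_Int by simp
    qed
  qed (simp add: le)
qed (simp add: le)

lemma continuous_on_of_bounded_intervals:
  fixes f :: "real \<Rightarrow> 'a::topological_space"
  assumes cont: "\<And>b. continuous_on {-b<..<b} f"
  shows "continuous_on S f"
proof -
  have "isCont f x" for x
  proof -
    have "x \<in> {-(\<bar>x\<bar>+1)<..<\<bar>x\<bar>+1}" unfolding greaterThanLessThan_iff by linarith
    then show ?thesis
      using continuous_on_interior[OF cont[of "\<bar>x\<bar>+1"], of x]
      by (simp only: interior_open[OF open_greaterThanLessThan])
  qed
  then show ?thesis by (simp add: continuous_at_imp_continuous_on)
qed

lemma is_solution_subset:
  assumes Y: "is_solution A J Y" and sub: "J' \<subseteq> J"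
  shows "is_solution A J' Y"
  unfolding is_solution_def
proof
  show "locally_abs_continuous_on J' Y"
    using Y sub unfolding is_solution_def locally_abs_continuous_on_def by (meson order_trans)
  have "AE x in lebesgue. x \<in> J \<longrightarrow> (Y has_vector_derivative A x ** Y x) (at x within J)"
    using Y by (simp add: is_solution_def)
  then show "AE x in lebesgue. x \<in> J' \<longrightarrow> (Y has_vector_derivative A x ** Y x) (at x within J')"
    by eventually_elim (use sub has_vector_derivative_within_subset in blast)
qed

lemma is_solution_imp_abs_continuous_on:
  "is_solution A J Y \<Longrightarrow> {a..b} \<subseteq> J \<Longrightarrow> abs_continuous_on {a..b} Y"
  by (simp add: is_solution_def locally_abs_continuous_on_def)

lemma is_solution_imp_continuous_on:
  "is_solution A J Y \<Longrightarrow> {a..b} \<subseteq> J \<Longrightarrow> continuous_on {a..b} Y"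
  by (rule abs_continuous_on_imp_continuous_on[OF is_solution_imp_abs_continuous_on])

lemma is_solution_has_integral:
  assumes "is_solution A J Y" and "{a..b} \<subseteq> J" and "a \<le> b"
  shows "((\<lambda>x. A x ** Y x) has_integral (Y b - Y a)) {a..b}"
proof (rule abs_continuous_has_integral)
  have *: "is_solution A {a..b} Y" using assms is_solution_subset by blast
  then show "abs_continuous_on {a..b} Y" by (rule is_solution_imp_abs_continuous_on) simp
  show "AE x in lebesgue. x \<in> {a..b} \<longrightarrow> (Y has_vector_derivative A x ** Y x) (at x within {a..b})"
    using * by (simp add: is_solution_def)
qed fact

text \<open>This identity is what exponential weights are for: integrating \<open>r\<close> against
  the weight of rate \<open>K\<close> reproduces the weight up to a factor \<open>1 / K\<close>. The
  antiderivative \<open>- exp (K * integral {t..b} r) / K\<close> is absolutely continuous and obeys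
  the chain rule almost everywhere, which suffices for an \<open>r\<close> that is merely
  integrable.\<close>

lemma has_integral_exp_integral:
  fixes r :: "real \<Rightarrow> real"
  assumes r: "r absolutely_integrable_on {a..b}" and "a \<le> b" and "K > 0" and r0: "\<And>t. r t \<ge> 0"
  shows "((\<lambda>t. r t * exp (K * integral {t..b} r)) has_integral ((exp (K * integral {a..b} r) - 1) / K)) {a..b}"
proof -
  define I where "I = integral {a..b} r"
  define F where "F t = integral {a..t} r" for t
  have ri: "r integrable_on {a..b}" using r by (rule absolutely_integrable_imp_integrable_on)
  have F: "integral {t..b} r = I - F t" "0 \<le> F t" if "t \<in> {a..b}" for t
  proof -
    have "F t + integral {t..b} r = I"
      unfolding F_def I_def using that ri by (intro Henstock_Kurzweil_Integration.integral_combine) auto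
    then show "integral {t..b} r = I - F t" by simp
    show "0 \<le> F t" unfolding F_def
      using that by (intro integral_nonneg integrable_on_subinterval[OF ri] r0) auto
  qed
  have Fac: "abs_continuous_on {a..b} F"
    unfolding F_def by (rule abs_continuous_on_integral[OF r])
  define h where "h t = - exp (K * (I - F t)) / K" for t
  have "((\<lambda>t. r t * exp (K * (I - F t))) has_integral (h b - h a)) {a..b}"
  proof (rule abs_continuous_has_integral[OF \<open>a \<le> b\<close>])
    show "abs_continuous_on {a..b} h"
    proof (rule abs_continuous_on_dominated[OF Fac Fac, of _ "exp (K * I)" 0])
      fix x y assume xy: "x \<in> {a..b}" "y \<in> {a..b}"
      \<comment> \<open>Lipschitz bound for the exponential on the range of the indefinite integral,
        from \<open>1 - exp (- s) \<le> s\<close>.\<close>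
      have mono: "\<bar>exp (K * (I - v)) - exp (K * (I - u))\<bar> \<le> exp (K * I) * (K * (v - u))"
        if "0 \<le> u" "u \<le> v" for u v
      proof -
        have "1 - exp (- (K * (v - u))) \<le> K * (v - u)"
          using exp_ge_add_one_self[of "- (K * (v - u))"] by linarith
        moreover have "exp (K * (I - v)) = exp (K * (I - u)) * exp (- (K * (v - u)))"
          by (simp add: exp_add[symmetric] algebra_simps)
        moreover have "exp (K * (I - u)) \<le> exp (K * I)" using that \<open>K > 0\<close> by simp
        moreover have "exp (K * (I - v)) \<le> exp (K * (I - u))" using that \<open>K > 0\<close> by simp
        moreover have "exp (K * (I - u)) * (1 - exp (- (K * (v - u)))) \<le> exp (K * I) * (K * (v - u))"
          using that \<open>K > 0\<close> calculation by (intro mult_mono) auto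
        ultimately show ?thesis by (simp add: algebra_simps)
      qed
      have *: "\<bar>exp (K * (I - F y)) - exp (K * (I - F x))\<bar> \<le> exp (K * I) * (K * \<bar>F y - F x\<bar>)"
      proof (cases "F x \<le> F y")
        case True
        then show ?thesis using mono[of "F x" "F y"] F(2) xy by simp
      next
        case False
        then show ?thesis using mono[of "F y" "F x"] F(2) xy by (simp add: abs_minus_commute)
      qed
      have "norm (h y - h x) = \<bar>exp (K * (I - F y)) - exp (K * (I - F x))\<bar> / K"
        using \<open>K > 0\<close> by (simp add: h_def abs_minus_commute diff_divide_distrib[symmetric])
      also have "\<dots> \<le> (exp (K * I) * (K * \<bar>F y - F x\<bar>)) / K"
        using * \<open>K > 0\<close> by (intro divide_right_mono) auto
      also have "\<dots> = exp (K * I) * norm (F y - F x) + 0 * norm (F y - F x)"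
        using \<open>K > 0\<close> by simp
      finally show "norm (h y - h x) \<le> exp (K * I) * norm (F y - F x) + 0 * norm (F y - F x)" .
    qed
    have "AE x in lebesgue. x \<noteq> a \<and> x \<noteq> b"
      by (intro AE_conjI AE_lborel_singleton AE_completion)
    moreover have "AE x in lebesgue. x \<in> {a<..<b} \<longrightarrow> (F has_vector_derivative r x) (at x)"
      unfolding F_def by (rule AE_has_vector_derivative_integral[OF ri])
    ultimately show "AE x in lebesgue. x \<in> {a..b} \<longrightarrow> (h has_vector_derivative r x * exp (K * (I - F x))) (at x within {a..b})"
    proof eventually_elim
      case (elim x)
      show ?case
      proof
        assume "x \<in> {a..b}"
        with elim have "(F has_real_derivative r x) (at x)"
          by (simp add: has_real_derivative_iff_has_vector_derivative)
        then have "(h has_real_derivative r x * exp (K * (I - F x))) (at x)"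
          unfolding h_def using \<open>K > 0\<close> by (auto intro!: derivative_eq_intros simp: field_simps)
        then show "(h has_vector_derivative r x * exp (K * (I - F x))) (at x within {a..b})"
          unfolding has_real_derivative_iff_has_vector_derivative by (rule has_vector_derivative_at_within)
      qed
    qed
  qed
  moreover have "h b - h a = (exp (K * I) - 1) / K"
    using F(1)[of b] \<open>a \<le> b\<close> by (simp add: h_def F_def I_def diff_divide_distrib)
  ultimately show ?thesis
    unfolding I_def[symmetric] by (rule_tac has_integral_eq) (auto simp: F(1))
qed

lemma continuous_on_exp_integral:
  fixes r :: "real \<Rightarrow> real"
  assumes r: "r integrable_on {a..b}"
  shows "continuous_on {a..b} (\<lambda>t. exp (K * integral {t..b} r))"
  by (intro continuous_intros indefinite_integral_continuous_1' r)

text \<open>Measured against the weight of rate 2, the integral operator has norm at most 1/2. At a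
  maximum point of \<open>y / h\<close> the maximum \<open>m\<close> therefore satisfies
  \<open>m \<le> m / 2\<close>.\<close>

lemma gronwall_zero:
  fixes y r :: "real \<Rightarrow> real"
  assumes r: "r absolutely_integrable_on {a..b}" and r0: "\<And>t. r t \<ge> 0"
    and y: "continuous_on {a..b} y" and y0: "\<And>t. t \<in> {a..b} \<Longrightarrow> y t \<ge> 0"
    and le: "\<And>t. t \<in> {a..b} \<Longrightarrow> y t \<le> integral {t..b} (\<lambda>s. r s * y s)"
    and x: "x \<in> {a..b}"
  shows "y x = 0"
proof -
  have ri: "r integrable_on {a..b}" using r by (rule absolutely_integrable_imp_integrable_on)
  define h where "h t = exp (2 * integral {t..b} r)" for t
  have hc: "continuous_on {a..b} h" unfolding h_def by (rule continuous_on_exp_integral[OF ri])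
  have hpos: "h t > 0" for t by (simp add: h_def)
  have "continuous_on {a..b} (\<lambda>t. y t / h t)"
    using hpos by (intro continuous_on_divide y hc) (auto simp: less_imp_neq[symmetric])
  then obtain z where z: "z \<in> {a..b}" and zmax: "\<And>t. t \<in> {a..b} \<Longrightarrow> y t / h t \<le> y z / h z"
    using continuous_attains_sup[of "{a..b}" "\<lambda>t. y t / h t"] x by auto
  define m where "m = y z / h z"
  have m0: "m \<ge> 0" using y0[OF z] hpos[of z] by (simp add: m_def)
  have ym: "y t \<le> m * h t" if "t \<in> {a..b}" for t
    using zmax[OF that] hpos[of t] by (simp add: m_def field_simps)
  have sub: "{z..b} \<subseteq> {a..b}" using z by auto
  have rz: "r absolutely_integrable_on {z..b}"
    using r sub by (auto intro: absolutely_integrable_on_subinterval)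
  have "((\<lambda>t. r t * h t) has_integral ((h z - 1) / 2)) {z..b}"
    unfolding h_def using has_integral_exp_integral[OF rz _ _ r0, of 2] z by simp
  then have rh: "((\<lambda>t. m * (r t * h t)) has_integral (m * ((h z - 1) / 2))) {z..b}"
    by (rule has_integral_mult_right)
  have "y z \<le> integral {z..b} (\<lambda>s. r s * y s)" by (rule le[OF z])
  also have "\<dots> \<le> integral {z..b} (\<lambda>t. m * (r t * h t))"
  proof (rule integral_le)
    show "(\<lambda>s. r s * y s) integrable_on {z..b}"
      by (intro absolutely_integrable_imp_integrable_on absolutely_integrable_mult_continuous rz
          continuous_on_subset[OF y sub])
    show "(\<lambda>t. m * (r t * h t)) integrable_on {z..b}" using rh by blast
    fix t assume "t \<in> {z..b}"
    then have "y t \<le> m * h t" using sub by (intro ym) auto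
    then show "r t * y t \<le> m * (r t * h t)"
      using mult_left_mono[of "y t" "m * h t" "r t"] r0[of t] by (simp add: mult_ac)
  qed
  also have "\<dots> = m * ((h z - 1) / 2)" using rh by (rule integral_unique)
  also have "\<dots> \<le> m * (h z / 2)" using m0 by (intro mult_left_mono) auto
  finally have "m * h z \<le> m * h z / 2" using hpos[of z] by (simp add: m_def)
  then have "m * h z \<le> 0" by simp
  then have "m = 0" using m0 hpos[of z] by (simp add: mult_le_0_iff)
  then show ?thesis using ym[OF x] y0[OF x] by simp
qed

lemma gronwall_zero_right:
  fixes y r :: "real \<Rightarrow> real"
  assumes r: "r absolutely_integrable_on {a..b}" and r0: "\<And>t. r t \<ge> 0"
    and y: "continuous_on {a..b} y" and y0: "\<And>t. t \<in> {a..b} \<Longrightarrow> y t \<ge> 0"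
    and le: "\<And>t. t \<in> {a..b} \<Longrightarrow> y t \<le> integral {a..t} (\<lambda>s. r s * y s)"
    and x: "x \<in> {a..b}"
  shows "y x = 0"
proof -
  have "y (- (- x)) = 0"
  proof (rule gronwall_zero[where r = "\<lambda>t. r (- t)" and a = "-b" and b = "-a" and y = "\<lambda>t. y (- t)" and x = "- x"])
    show "(\<lambda>t. r (- t)) absolutely_integrable_on {- b..- a}" using r by simp
    show "continuous_on {- b..- a} (\<lambda>t. y (- t))"
      by (rule continuous_on_compose2[OF y]) (auto intro: continuous_intros)
    show "y (- t) \<le> integral {t..- a} (\<lambda>s. r (- s) * y (- s))" if "t \<in> {- b..- a}" for t
      using le[of "- t"] that Henstock_Kurzweil_Integration.integral_reflect_real[of "-t" "a" "\<lambda>s. r s * y s"] by simp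
  qed (use x y0 r0 in auto)
  then show ?thesis by simp
qed

lemma solution_zero:
  fixes A Y :: "real \<Rightarrow> complex ^ 'n ^ 'n"
  assumes A: "loc_integrable A" and Y: "is_solution A {a..b} Y" and c: "c \<in> {a..b}" "Y c = 0" and x: "x \<in> {a..b}"
  shows "Y x = 0"
proof -
  have rA: "(\<lambda>t. norm (A t)) absolutely_integrable_on {u..v}" for u v
    using A by (auto simp: loc_integrable_def intro: absolutely_integrable_norm')
  have bound: "norm (Y v - Y u) \<le> integral {u..v} (\<lambda>s. norm (A s) * norm (Y s))"
    if "u \<le> v" "{u..v} \<subseteq> {a..b}" for u v
  proof -
    have hi: "((\<lambda>s. A s ** Y s) has_integral (Y v - Y u)) {u..v}"
      by (rule is_solution_has_integral[OF Y that(2,1)])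
    have c: "continuous_on {u..v} Y" by (rule is_solution_imp_continuous_on[OF Y that(2)])
    have "norm (integral {u..v} (\<lambda>s. A s ** Y s)) \<le> integral {u..v} (\<lambda>s. norm (A s) * norm (Y s))"
      by (intro integral_norm_bound_integral has_integral_integrable[OF hi] absolutely_integrable_imp_integrable_on
          absolutely_integrable_mult_continuous rA continuous_on_norm c norm_matrix_mult_le)
    then show ?thesis using integral_unique[OF hi] by simp
  qed
  have cY: "continuous_on {a..b} (\<lambda>t. norm (Y t))"
    by (intro continuous_on_norm is_solution_imp_continuous_on[OF Y]) simp
  have "norm (Y x) = 0"
  proof (cases "x \<le> c")
    case True
    show ?thesis
    proof (rule gronwall_zero[where r = "\<lambda>t. norm (A t)" and y = "\<lambda>t. norm (Y t)" and a = x and b = c])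
      show "continuous_on {x..c} (\<lambda>t. norm (Y t))"
        using c x by (intro continuous_on_subset[OF cY]) auto
      show "norm (Y t) \<le> integral {t..c} (\<lambda>s. norm (A s) * norm (Y s))" if "t \<in> {x..c}" for t
        using bound[of t c] c x that by simp
    qed (use True rA in auto)
  next
    case False
    show ?thesis
    proof (rule gronwall_zero_right[where r = "\<lambda>t. norm (A t)" and y = "\<lambda>t. norm (Y t)" and a = c and b = x])
      show "continuous_on {c..x} (\<lambda>t. norm (Y t))"
        using c x by (intro continuous_on_subset[OF cY]) auto
      show "norm (Y t) \<le> integral {c..t} (\<lambda>s. norm (A s) * norm (Y s))" if "t \<in> {c..x}" for t
        using bound[of c t] c x that by simp
    qed (use False rA in auto)
  qed
  then show ?thesis by simp
qed

lemma abs_continuous_on_diff: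
  assumes "abs_continuous_on S f" "abs_continuous_on S g"
  shows "abs_continuous_on S (\<lambda>x. f x - g x)"
proof (rule abs_continuous_on_dominated[OF assms, of _ 1 1])
  fix x y
  have "f y - g y - (f x - g x) = (f y - f x) - (g y - g x)" by simp
  then show "norm (f y - g y - (f x - g x)) \<le> 1 * norm (f y - f x) + 1 * norm (g y - g x)"
    by (metis mult_1 norm_triangle_ineq4)
qed

lemma is_solution_diff:
  assumes "is_solution A J Y" "is_solution A J Z"
  shows "is_solution A J (\<lambda>x. Y x - Z x)"
  unfolding is_solution_def
proof
  show "locally_abs_continuous_on J (\<lambda>x. Y x - Z x)"
    unfolding locally_abs_continuous_on_def
  proof (intro allI impI)
    fix a b assume "{a..b} \<subseteq> J"
    then have "abs_continuous_on {a..b} Y" "abs_continuous_on {a..b} Z"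
      using assms is_solution_imp_abs_continuous_on by blast+
    then show "abs_continuous_on {a..b} (\<lambda>x. Y x - Z x)"
      by (rule abs_continuous_on_diff)
  qed
  have "AE x in lebesgue. x \<in> J \<longrightarrow> (Y has_vector_derivative A x ** Y x) (at x within J)"
    "AE x in lebesgue. x \<in> J \<longrightarrow> (Z has_vector_derivative A x ** Z x) (at x within J)"
    using assms by (simp_all add: is_solution_def)
  then show "AE x in lebesgue. x \<in> J \<longrightarrow> ((\<lambda>x. Y x - Z x) has_vector_derivative A x ** (Y x - Z x)) (at x within J)"
    by eventually_elim (auto simp: mat_mult.diff_right intro: has_vector_derivative_diff)
qed

lemma has_vector_derivative_matrix_mult:
  fixes f g :: "real \<Rightarrow> complex ^ 'n ^ 'n"
  assumes "(f has_vector_derivative f') (at x within S)" "(g has_vector_derivative g') (at x within S)"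
  shows "((\<lambda>x. f x ** g x) has_vector_derivative (f x ** g' + f' ** g x)) (at x within S)"
  using mat_mult.has_vector_derivative[OF assms] .

lemma is_solution_mult_const:
  assumes Y: "is_solution A J Y"
  shows "is_solution A J (\<lambda>x. Y x ** M)"
  unfolding is_solution_def
proof
  show "locally_abs_continuous_on J (\<lambda>x. Y x ** M)"
    using Y unfolding is_solution_def locally_abs_continuous_on_def
    by (auto intro: abs_continuous_on_matrix_mult abs_continuous_on_const)
  have "AE x in lebesgue. x \<in> J \<longrightarrow> (Y has_vector_derivative A x ** Y x) (at x within J)"
    using Y by (simp add: is_solution_def)
  then show "AE x in lebesgue. x \<in> J \<longrightarrow> ((\<lambda>x. Y x ** M) has_vector_derivative A x ** (Y x ** M)) (at x within J)"
  proof eventually_elim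
    case (elim x)
    then show ?case
      using has_vector_derivative_matrix_mult[where g = "\<lambda>x. M" and g' = 0 and f = Y and x = x and S = J]
      by (auto simp: matrix_mul_assoc)
  qed
qed

lemma solution_unique:
  fixes A Y :: "real \<Rightarrow> complex ^ 'n ^ 'n"
  assumes A: "loc_integrable A" and Y: "is_solution A {a..b} Y" and Z: "is_solution A {a..b} Z"
    and c: "c \<in> {a..b}" "Y c = Z c" and x: "x \<in> {a..b}"
  shows "Y x = Z x"
  using solution_zero[OF A is_solution_diff[OF Y Z] c(1) _ x] c(2) by simp

text \<open>A kernel vector of \<open>\<Phi> x\<close>, repeated in every column, gives a matrix
  \<open>M\<close> for which the solution \<open>\<Phi> ** M\<close> vanishes at \<open>x\<close>.
  By uniqueness it vanishes at 0 as well, where it equals \<open>M\<close>.\<close>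

lemma invertible_fundamental_solution:
  fixes A \<Phi> :: "real \<Rightarrow> complex ^ 'n ^ 'n"
  assumes A: "loc_integrable A" and F: "fundamental_solution A \<Phi>"
  shows "invertible (\<Phi> x)"
proof (rule ccontr)
  assume "\<not> invertible (\<Phi> x)"
  then have "\<not> (\<exists>B. B ** \<Phi> x = mat 1)" by (simp add: invertible_left_inverse)
  then obtain v where v: "\<Phi> x *v v = 0" "v \<noteq> 0" by (auto simp: matrix_left_invertible_ker)
  define M :: "complex ^ 'n ^ 'n" where "M = (\<chi> i j. v $ i)"
  have "(\<Phi> x ** M) $ i $ j = (\<Phi> x *v v) $ i" for i j
    by (simp add: M_def matrix_matrix_mult_def matrix_vector_mult_def)
  then have M: "\<Phi> x ** M = 0" using v(1) by (simp add: vec_eq_iff)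
  have "is_solution A UNIV (\<lambda>x. \<Phi> x ** M)"
    using F by (intro is_solution_mult_const) (simp add: fundamental_solution_def)
  then have "is_solution A {min 0 x..max 0 x} (\<lambda>x. \<Phi> x ** M)" by (rule is_solution_subset) simp
  then have "\<Phi> 0 ** M = 0" by (rule solution_zero[OF A, where c = x]) (auto simp: M)
  then have "M = 0" using F by (simp add: fundamental_solution_def)
  then have "v = 0" by (simp add: M_def vec_eq_iff)
  with v show False by simp
qed

lemma fundamental_solution_imp_is_solution:
  "fundamental_solution A \<Phi> \<Longrightarrow> is_solution A J \<Phi>"
  unfolding fundamental_solution_def using is_solution_subset by blast

lemma continuous_on_fundamental_solution:
  fixes A \<Phi> :: "real \<Rightarrow> complex ^ 'n ^ 'n"
  assumes "fundamental_solution A \<Phi>"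
  shows "continuous_on S \<Phi>"
proof (rule continuous_on_of_bounded_intervals)
  show "continuous_on {-b<..<b} \<Phi>" for b :: real
    using is_solution_imp_continuous_on[OF fundamental_solution_imp_is_solution[OF assms, of UNIV], of "-b" b]
    by (rule continuous_on_subset) auto
qed

lemma solution_eq_fundamental_solution:
  fixes A Y :: "real \<Rightarrow> complex ^ 'n ^ 'n"
  assumes A: "loc_integrable A" and F: "fundamental_solution A \<Phi>" and Y: "is_solution A {0..} Y" and "x \<ge> 0"
  shows "Y x = \<Phi> x ** Y 0"
proof (rule solution_unique[OF A, where Y = Y and Z = "\<lambda>x. \<Phi> x ** Y 0" and a = 0 and b = x and c = 0])
  show "is_solution A {0..x} Y" using Y by (rule is_solution_subset) auto
  show "is_solution A {0..x} (\<lambda>x. \<Phi> x ** Y 0)"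
    by (intro is_solution_mult_const fundamental_solution_imp_is_solution[OF F])
  show "Y 0 = \<Phi> 0 ** Y 0" using F by (simp add: fundamental_solution_def)
qed (use \<open>x \<ge> 0\<close> in auto)

section \<open>Variation of constants\<close>

lemma indefinite_integral_half_line:
  fixes g :: "real \<Rightarrow> complex ^ 'n ^ 'n"
  assumes g: "\<And>b. g absolutely_integrable_on {0..b}"
  shows "\<And>a b. {a..b} \<subseteq> {0..} \<Longrightarrow> abs_continuous_on {a..b} (\<lambda>x. c + integral {0..x} g)"
    and "AE x in lebesgue. x \<in> {0..} \<longrightarrow> ((\<lambda>x. c + integral {0..x} g) has_vector_derivative g x) (at x within {0..})"
proof -
  fix a b :: real assume ab: "{a..b} \<subseteq> {0..}"
  have "abs_continuous_on {0..b} (\<lambda>x. c + integral {0..x} g)"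
    by (intro abs_continuous_on_add abs_continuous_on_const abs_continuous_on_integral g)
  then show "abs_continuous_on {a..b} (\<lambda>x. c + integral {0..x} g)"
    by (rule abs_continuous_on_subset) (use ab in auto)
next
  have "AE x in lebesgue. \<forall>n. x \<in> {0<..<real n} \<longrightarrow> ((\<lambda>x. integral {0..x} g) has_vector_derivative g x) (at x)"
    unfolding AE_all_countable
    by (intro allI AE_has_vector_derivative_integral absolutely_integrable_imp_integrable_on g)
  moreover have "AE x in lebesgue. x \<noteq> (0::real)"
    by (intro AE_lborel_singleton AE_completion)
  ultimately show "AE x in lebesgue. x \<in> {0..} \<longrightarrow> ((\<lambda>x. c + integral {0..x} g) has_vector_derivative g x) (at x within {0..})"
  proof eventually_elim
    case (elim x)
    show ?case
    proof
      assume "x \<in> {0..}"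
      moreover obtain n where "x < real n" using reals_Archimedean2 by blast
      ultimately have "((\<lambda>x. integral {0..x} g) has_vector_derivative g x) (at x)" using elim by auto
      then have "((\<lambda>x. c + integral {0..x} g) has_vector_derivative (0 + g x)) (at x)"
        by (intro has_vector_derivative_add has_vector_derivative_const)
      then show "((\<lambda>x. c + integral {0..x} g) has_vector_derivative g x) (at x within {0..})"
        by (simp add: has_vector_derivative_at_within)
    qed
  qed
qed

text \<open>The product rule for the variation of constants ansatz, with inhomogeneity
  \<open>\<Phi> ** g\<close>. It serves both to represent a given solution and to verify that a
  constructed function is one.\<close>

lemma fundamental_solution_mult_integral:
  fixes A \<Phi> g :: "real \<Rightarrow> complex ^ 'n ^ 'n" and c :: "complex ^ 'n ^ 'n"
  assumes F: "fundamental_solution A \<Phi>" and g: "\<And>b. g absolutely_integrable_on {0..b}"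
  defines "E \<equiv> \<lambda>x. \<Phi> x ** (c + integral {0..x} g)"
  shows "locally_abs_continuous_on {0..} E"
    and "AE x in lebesgue. x \<in> {0..} \<longrightarrow> (E has_vector_derivative (A x ** E x + \<Phi> x ** g x)) (at x within {0..})"
proof -
  have F': "is_solution A {0..} \<Phi>" by (rule fundamental_solution_imp_is_solution[OF F])
  show "locally_abs_continuous_on {0..} E"
    unfolding locally_abs_continuous_on_def E_def
    by (intro allI impI abs_continuous_on_matrix_mult indefinite_integral_half_line(1) g
        is_solution_imp_abs_continuous_on[OF F'])
  have "AE x in lebesgue. x \<in> {0..} \<longrightarrow> (\<Phi> has_vector_derivative A x ** \<Phi> x) (at x within {0..})"
    using F' by (simp add: is_solution_def)
  with indefinite_integral_half_line(2)[of g c, OF g]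
  show "AE x in lebesgue. x \<in> {0..} \<longrightarrow> (E has_vector_derivative (A x ** E x + \<Phi> x ** g x)) (at x within {0..})"
  proof eventually_elim
    case (elim x)
    show ?case
    proof
      assume "x \<in> {0..}"
      with has_vector_derivative_matrix_mult[of \<Phi> "A x ** \<Phi> x" x "{0..}"] elim
      have "(E has_vector_derivative (\<Phi> x ** g x + (A x ** \<Phi> x) ** (c + integral {0..x} g))) (at x within {0..})"
        unfolding E_def by blast
      then show "(E has_vector_derivative (A x ** E x + \<Phi> x ** g x)) (at x within {0..})"
        by (simp add: E_def matrix_mul_assoc add.commute)
    qed
  qed
qed

text \<open>\<open>D\<close> and the right-hand side satisfy the same inhomogeneous equation with
  source \<open>R ** D\<close> and agree at 0, so their difference is a solution of the unperturbed
  equation with initial value 0.\<close>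

lemma variation_of_constants:
  fixes A \<Phi> D s :: "real \<Rightarrow> complex ^ 'n ^ 'n"
  assumes A: "loc_integrable A" and F: "fundamental_solution A \<Phi>" and R: "\<And>b. R absolutely_integrable_on {0..b}"
    and D: "is_solution (\<lambda>x. A x + R x) {0..} D" and x: "x \<ge> 0"
  shows "D x = \<Phi> x ** (D 0 + integral {0..x} (\<lambda>t. matrix_inv (\<Phi> t) ** (R t ** D t)))"
proof -
  define g where "g t = matrix_inv (\<Phi> t) ** (R t ** D t)" for t
  note inv = invertible_fundamental_solution[OF A F]
  have g: "g absolutely_integrable_on {0..b}" for b
    unfolding g_def
    by (intro absolutely_integrable_matrix_mult_left absolutely_integrable_matrix_mult_right R
        continuous_on_matrix_inv inv continuous_on_fundamental_solution[OF F] is_solution_imp_continuous_on[OF D]) auto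
  define E where "E x = \<Phi> x ** (D 0 + integral {0..x} g)" for x
  note E = fundamental_solution_mult_integral[OF F g, of "D 0", folded E_def]
  define Z where "Z x = D x - E x" for x
  have "is_solution A {0..} Z"
    unfolding is_solution_def
  proof
    show "locally_abs_continuous_on {0..} Z"
      unfolding locally_abs_continuous_on_def
    proof (intro allI impI)
      fix a b :: real assume ab: "{a..b} \<subseteq> {0..}"
      have "abs_continuous_on {a..b} D" "abs_continuous_on {a..b} E"
        using is_solution_imp_abs_continuous_on[OF D ab] E(1) ab by (auto simp: locally_abs_continuous_on_def)
      then show "abs_continuous_on {a..b} Z"
        unfolding Z_def by (rule abs_continuous_on_diff)
    qed
    have "AE x in lebesgue. x \<in> {0..} \<longrightarrow> (D has_vector_derivative (A x + R x) ** D x) (at x within {0..})"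
      using D by (simp add: is_solution_def)
    then show "AE x in lebesgue. x \<in> {0..} \<longrightarrow> (Z has_vector_derivative A x ** Z x) (at x within {0..})"
      using E(2)
    proof eventually_elim
      case (elim x)
      show ?case
      proof
        assume "x \<in> {0..}"
        with elim have "(Z has_vector_derivative ((A x + R x) ** D x - (A x ** E x + \<Phi> x ** g x))) (at x within {0..})"
          unfolding Z_def by (intro has_vector_derivative_diff) auto
        moreover have "\<Phi> x ** g x = R x ** D x"
          unfolding g_def by (simp add: matrix_inv_mult_assoc[OF inv])
        ultimately show "(Z has_vector_derivative A x ** Z x) (at x within {0..})"
          by (simp add: Z_def mat_mult.diff_right mat_mult.add_left)
      qed
    qed
  qed
  then have Z: "is_solution A {0..x} Z" by (rule is_solution_subset) auto
  have Z0: "Z 0 = 0" using F by (simp add: Z_def E_def fundamental_solution_def)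
  have "Z x = 0" by (rule solution_zero[OF A Z _ Z0]) (use x in auto)
  then show ?thesis by (simp add: Z_def E_def g_def[abs_def])
qed

text \<open>The hypothesis \<open>eq\<close> is the fixed point equation in disguise: the source
  \<open>\<Phi> ** g\<close> equals \<open>R\<close> times the function itself.\<close>

lemma is_solution_fundamental_solution_mult_integral:
  fixes A \<Phi> g :: "real \<Rightarrow> complex ^ 'n ^ 'n"
  assumes F: "fundamental_solution A \<Phi>" and g: "\<And>b. g absolutely_integrable_on {0..b}"
    and eq: "\<And>x. x \<ge> 0 \<Longrightarrow> \<Phi> x ** g x = R x ** (\<Phi> x ** (c + integral {0..x} g))"
  shows "is_solution (\<lambda>x. A x + R x) {0..} (\<lambda>x. \<Phi> x ** (c + integral {0..x} g))"
  unfolding is_solution_def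
proof
  show "locally_abs_continuous_on {0..} (\<lambda>x. \<Phi> x ** (c + integral {0..x} g))"
    by (rule fundamental_solution_mult_integral(1)[OF F g])
  show "AE x in lebesgue. x \<in> {0..} \<longrightarrow> ((\<lambda>x. \<Phi> x ** (c + integral {0..x} g)) has_vector_derivative
      (A x + R x) ** (\<Phi> x ** (c + integral {0..x} g))) (at x within {0..})"
    using fundamental_solution_mult_integral(2)[OF F g, of c]
    by eventually_elim (auto simp: eq mat_mult.add_left)
qed

subsection \<open>Solutions of the perturbed equation\<close>

lemma integral_atLeast_tendsto_0:
  fixes r :: "real \<Rightarrow> real"
  assumes r: "r absolutely_integrable_on UNIV"
  shows "(\<lambda>n. integral {real n..} r) \<longlonglongrightarrow> 0"
proof -
  have ri: "r integrable_on UNIV" using r by (rule absolutely_integrable_imp_integrable_on)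
  have eq: "integral {c..} r = integral UNIV (\<lambda>x. if x \<in> {c..} then r x else 0)" for c
    by (rule integral_restrict_UNIV[symmetric])
  have "(\<lambda>n. integral UNIV (\<lambda>x. if x \<in> {real n..} then r x else 0)) \<longlonglongrightarrow> integral UNIV (\<lambda>x::real. 0)"
  proof (rule dominated_convergence(2))
    fix n
    have "r absolutely_integrable_on {real n..}"
      by (rule set_integrable_subset[OF r]) auto
    then show "(\<lambda>x. if x \<in> {real n..} then r x else 0) integrable_on UNIV"
      using integrable_restrict_UNIV[of "{real n..}" r] absolutely_integrable_imp_integrable_on by blast
    show "(\<lambda>x. norm (r x)) integrable_on UNIV"
      using absolutely_integrable_norm'[OF r] by (rule absolutely_integrable_imp_integrable_on)
    show "norm (if x \<in> {real n..} then r x else 0) \<le> norm (r x)" for x by simp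
  next
    fix x :: real
    show "(\<lambda>n. if x \<in> {real n..} then r x else 0) \<longlonglongrightarrow> 0"
    proof (rule tendsto_eventually)
      show "\<forall>\<^sub>F n in sequentially. (if x \<in> {real n..} then r x else 0) = 0"
        using eventually_gt_at_top[of "nat \<lceil>\<bar>x\<bar>\<rceil>"] by eventually_elim (auto, linarith)
    qed
  qed
  then show ?thesis by (simp add: eq)
qed

lemma exp_decay_tendsto_0:
  fixes c :: real
  assumes "\<mu> < \<nu>"
  shows "((\<lambda>x. c * exp ((\<mu> - \<nu>) * x)) \<longlongrightarrow> 0) at_top"
proof -
  have "filterlim (\<lambda>x. (\<mu> - \<nu>) * x) at_bot at_top"
    using assms by (intro filterlim_tendsto_neg_mult_at_bot[OF tendsto_const]) (auto simp: filterlim_ident)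
  then have "((\<lambda>x. exp ((\<mu> - \<nu>) * x)) \<longlongrightarrow> 0) at_top"
    by (rule filterlim_compose[OF exp_at_bot])
  then show ?thesis using tendsto_mult_right_zero by blast
qed

text \<open>The growth comparisons below end here: a fixed quantity is bounded by a multiple of an
  exponential of negative rate and hence cannot be positive.\<close>

lemma le_0_of_exp_decay:
  fixes b c :: real
  assumes "\<mu> < \<nu>" and "\<forall>\<^sub>F x in at_top. b \<le> c * exp ((\<mu> - \<nu>) * x)"
  shows "b \<le> 0"
  by (rule tendsto_lowerbound[OF exp_decay_tendsto_0[OF assms(1)] assms(2)]) simp

locale perturbed_equation =
  fixes A R \<Phi> :: "real \<Rightarrow> complex ^ 'n ^ 'n"
  assumes A: "loc_integrable A" and fund: "fundamental_solution A \<Phi>" and R: "R absolutely_integrable_on UNIV"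
begin

abbreviation \<Phi>i :: "real \<Rightarrow> complex ^ 'n ^ 'n" where "\<Phi>i t \<equiv> matrix_inv (\<Phi> t)"

abbreviation r :: "real \<Rightarrow> real" where "r t \<equiv> norm (R t)"

lemma invertible: "invertible (\<Phi> x)"
  by (rule invertible_fundamental_solution[OF A fund])

lemma \<Phi>_mult_inv [simp]: "\<Phi> x ** \<Phi>i x = mat 1" "\<Phi>i x ** \<Phi> x = mat 1"
  "\<Phi> x ** (\<Phi>i x ** B) = B" "\<Phi>i x ** (\<Phi> x ** B) = B"
  by (simp_all add: matrix_inv_mult matrix_inv_mult_assoc invertible)

lemma \<Phi>0: "\<Phi> 0 = mat 1" using fund by (simp add: fundamental_solution_def)

lemma continuous_on_\<Phi>: "continuous_on S \<Phi>"
  by (rule continuous_on_fundamental_solution[OF fund])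

lemma continuous_on_\<Phi>i: "continuous_on S \<Phi>i"
  by (rule continuous_on_matrix_inv[OF continuous_on_\<Phi> invertible])

lemma R_on: "S \<in> sets lebesgue \<Longrightarrow> R absolutely_integrable_on S"
  by (rule set_integrable_subset[OF R]) auto

lemma r_on: "S \<in> sets lebesgue \<Longrightarrow> r absolutely_integrable_on S"
  by (intro absolutely_integrable_norm' R_on)

lemma r_integrable: "S \<in> sets lebesgue \<Longrightarrow> r integrable_on S"
  by (intro absolutely_integrable_imp_integrable_on r_on)

lemma small_tail:
  assumes "e > 0"
  obtains a where "a \<ge> b" "a \<ge> 0" "C * integral {a..} r \<le> e"
proof -
  have "(\<lambda>n. C * integral {real n..} r) \<longlonglongrightarrow> C * 0"
    by (intro tendsto_intros integral_atLeast_tendsto_0 r_on) simp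
  then have "\<forall>\<^sub>F n in sequentially. C * integral {real n..} r < e"
    using \<open>e > 0\<close> by (auto intro: order_tendstoD)
  with eventually_ge_at_top[of "nat \<lceil>b\<rceil>"]
  have "\<forall>\<^sub>F n in sequentially. C * integral {real n..} r < e \<and> n \<ge> nat \<lceil>b\<rceil>"
    by eventually_elim simp
  then obtain n where "C * integral {real n..} r < e" "n \<ge> nat \<lceil>b\<rceil>"
    by (metis (no_types, lifting) eventually_sequentially order_refl)
  then show ?thesis using that[of "real n"] by linarith
qed

text \<open>The whole propagator contracts backwards at a rate \<nu> above the growth rate \<mu> of
  \<open>D\<close>. In the variation of constants formula between \<open>x\<close> and
  \<open>t\<close> the boundary term vanishes as \<open>t\<close> tends to infinity, and the
  remaining integral halves the constant in the growth bound. Iteration makes \<open>D\<close> zero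
  on a tail, and uniqueness carries this back to 0.\<close>

lemma solution_zero_of_growth:
  assumes D: "is_solution (\<lambda>x. A x + R x) {0..} D"
    and growth: "\<And>x. x \<ge> x1 \<Longrightarrow> norm (D x) \<le> K * exp (\<mu> * x)"
    and bound: "\<And>x t. 0 \<le> x \<Longrightarrow> x \<le> t \<Longrightarrow> norm (\<Phi> x ** \<Phi>i t) \<le> C * exp (\<nu> * (x - t))"
    and "\<mu> < \<nu>" and "x \<ge> 0"
  shows "D x = 0"
proof -
  have C0: "C \<ge> 0" using order_trans[OF norm_ge_zero bound[of 0 0]] by simp
  obtain a where a: "a \<ge> x1" "a \<ge> 0" "C * integral {a..} r \<le> 1 / 2"
    using small_tail[of "1 / 2" x1 C] by auto
  define g where "g t = \<Phi>i t ** (R t ** D t)" for t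
  have cD: "continuous_on {u..v} D" if "u \<ge> 0" for u v
    by (rule is_solution_imp_continuous_on[OF D]) (use that in auto)
  have gi: "g integrable_on {u..v}" if "u \<ge> 0" for u v
    unfolding g_def using that
    by (intro absolutely_integrable_imp_integrable_on absolutely_integrable_matrix_mult_left
        absolutely_integrable_matrix_mult_right R_on continuous_on_\<Phi>i cD) auto
  have var: "\<Phi>i t ** D t = D 0 + integral {0..t} g" if "t \<ge> 0" for t
    using variation_of_constants[OF A fund R_on D that] unfolding g_def[abs_def] by simp
  have step: "norm (D x) \<le> m / 2 * exp (\<mu> * x)"
    if m: "\<And>s. s \<ge> a \<Longrightarrow> norm (D s) \<le> m * exp (\<mu> * s)" and x: "x \<ge> a" for m x
  proof -
    have m0: "m \<ge> 0" using order_trans[OF norm_ge_zero m[of a]] by (simp add: zero_le_mult_iff)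
    \<comment> \<open>The first summand is the boundary term at \<open>t\<close>, decaying in
      \<open>t\<close>; the second is the integral term, where the smallness of the tail of
      \<open>r\<close> gives the factor 1/2.\<close>
    have le: "norm (D x) \<le> C * K * exp (\<nu> * x) * exp ((\<mu> - \<nu>) * t) + m / 2 * exp (\<mu> * x)" if t: "t \<ge> x" for t
    proof -
      have "integral {0..x} g + integral {x..t} g = integral {0..t} g"
        using x t a by (intro Henstock_Kurzweil_Integration.integral_combine gi) auto
      then have "\<Phi>i x ** D x = \<Phi>i t ** D t - integral {x..t} g"
        using var[of x] var[of t] x t a by (simp add: algebra_simps)
      then have "D x = \<Phi> x ** (\<Phi>i t ** D t - integral {x..t} g)"
        by (metis \<Phi>_mult_inv(3))
      also have "\<dots> = \<Phi> x ** \<Phi>i t ** D t - integral {x..t} (\<lambda>s. \<Phi> x ** g s)"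
        using integral_linear[OF gi[of x t] mat_mult.bounded_linear_right[of "\<Phi> x"]] x a
        by (simp add: mat_mult.diff_right matrix_mul_assoc o_def)
      finally have "norm (D x) \<le> norm (\<Phi> x ** \<Phi>i t ** D t) + norm (integral {x..t} (\<lambda>s. \<Phi> x ** g s))"
        using norm_triangle_ineq4 by metis
      moreover have "norm (\<Phi> x ** \<Phi>i t ** D t) \<le> (C * exp (\<nu> * (x - t))) * (K * exp (\<mu> * t))"
        using x t a C0 by (intro order_trans[OF norm_matrix_mult_le] mult_mono bound growth) auto
      moreover have "(C * exp (\<nu> * (x - t))) * (K * exp (\<mu> * t)) = C * K * exp (\<nu> * x) * exp ((\<mu> - \<nu>) * t)"
        by (simp add: exp_add[symmetric] algebra_simps)
      moreover have "norm (integral {x..t} (\<lambda>s. \<Phi> x ** g s)) \<le> integral {x..t} (\<lambda>s. C * m * exp (\<mu> * x) * r s)"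
      proof (rule integral_norm_bound_integral)
        show "(\<lambda>s. \<Phi> x ** g s) integrable_on {x..t}"
          using integrable_linear[OF gi[of x t] mat_mult.bounded_linear_right[of "\<Phi> x"]] x a by (simp add: o_def)
        show "(\<lambda>s. C * m * exp (\<mu> * x) * r s) integrable_on {x..t}"
          by (intro integrable_on_mult_right r_integrable) simp
        fix s assume s: "s \<in> {x..t}"
        have "norm (\<Phi> x ** g s) \<le> norm (\<Phi> x ** \<Phi>i s) * (r s * norm (D s))"
          unfolding g_def matrix_mul_assoc[of "\<Phi> x"]
          by (intro order_trans[OF norm_matrix_mult_le] mult_left_mono norm_matrix_mult_le) auto
        also have "\<dots> \<le> (C * exp (\<nu> * (x - s))) * (r s * (m * exp (\<mu> * s)))"
          using s x a C0 by (intro mult_mono bound mult_left_mono m) auto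
        \<comment> \<open>Here \<open>x - s\<close> is not positive, so lowering the rate from \<nu>
          to \<mu> only weakens the bound. It makes the exponentials combine to
          \<open>exp (\<mu> * x)\<close>, independent of \<open>s\<close>.\<close>
        also have "\<dots> \<le> (C * exp (\<mu> * (x - s))) * (r s * (m * exp (\<mu> * s)))"
        proof (intro mult_right_mono mult_left_mono)
          have "(\<nu> - \<mu>) * (x - s) \<le> 0" using s \<open>\<mu> < \<nu>\<close> by (intro mult_nonneg_nonpos) auto
          then show "exp (\<nu> * (x - s)) \<le> exp (\<mu> * (x - s))" by (simp add: algebra_simps)
        qed (use C0 m0 in auto)
        also have "\<dots> = C * m * (exp (\<mu> * (x - s)) * exp (\<mu> * s)) * r s" by (simp add: mult_ac)
        also have "exp (\<mu> * (x - s)) * exp (\<mu> * s) = exp (\<mu> * x)"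
          by (simp add: exp_add[symmetric] algebra_simps)
        finally show "norm (\<Phi> x ** g s) \<le> C * m * exp (\<mu> * x) * r s" .
      qed
      moreover have "integral {x..t} (\<lambda>s. C * m * exp (\<mu> * x) * r s) \<le> m / 2 * exp (\<mu> * x)"
      proof -
        have "integral {x..t} r \<le> integral {a..} r"
          using x by (intro integral_subset_le r_integrable) auto
        then have "C * integral {x..t} r \<le> 1 / 2"
          using a(3) C0 by (meson mult_left_mono order_trans)
        then have "m * exp (\<mu> * x) * (C * integral {x..t} r) \<le> m * exp (\<mu> * x) * (1 / 2)"
          using m0 by (intro mult_left_mono) auto
        then show ?thesis by (simp add: mult_ac)
      qed
      ultimately show ?thesis by linarith
    qed
    have "((\<lambda>t. C * K * exp (\<nu> * x) * exp ((\<mu> - \<nu>) * t) + m / 2 * exp (\<mu> * x)) \<longlongrightarrow>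
        C * K * exp (\<nu> * x) * 0 + m / 2 * exp (\<mu> * x)) at_top"
      by (intro tendsto_intros exp_decay_tendsto_0[of \<mu> \<nu> 1, simplified] \<open>\<mu> < \<nu>\<close>)
    then have "norm (D x) \<le> C * K * exp (\<nu> * x) * 0 + m / 2 * exp (\<mu> * x)"
    proof (rule tendsto_lowerbound)
      show "\<forall>\<^sub>F t in at_top. norm (D x) \<le> C * K * exp (\<nu> * x) * exp ((\<mu> - \<nu>) * t) + m / 2 * exp (\<mu> * x)"
        using eventually_ge_at_top[of x] by eventually_elim (rule le)
    qed simp
    then show ?thesis by simp
  qed
  have pow: "norm (D x) \<le> K / 2 ^ n * exp (\<mu> * x)" if "x \<ge> a" for x n
    using that
  proof (induction n arbitrary: x)
    case 0
    then show ?case using growth[of x] a by simp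
  next
    case (Suc n)
    then show ?case using step[of "K / 2 ^ n" x] by (simp add: field_simps)
  qed
  have zero: "D x = 0" if "x \<ge> a" for x
  proof -
    have "norm (D x) \<le> K * 0 * exp (\<mu> * x)"
    proof (rule LIMSEQ_le_const)
      have "(\<lambda>n. K * (1 / 2) ^ n * exp (\<mu> * x)) \<longlonglongrightarrow> K * 0 * exp (\<mu> * x)"
        by (intro tendsto_intros LIMSEQ_realpow_zero) auto
      then show "(\<lambda>n. K / 2 ^ n * exp (\<mu> * x)) \<longlonglongrightarrow> K * 0 * exp (\<mu> * x)"
        by (simp add: power_divide)
    qed (use pow[OF that] in auto)
    then show ?thesis by simp
  qed
  show "D x = 0"
  proof (cases "x \<ge> a")
    case True
    then show ?thesis by (rule zero)
  next
    case False
    \<comment> \<open>The solution vanishes at \<open>a\<close>, hence on the remaining compact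
      interval \<open>{0..a}\<close> too.\<close>
    have "loc_integrable (\<lambda>x. A x + R x)"
      using A by (auto simp: loc_integrable_def intro!: set_integral_add R_on)
    then show ?thesis
      by (rule solution_zero[where a = 0 and b = a and c = a, OF _ is_solution_subset[OF D]])
         (use zero False \<open>x \<ge> 0\<close> in auto)
  qed
qed

end

text \<open>\<open>Qm\<close> is estimated forwards and \<open>Qp\<close> backwards, at one common
  rate \<mu>. To the left of \<open>a\<close> both kernels run backwards over \<open>{x..a}\<close>
  and add up to the full propagator, for which the splitting gives no estimate; there only
  compactness is available, hence the separate constant \<open>M\<close>.\<close>

locale green_operator = perturbed_equation A R \<Phi>
  for A R \<Phi> :: "real \<Rightarrow> complex ^ 'n ^ 'n" +
  fixes Qm Qp :: "complex ^ 'n ^ 'n" and C \<mu> a M :: real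
  assumes Qm_Qp: "Qm + Qp = mat 1"
    and Qm_bound: "\<And>x t. 0 \<le> t \<Longrightarrow> t \<le> x \<Longrightarrow> norm (\<Phi> x ** Qm ** \<Phi>i t) \<le> C * exp (\<mu> * (x - t))"
    and Qp_bound: "\<And>x t. 0 \<le> x \<Longrightarrow> x \<le> t \<Longrightarrow> norm (\<Phi> x ** Qp ** \<Phi>i t) \<le> C * exp (\<mu> * (x - t))"
    and a0: "a \<ge> 0"
    and M_bound: "\<And>x t. 0 \<le> x \<Longrightarrow> x \<le> t \<Longrightarrow> t \<le> a \<Longrightarrow> norm (\<Phi> x ** \<Phi>i t) \<le> M * exp (\<mu> * (x - t))"
begin

text \<open>The weight is matched to the kernels:
  \<open>exp (\<mu> * (x - t)) * exp (\<mu> * t)\<close> no longer depends on \<open>t\<close>, so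
  convergence and size of all integrals are governed by \<sigma> alone.\<close>

definition admissible :: "(real \<Rightarrow> complex ^ 'n ^ 'n) \<Rightarrow> (real \<Rightarrow> real) \<Rightarrow> bool" where
  "admissible s \<sigma> \<longleftrightarrow> (\<forall>b. s absolutely_integrable_on {0..b}) \<and> \<sigma> integrable_on {0..} \<and>
     (\<forall>t\<ge>0. norm (s t) \<le> exp (\<mu> * t) * \<sigma> t)"

text \<open>
  The initial value \<open>vs s\<close> is the one for which
  \<open>green s x = \<integral>\<^sub>a\<^sup>x \<Phi>(x) Qm \<Phi>(t)\<^sup>-\<^sup>1 s(t) dt - \<integral>\<^sub>x\<^sup>\<infinity> \<Phi>(x) Qp \<Phi>(t)\<^sup>-\<^sup>1 s(t) dt\<close>, with an oriented
  first integral; \<open>green s\<close> then solves \<open>y' = A y + s\<close>.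
\<close>

definition vs :: "(real \<Rightarrow> complex ^ 'n ^ 'n) \<Rightarrow> complex ^ 'n ^ 'n" where
  "vs s = - (Qm ** integral {0..a} (\<lambda>t. \<Phi>i t ** s t)) - integral {0..} (\<lambda>t. Qp ** (\<Phi>i t ** s t))"

definition green :: "(real \<Rightarrow> complex ^ 'n ^ 'n) \<Rightarrow> real \<Rightarrow> complex ^ 'n ^ 'n" where
  "green s x = \<Phi> x ** (vs s + integral {0..x} (\<lambda>t. \<Phi>i t ** s t))"

lemma C0: "C \<ge> 0"
  using order_trans[OF norm_ge_zero Qp_bound[of 0 0]] by simp

lemma M0: "M \<ge> 0"
  using order_trans[OF norm_ge_zero M_bound[of 0 0]] a0 by simp

context
  fixes s \<sigma>
  assumes adm: "admissible s \<sigma>"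
begin

lemma \<sigma>0: "t \<ge> 0 \<Longrightarrow> \<sigma> t \<ge> 0"
  using adm order_trans[OF norm_ge_zero, of "s t" "exp (\<mu> * t) * \<sigma> t"]
  by (auto simp: admissible_def zero_le_mult_iff)

lemma s_int: "s absolutely_integrable_on {u..v}" if "u \<ge> 0"
  using adm that absolutely_integrable_on_subinterval[where f = s and S = "{0..v}" and a = u and b = v] by (auto simp: admissible_def)

lemma \<sigma>_int: "u \<ge> 0 \<Longrightarrow> \<sigma> integrable_on {u..}" "u \<ge> 0 \<Longrightarrow> \<sigma> integrable_on {u..v}"
proof -
  have "\<sigma> absolutely_integrable_on {0..}"
    using adm \<sigma>0 by (intro nonnegative_absolutely_integrable_1) (auto simp: admissible_def)
  then show "u \<ge> 0 \<Longrightarrow> \<sigma> integrable_on {u..}" "u \<ge> 0 \<Longrightarrow> \<sigma> integrable_on {u..v}"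
    by (auto intro!: absolutely_integrable_imp_integrable_on elim!: set_integrable_subset)
qed

lemma q_int: "(\<lambda>t. \<Phi>i t ** s t) absolutely_integrable_on {u..v}" if "u \<ge> 0"
  by (intro absolutely_integrable_matrix_mult_left s_int that continuous_on_\<Phi>i)

lemma q_int':
  fixes X :: "complex ^ 'n ^ 'n"
  assumes that: "u \<ge> 0"
  shows "(\<lambda>t. X ** (\<Phi>i t ** s t)) integrable_on {u..v}"
  using integrable_linear[OF absolutely_integrable_imp_integrable_on[OF q_int[OF that]] mat_mult.bounded_linear_right[of X]]
  by (simp add: o_def)

lemma kernel_bound:
  fixes X :: "complex ^ 'n ^ 'n"
  assumes "norm (X ** \<Phi>i t) \<le> c * exp (\<mu> * (x - t))" "t \<ge> 0"
  shows "norm (X ** (\<Phi>i t ** s t)) \<le> exp (\<mu> * x) * (c * \<sigma> t)"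
proof -
  have "norm (X ** (\<Phi>i t ** s t)) \<le> norm (X ** \<Phi>i t) * norm (s t)"
    unfolding matrix_mul_assoc by (rule norm_matrix_mult_le)
  also have "\<dots> \<le> (c * exp (\<mu> * (x - t))) * (exp (\<mu> * t) * \<sigma> t)"
    using assms adm by (intro mult_mono order_trans[OF norm_ge_zero assms(1)]) (auto simp: admissible_def)
  also have "\<dots> = (exp (\<mu> * (x - t)) * exp (\<mu> * t)) * (c * \<sigma> t)" by (simp add: mult_ac)
  also have "exp (\<mu> * (x - t)) * exp (\<mu> * t) = exp (\<mu> * x)"
    by (simp add: exp_add[symmetric] algebra_simps)
  finally show ?thesis .
qed

text \<open>The backward bound at \<open>x = 0\<close>, where \<Phi> is the identity, gives
  convergence of the improper integral in \<open>vs\<close>.\<close>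

lemma p_abs_int: "(\<lambda>t. Qp ** (\<Phi>i t ** s t)) absolutely_integrable_on {0..}"
proof (rule absolutely_integrable_on_half_line)
  show "(\<lambda>t. Qp ** (\<Phi>i t ** s t)) integrable_on {0..b}" for b by (rule q_int') simp
  show "(\<lambda>t. exp (\<mu> * 0) * (C * \<sigma> t)) integrable_on {0..}"
    by (intro integrable_on_mult_right \<sigma>_int) simp
  show "norm (Qp ** (\<Phi>i t ** s t)) \<le> exp (\<mu> * 0) * (C * \<sigma> t)" if "t \<ge> 0" for t
    using Qp_bound[of 0 t] that by (intro kernel_bound) (auto simp: \<Phi>0)
qed

lemmas p_int = absolutely_integrable_imp_integrable_on[OF p_abs_int]

lemma p_int_atLeast:
  fixes X :: "complex ^ 'n ^ 'n"
  assumes "u \<ge> 0"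
  shows "(\<lambda>t. X ** (Qp ** (\<Phi>i t ** s t))) integrable_on {u..}"
proof -
  have "(\<lambda>t. Qp ** (\<Phi>i t ** s t)) absolutely_integrable_on {u..}"
    by (rule set_integrable_subset[OF p_abs_int]) (use assms in auto)
  from integrable_linear[OF absolutely_integrable_imp_integrable_on[OF this] mat_mult.bounded_linear_right[of X]]
  show ?thesis by (simp add: o_def)
qed

lemma integral_p_split:
  assumes "x \<ge> 0"
  shows "integral {0..} (\<lambda>t. Qp ** (\<Phi>i t ** s t)) =
    integral {0..x} (\<lambda>t. Qp ** (\<Phi>i t ** s t)) + integral {x..} (\<lambda>t. Qp ** (\<Phi>i t ** s t))"
proof -
  let ?p = "\<lambda>t. Qp ** (\<Phi>i t ** s t)"
  have "(?p has_integral (integral {0..x} ?p + integral {x..} ?p)) ({0..x} \<union> {x..})"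
  proof (rule has_integral_Un)
    show "(?p has_integral integral {0..x} ?p) {0..x}" by (rule integrable_integral[OF q_int']) simp
    show "(?p has_integral integral {x..} ?p) {x..}"
      using p_int_atLeast[OF assms, of "mat 1"] by (intro integrable_integral) simp
    have "{0..x} \<inter> {x..} \<subseteq> {x}" by auto
    then show "negligible ({0..x} \<inter> {x..})" by (rule negligible_subset[OF negligible_sing])
  qed
  moreover have "{0..x} \<union> {x..} = {0..}" using assms by auto
  ultimately show ?thesis by (simp add: integral_unique)
qed

lemma norm_integral_kernel_le:
  fixes X :: "complex ^ 'n ^ 'n"
  assumes "u \<ge> 0" "\<And>t. t \<in> {u..v} \<Longrightarrow> norm (X ** \<Phi>i t) \<le> c * exp (\<mu> * (x - t))"
  shows "norm (X ** integral {u..v} (\<lambda>t. \<Phi>i t ** s t)) \<le> exp (\<mu> * x) * (c * integral {u..v} \<sigma>)"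
proof -
  have "X ** integral {u..v} (\<lambda>t. \<Phi>i t ** s t) = integral {u..v} (\<lambda>t. X ** (\<Phi>i t ** s t))"
    using integral_linear[OF absolutely_integrable_imp_integrable_on[OF q_int[OF assms(1)]] mat_mult.bounded_linear_right[of X], of v]
    by (simp add: o_def)
  also have "norm \<dots> \<le> integral {u..v} (\<lambda>t. exp (\<mu> * x) * (c * \<sigma> t))"
    by (intro integral_norm_bound_integral q_int' integrable_on_mult_right \<sigma>_int kernel_bound) (use assms in auto)
  finally show ?thesis by simp
qed

lemma norm_integral_kernel_Qp_le:
  fixes X :: "complex ^ 'n ^ 'n"
  assumes "u \<ge> 0" "\<And>t. t \<in> {u..} \<Longrightarrow> norm (X ** Qp ** \<Phi>i t) \<le> c * exp (\<mu> * (x - t))"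
  shows "norm (X ** integral {u..} (\<lambda>t. Qp ** (\<Phi>i t ** s t))) \<le> exp (\<mu> * x) * (c * integral {u..} \<sigma>)"
proof -
  have "X ** integral {u..} (\<lambda>t. Qp ** (\<Phi>i t ** s t)) = integral {u..} (\<lambda>t. X ** (Qp ** (\<Phi>i t ** s t)))"
    using integral_linear[OF p_int_atLeast[OF assms(1), of "mat 1", simplified] mat_mult.bounded_linear_right[of X]]
    by (simp add: o_def)
  also have "norm \<dots> \<le> integral {u..} (\<lambda>t. exp (\<mu> * x) * (c * \<sigma> t))"
  proof (intro integral_norm_bound_integral p_int_atLeast integrable_on_mult_right \<sigma>_int assms(1))
    fix t assume "t \<in> {u..}"
    then show "norm (X ** (Qp ** (\<Phi>i t ** s t))) \<le> exp (\<mu> * x) * (c * \<sigma> t)"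
      unfolding matrix_mul_assoc[of X Qp] using assms by (intro kernel_bound) auto
  qed
  finally show ?thesis by simp
qed

text \<open>To the right of \<open>a\<close> the forward kernel on \<open>{a..x}\<close> and the
  backward kernel on \<open>{x..}\<close> share the constant \<open>C\<close>, and their
  contributions join to an integral over \<open>{a..}\<close>. To the left, the full propagator acts
  on \<open>{x..a}\<close> and the \<open>Qp\<close> kernel on \<open>{a..}\<close>.\<close>

lemma norm_green_le:
  assumes x: "x \<ge> 0"
  shows "norm (green s x) \<le> exp (\<mu> * x) * (M * integral {x..a} \<sigma> + C * integral {a..} \<sigma>)"
proof -
  let ?q = "\<lambda>t. \<Phi>i t ** s t" and ?p = "\<lambda>t. Qp ** (\<Phi>i t ** s t)"
  have qi: "?q integrable_on {0..v}" for v
    by (intro absolutely_integrable_imp_integrable_on q_int) simp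
  have Qp: "Qp = mat 1 - Qm" using Qm_Qp by (simp add: algebra_simps)
  have comb: "integral {0..u} ?q + integral {u..v} ?q = integral {0..v} ?q" if "0 \<le> u" "u \<le> v" for u v
    using that by (intro Henstock_Kurzweil_Integration.integral_combine qi)
  have pint: "integral {u..v} ?p = Qp ** integral {u..v} ?q" if "u \<ge> 0" for u v
    using integral_linear[OF absolutely_integrable_imp_integrable_on[OF q_int[OF that]] mat_mult.bounded_linear_right[of Qp], of v]
    by (simp add: o_def)
  show ?thesis
  proof (cases "x \<ge> a")
    case True
    \<comment> \<open>Splitting the tail integral in \<open>vs\<close> at \<open>x\<close> removes
      the \<open>Qp\<close> part of the integral over \<open>{0..x}\<close>; its \<open>Qm\<close>
      part is shortened by the integral up to \<open>a\<close>.\<close>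
    have "vs s + integral {0..x} ?q = Qm ** integral {a..x} ?q - integral {x..} ?p"
    proof -
      have "integral {0..x} ?q - Qp ** integral {0..x} ?q = (mat 1 - Qp) ** integral {0..x} ?q"
        by (simp add: mat_mult.diff_left)
      then have "integral {0..x} ?q - Qp ** integral {0..x} ?q = Qm ** integral {0..x} ?q"
        by (simp add: Qp)
      then have "vs s + integral {0..x} ?q = Qm ** (integral {0..x} ?q - integral {0..a} ?q) - integral {x..} ?p"
        unfolding vs_def integral_p_split[OF x] by (simp add: pint mat_mult.diff_right)
      also have "integral {0..x} ?q - integral {0..a} ?q = integral {a..x} ?q"
        using comb[of a x] True a0 by (simp add: algebra_simps)
      finally show ?thesis .
    qed
    then have "green s x = (\<Phi> x ** Qm) ** integral {a..x} ?q - \<Phi> x ** integral {x..} ?p"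
      by (simp add: green_def mat_mult.diff_right matrix_mul_assoc)
    then have "norm (green s x) \<le> norm ((\<Phi> x ** Qm) ** integral {a..x} ?q) + norm (\<Phi> x ** integral {x..} ?p)"
      by (simp only: norm_triangle_ineq4)
    also have "\<dots> \<le> exp (\<mu> * x) * (C * integral {a..x} \<sigma>) + exp (\<mu> * x) * (C * integral {x..} \<sigma>)"
    proof (rule add_mono)
      show "norm ((\<Phi> x ** Qm) ** integral {a..x} ?q) \<le> exp (\<mu> * x) * (C * integral {a..x} \<sigma>)"
        by (rule norm_integral_kernel_le) (use a0 Qm_bound in auto)
      show "norm (\<Phi> x ** integral {x..} ?p) \<le> exp (\<mu> * x) * (C * integral {x..} \<sigma>)"
        by (rule norm_integral_kernel_Qp_le) (use x Qp_bound in auto)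
    qed
    also have "\<dots> = exp (\<mu> * x) * (C * (integral {a..x} \<sigma> + integral {x..} \<sigma>))" by (simp add: algebra_simps)
    also have "integral {a..x} \<sigma> + integral {x..} \<sigma> = integral {a..} \<sigma>"
    proof -
      have "(\<sigma> has_integral (integral {a..x} \<sigma> + integral {x..} \<sigma>)) ({a..x} \<union> {x..})"
      proof (rule has_integral_Un)
        have "{a..x} \<inter> {x..} \<subseteq> {x}" by auto
        then show "negligible ({a..x} \<inter> {x..})" by (rule negligible_subset[OF negligible_sing])
      qed (use \<sigma>_int a0 x in \<open>auto intro!: integrable_integral\<close>)
      moreover have "{a..x} \<union> {x..} = {a..}" using True by auto
      ultimately show ?thesis by (simp add: integral_unique)
    qed
    finally have "norm (green s x) \<le> exp (\<mu> * x) * (C * integral {a..} \<sigma>)" .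
    \<comment> \<open>The interval is empty or a single point, so the term with \<open>M\<close>
      drops out and one formula serves both cases.\<close>
    moreover have "integral {x..a} \<sigma> = 0" using True by (cases "x = a") auto
    ultimately show ?thesis by simp
  next
    case False
    \<comment> \<open>Splitting the tail at \<open>a\<close> instead, the two projections recombine
      to the identity over \<open>{0..a}\<close>.\<close>
    have "vs s + integral {0..x} ?q = - integral {x..a} ?q - integral {a..} ?p"
    proof -
      have "vs s = - (Qm ** integral {0..a} ?q + Qp ** integral {0..a} ?q) - integral {a..} ?p"
        unfolding vs_def integral_p_split[OF a0] by (simp add: pint)
      also have "Qm ** integral {0..a} ?q + Qp ** integral {0..a} ?q = integral {0..a} ?q"
        using Qm_Qp by (simp add: mat_mult.add_left[symmetric])
      finally have "vs s = - integral {0..a} ?q - integral {a..} ?p" .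
      moreover have "integral {0..a} ?q = integral {0..x} ?q + integral {x..a} ?q"
        using comb[of x a] False x by simp
      ultimately show ?thesis by simp
    qed
    then have "green s x = - (\<Phi> x ** integral {x..a} ?q) - \<Phi> x ** integral {a..} ?p"
      by (simp add: green_def mat_mult.diff_right mat_mult.minus_right)
    then have "norm (green s x) \<le> norm (\<Phi> x ** integral {x..a} ?q) + norm (\<Phi> x ** integral {a..} ?p)"
      using norm_triangle_ineq4[of "- (\<Phi> x ** integral {x..a} ?q)" "\<Phi> x ** integral {a..} ?p"]
      by (simp only: norm_minus_cancel)
    also have "\<dots> \<le> exp (\<mu> * x) * (M * integral {x..a} \<sigma>) + exp (\<mu> * x) * (C * integral {a..} \<sigma>)"
    proof (rule add_mono)
      show "norm (\<Phi> x ** integral {x..a} ?q) \<le> exp (\<mu> * x) * (M * integral {x..a} \<sigma>)"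
        by (rule norm_integral_kernel_le) (use x M_bound in auto)
      show "norm (\<Phi> x ** integral {a..} ?p) \<le> exp (\<mu> * x) * (C * integral {a..} \<sigma>)"
        by (rule norm_integral_kernel_Qp_le) (use a0 x False Qp_bound in auto)
    qed
    finally show ?thesis by (simp add: algebra_simps)
  qed
qed

end

text \<open>Linearity is claimed for admissible sources only: admissibility makes every integral
  exist, so that no default value of \<open>integral\<close> enters.\<close>

lemma green_diff:
  assumes "admissible s \<sigma>" "admissible s' \<sigma>'"
  shows "green (\<lambda>t. s t - s' t) x = green s x - green s' x"
proof -
  have eq: "\<Phi>i t ** (s t - s' t) = \<Phi>i t ** s t - \<Phi>i t ** s' t" for t by (rule mat_mult.diff_right)
  have "vs (\<lambda>t. s t - s' t) = vs s - vs s'"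
    unfolding vs_def eq mat_mult.diff_right
    by (subst integral_diff integral_diff[OF p_int[OF assms(1)] p_int[OF assms(2)]];
        (intro absolutely_integrable_imp_integrable_on q_int[OF assms(1)] q_int[OF assms(2)])?)+
       (simp_all add: mat_mult.diff_right)
  moreover have "integral {0..x} (\<lambda>t. \<Phi>i t ** s t - \<Phi>i t ** s' t) = integral {0..x} (\<lambda>t. \<Phi>i t ** s t) - integral {0..x} (\<lambda>t. \<Phi>i t ** s' t)"
    by (intro integral_diff absolutely_integrable_imp_integrable_on q_int[OF assms(1)] q_int[OF assms(2)]) simp_all
  ultimately have "green (\<lambda>t. s t - s' t) x = \<Phi> x ** ((vs s - vs s') +
      (integral {0..x} (\<lambda>t. \<Phi>i t ** s t) - integral {0..x} (\<lambda>t. \<Phi>i t ** s' t)))"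
    by (simp only: green_def eq)
  also have "\<dots> = \<Phi> x ** ((vs s + integral {0..x} (\<lambda>t. \<Phi>i t ** s t)) -
      (vs s' + integral {0..x} (\<lambda>t. \<Phi>i t ** s' t)))"
    by (simp add: algebra_simps)
  finally show ?thesis by (simp only: green_def mat_mult.diff_right)
qed

lemma continuous_on_green:
  assumes "admissible s \<sigma>"
  shows "continuous_on {0..b} (green s)"
  unfolding green_def
  by (intro mat_mult.continuous_on continuous_on_\<Phi> continuous_intros indefinite_integral_continuous_1
      absolutely_integrable_imp_integrable_on q_int[OF assms]) simp

end

section \<open>Existence of a perturbed solution close to an unperturbed one\<close>

context perturbed_equation
begin

text \<open>The unknown difference is written as \<rho> times a bounded continuous function
  \<open>u\<close>. This turns the weighted space into the complete type of bounded continuous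
  functions, where Banach's theorem applies. On the half-line \<rho> differs from
  \<open>exp (\<mu> * x)\<close> by a factor between 1 and \<open>H\<close>, so the second weight
  costs only a constant in the conclusion.\<close>

lemma exists_solution_close_to:
  fixes W Qm Qp :: "complex ^ 'n ^ 'n"
  assumes Q: "Qm + Qp = mat 1"
    and bm: "\<And>x t. 0 \<le> t \<Longrightarrow> t \<le> x \<Longrightarrow> norm (\<Phi> x ** Qm ** \<Phi>i t) \<le> C * exp (\<mu> * (x - t))"
    and bp: "\<And>x t. 0 \<le> x \<Longrightarrow> x \<le> t \<Longrightarrow> norm (\<Phi> x ** Qp ** \<Phi>i t) \<le> C * exp (\<mu> * (x - t))"
    and W: "(\<lambda>t. r t * (norm (\<Phi> t ** W) * exp (- \<mu> * t))) integrable_on {0..}"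
  obtains Y K where "is_solution (\<lambda>x. A x + R x) {0..} Y"
    "\<forall>x\<ge>0. norm (Y x - \<Phi> x ** W) \<le> K * exp (\<mu> * x)"
proof -
  obtain a where a: "a \<ge> 0" "C * integral {a..} r \<le> 1 / 4"
    using small_tail[of "1 / 4" 0 C] by auto
  obtain M where M1: "M \<ge> 1"
    and M: "\<And>x t. 0 \<le> x \<Longrightarrow> x \<le> t \<Longrightarrow> t \<le> a \<Longrightarrow> norm (\<Phi> x ** \<Phi>i t) \<le> M * exp (\<mu> * (x - t))"
  proof -
    have "bounded (\<Phi> ` {0..a})" "bounded (\<Phi>i ` {0..a})"
      using compact_continuous_image[OF continuous_on_\<Phi>] compact_continuous_image[OF continuous_on_\<Phi>i]
      by (auto intro: compact_imp_bounded)
    then obtain B1 B2 where B: "\<And>x. x \<in> {0..a} \<Longrightarrow> norm (\<Phi> x) \<le> B1" "\<And>x. x \<in> {0..a} \<Longrightarrow> norm (\<Phi>i x) \<le> B2"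
      unfolding bounded_iff by (metis imageI)
    have B0: "B1 \<ge> 0" "B2 \<ge> 0"
      using order_trans[OF norm_ge_zero B(1)[of 0]] order_trans[OF norm_ge_zero B(2)[of 0]] a by auto
    \<comment> \<open>The factor \<open>exp (\<bar>\<mu>\<bar> * a)\<close> compensates
      \<open>exp (\<mu> * (x - t))\<close>, which on \<open>{0..a}\<close> may be as small as its
      inverse. The maximum with 1 keeps the rate \<open>4 * M\<close> positive.\<close>
    show thesis
    proof (rule that[of "max 1 (B1 * B2 * exp (\<bar>\<mu>\<bar> * a))"])
      fix x t assume xt: "0 \<le> x" "x \<le> t" "t \<le> a"
      have "\<mu> * (t - x) \<le> \<bar>\<mu>\<bar> * a" using xt by (intro mult_mono) auto
      then have "exp 0 \<le> exp (\<bar>\<mu>\<bar> * a + \<mu> * (x - t))" by (subst exp_le_cancel_iff) (simp add: algebra_simps)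
      then have e: "1 \<le> exp (\<bar>\<mu>\<bar> * a) * exp (\<mu> * (x - t))" by (simp add: exp_add)
      have "norm (\<Phi> x ** \<Phi>i t) \<le> B1 * B2"
        using xt B0 by (intro order_trans[OF norm_matrix_mult_le] mult_mono B) auto
      also have "\<dots> \<le> B1 * B2 * (exp (\<bar>\<mu>\<bar> * a) * exp (\<mu> * (x - t)))"
        using mult_left_mono[OF e, of "B1 * B2"] B0 by simp
      also have "\<dots> = (B1 * B2 * exp (\<bar>\<mu>\<bar> * a)) * exp (\<mu> * (x - t))" by simp
      also have "\<dots> \<le> max 1 (B1 * B2 * exp (\<bar>\<mu>\<bar> * a)) * exp (\<mu> * (x - t))"
        by (intro mult_right_mono) auto
      finally show "norm (\<Phi> x ** \<Phi>i t) \<le> max 1 (B1 * B2 * exp (\<bar>\<mu>\<bar> * a)) * exp (\<mu> * (x - t))" .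
    qed simp
  qed
  interpret green_operator A R \<Phi> Qm Qp C \<mu> a M
    by unfold_locales (use Q bm bp a M in auto)
  txt \<open>
    With the rate \<open>4 M\<close> the integral over \<open>{x..a}\<close> contributes at most a quarter of the weight, and
    the choice of \<open>a\<close> makes the tail contribute another quarter.
  \<close>
  define h where "h x = exp (4 * M * integral {x..a} r)" for x
  define H where "H = h 0"
  have int_nonneg: "integral {x..a} r \<ge> 0" for x
    by (intro integral_nonneg r_integrable) auto
  have h1: "h x \<ge> 1" for x using M1 int_nonneg[of x] by (simp add: h_def)
  have hpos: "h x > 0" for x by (simp add: h_def)
  have ha: "h x = 1" if "x \<ge> a" for x using that by (cases "x = a") (auto simp: h_def)
  have hH: "h x \<le> H" if "x \<ge> 0" for x
  proof -
    have "integral {x..a} r \<le> integral {0..a} r"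
      using that by (intro integral_subset_le r_integrable) auto
    then show ?thesis using M1 by (simp add: h_def H_def)
  qed
  \<comment> \<open>Beyond \<open>a\<close> the weight is constantly 1, so it is a continuous
    function on \<open>{0..a}\<close> composed with \<open>min x a\<close>.\<close>
  have h_cont: "continuous_on {0..b} h" for b
  proof -
    have "continuous_on {0..a} (\<lambda>t. exp (4 * M * integral {t..a} r))"
      by (rule continuous_on_exp_integral[OF r_integrable]) simp
    then have "continuous_on {0..b} (\<lambda>x. exp (4 * M * integral {min x a..a} r))"
      by (rule continuous_on_compose2[where f = "\<lambda>x. min x a"]) (use a in \<open>auto intro: continuous_intros\<close>)
    moreover have "exp (4 * M * integral {min x a..a} r) = h x" for x
      using ha[of x] by (cases "x \<ge> a") (auto simp: h_def min_def)
    ultimately show ?thesis by simp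
  qed
  have rh_loc: "(\<lambda>t. r t * h t) absolutely_integrable_on {0..b}" for b
    by (intro absolutely_integrable_mult_continuous r_on h_cont) simp
  have "(\<lambda>t. r t * h t) absolutely_integrable_on {0..}"
  proof (rule absolutely_integrable_on_half_line)
    show "(\<lambda>t. r t * h t) integrable_on {0..b}" for b
      by (rule absolutely_integrable_imp_integrable_on[OF rh_loc])
    show "norm (r t * h t) \<le> H * r t" if "t \<ge> 0" for t
      using hH[of t] hpos[of t] that mult_left_mono[of "h t" H "r t"] by (simp add: abs_mult mult.commute)
    show "(\<lambda>t. H * r t) integrable_on {0..}" by (intro integrable_on_mult_right r_integrable) simp
  qed
  then have rh_int: "(\<lambda>t. r t * h t) integrable_on {0..}"
    by (rule absolutely_integrable_imp_integrable_on)
  define \<rho> where "\<rho> x = exp (\<mu> * x) * h x" for x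
  have \<rho>pos: "\<rho> x > 0" for x using hpos by (simp add: \<rho>_def)
  have \<rho>_cont: "continuous_on {0..b} \<rho>" for b
    unfolding \<rho>_def by (intro continuous_intros h_cont)
  \<comment> \<open>The source without its inhomogeneous part \<open>\<Phi> t ** W\<close>; this is
    what remains of a difference of two sources in the contraction estimate.\<close>
  have adm0: "admissible (\<lambda>t. R t ** (\<rho> t *\<^sub>R w t)) (\<lambda>t. \<delta> * (r t * h t))"
    if w: "continuous_on UNIV w" "\<And>t. norm (w t) \<le> \<delta>" for w :: "real \<Rightarrow> complex ^ 'n ^ 'n" and \<delta>
    unfolding admissible_def
  proof (intro conjI allI impI)
    show "(\<lambda>t. R t ** (\<rho> t *\<^sub>R w t)) absolutely_integrable_on {0..b}" for b
      by (intro absolutely_integrable_matrix_mult_right R_on continuous_on_scaleR \<rho>_cont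
          continuous_on_subset[OF w(1)]) auto
    show "(\<lambda>t. \<delta> * (r t * h t)) integrable_on {0..}" by (intro integrable_on_mult_right rh_int)
    fix t :: real assume "t \<ge> 0"
    have "norm (R t ** (\<rho> t *\<^sub>R w t)) \<le> r t * (\<rho> t * \<delta>)"
      using \<rho>pos[of t] w(2)[of t] norm_matrix_mult_le[of "R t" "\<rho> t *\<^sub>R w t"]
      by (elim order_trans) (auto intro!: mult_left_mono)
    then show "norm (R t ** (\<rho> t *\<^sub>R w t)) \<le> exp (\<mu> * t) * (\<delta> * (r t * h t))"
      by (simp add: \<rho>_def mult_ac)
  qed
  define S where "S u t = R t ** (\<Phi> t ** W + \<rho> t *\<^sub>R u t)" for u :: "real \<Rightarrow> complex ^ 'n ^ 'n" and t
  define \<sigma> where "\<sigma> \<delta> t = r t * (norm (\<Phi> t ** W) * exp (- \<mu> * t)) + \<delta> * (r t * h t)" for \<delta> t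
  have adm: "admissible (S u) (\<sigma> \<delta>)"
    if u: "continuous_on UNIV u" "\<And>t. norm (u t) \<le> \<delta>" for u \<delta>
    unfolding admissible_def
  proof (intro conjI allI impI)
    show "S u absolutely_integrable_on {0..b}" for b
      unfolding S_def
      by (intro absolutely_integrable_matrix_mult_right R_on continuous_on_add continuous_on_scaleR \<rho>_cont
          mat_mult.continuous_on continuous_on_\<Phi> continuous_on_const continuous_on_subset[OF u(1)]) auto
    show "\<sigma> \<delta> integrable_on {0..}"
      unfolding \<sigma>_def by (intro integrable_add W integrable_on_mult_right rh_int)
    fix t :: real assume t: "t \<ge> 0"
    have S_eq: "S u t = R t ** (\<Phi> t ** W) + R t ** (\<rho> t *\<^sub>R u t)"
      by (simp add: S_def mat_mult.add_right)
    have "norm (R t ** (\<Phi> t ** W)) \<le> exp (\<mu> * t) * (r t * (norm (\<Phi> t ** W) * exp (- \<mu> * t)))"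
    proof -
      have "norm (R t ** (\<Phi> t ** W)) \<le> (exp (\<mu> * t) * exp (- \<mu> * t)) * (r t * norm (\<Phi> t ** W))"
        unfolding exp_add[symmetric] using norm_matrix_mult_le[of "R t" "\<Phi> t ** W"] by simp
      then show ?thesis by (simp add: mult_ac)
    qed
    moreover have "norm (R t ** (\<rho> t *\<^sub>R u t)) \<le> exp (\<mu> * t) * (\<delta> * (r t * h t))"
      using adm0[OF u] t unfolding admissible_def by blast
    ultimately have "norm (S u t) \<le> exp (\<mu> * t) * (r t * (norm (\<Phi> t ** W) * exp (- \<mu> * t))) + exp (\<mu> * t) * (\<delta> * (r t * h t))"
      unfolding S_eq by (intro order_trans[OF norm_triangle_ineq add_mono])
    then show "norm (S u t) \<le> exp (\<mu> * t) * \<sigma> \<delta> t" by (simp add: \<sigma>_def distrib_left)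
  qed
  \<comment> \<open>Bounded continuous functions live on the whole line, so values at negative
    arguments are frozen at 0. The division by \<rho> passes from the solution back to
    \<open>u\<close>.\<close>
  define F where "F u x = inverse (\<rho> (max 0 x)) *\<^sub>R green (S u) (max 0 x)" for u x
  have norm_F: "norm (inverse (\<rho> x) *\<^sub>R g) \<le> B" if "norm g \<le> exp (\<mu> * x) * (B * h x)" for g :: "complex ^ 'n ^ 'n" and x B
  proof -
    have "norm (inverse (\<rho> x) *\<^sub>R g) \<le> inverse (\<rho> x) * (exp (\<mu> * x) * (B * h x))"
      using \<rho>pos[of x] that by (simp add: mult_left_mono)
    also have "\<dots> = B" using hpos[of x] by (simp add: \<rho>_def field_simps)
    finally show ?thesis .
  qed
  have F_in: "F (apply_bcontfun u) \<in> bcontfun" for u :: "real \<Rightarrow>\<^sub>C (complex ^ 'n ^ 'n)"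
  proof -
    have u: "continuous_on UNIV (apply_bcontfun u)" "\<And>t. norm (apply_bcontfun u t) \<le> norm u"
      by (auto simp: norm_bounded intro: continuous_on_apply_bcontfun)
    note ad = adm[OF u]
    define B where "B = (M + C) * integral {0..} (\<sigma> (norm u))"
    show ?thesis
    proof (rule bcontfun_normI[of _ B])
      show "continuous_on UNIV (F (apply_bcontfun u))"
      proof (rule continuous_on_of_bounded_intervals)
        fix b
        have "continuous_on {0..b} (\<lambda>x. inverse (\<rho> x) *\<^sub>R green (S (apply_bcontfun u)) x)"
          using \<rho>pos by (intro continuous_on_scaleR continuous_on_inverse \<rho>_cont continuous_on_green[OF ad])
             (auto simp: less_imp_neq[symmetric])
        then show "continuous_on {-b<..<b} (F (apply_bcontfun u))"
          unfolding F_def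
          by (rule continuous_on_compose2[where f = "\<lambda>x. max 0 x"]) (auto intro: continuous_intros)
      qed
      fix x :: real
      let ?x = "max 0 x" and ?\<sigma> = "\<sigma> (norm u)"
      have int: "integral {?x..a} ?\<sigma> \<le> integral {0..} ?\<sigma>" "integral {a..} ?\<sigma> \<le> integral {0..} ?\<sigma>"
        using a by (auto intro!: integral_subset_le \<sigma>_int[OF ad] \<sigma>0[OF ad])
      have I0: "integral {0..} ?\<sigma> \<ge> 0" by (intro integral_nonneg \<sigma>_int[OF ad] \<sigma>0[OF ad]) auto
      have "norm (green (S (apply_bcontfun u)) ?x) \<le> exp (\<mu> * ?x) * (M * integral {?x..a} ?\<sigma> + C * integral {a..} ?\<sigma>)"
        by (rule norm_green_le[OF ad]) simp
      also have "\<dots> \<le> exp (\<mu> * ?x) * (M * integral {0..} ?\<sigma> + C * integral {0..} ?\<sigma>)"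
        using int M0 C0 by (intro mult_left_mono add_mono) auto
      also have "\<dots> = exp (\<mu> * ?x) * B" by (simp add: B_def algebra_simps)
      also have "\<dots> \<le> exp (\<mu> * ?x) * (B * h ?x)"
      proof -
        have "B \<ge> 0" using I0 M0 C0 by (simp add: B_def)
        then show ?thesis using mult_left_mono[OF h1[of ?x], of B] by (intro mult_left_mono) auto
      qed
      finally show "norm (F (apply_bcontfun u) x) \<le> B"
        unfolding F_def by (rule norm_F)
    qed
  qed
  define T where "T u = Bcontfun (F (apply_bcontfun u))" for u
  have T: "apply_bcontfun (T u) = F (apply_bcontfun u)" for u
    unfolding T_def by (rule Bcontfun_inverse[OF F_in])
  \<comment> \<open>By linearity the difference of the images is \<open>green\<close> applied to the
    source built from \<open>w\<close>, whose majorant is the distance times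
    \<open>r t * h t\<close>.\<close>
  have contr: "dist (T u) (T v) \<le> 1 / 2 * dist u v" for u v
  proof (rule dist_bound)
    fix x :: real
    define w where "w t = apply_bcontfun u t - apply_bcontfun v t" for t
    let ?\<delta> = "dist u v" and ?x = "max 0 x"
    have w: "continuous_on UNIV w" "\<And>t. norm (w t) \<le> ?\<delta>"
      unfolding w_def using dist_bounded[of u _ v] by (auto intro!: continuous_intros simp: dist_norm)
    note ad = adm0[OF w]
    have ad_u: "admissible (S (apply_bcontfun u)) (\<sigma> (norm u))" "admissible (S (apply_bcontfun v)) (\<sigma> (norm v))"
      by (rule adm; auto simp: norm_bounded intro: continuous_on_apply_bcontfun)+
    have Sw: "(\<lambda>t. R t ** (\<rho> t *\<^sub>R w t)) = (\<lambda>t. S (apply_bcontfun u) t - S (apply_bcontfun v) t)"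
      by (simp add: S_def w_def fun_eq_iff mat_mult.diff_right[symmetric] scaleR_diff_right)
    have "norm (green (\<lambda>t. R t ** (\<rho> t *\<^sub>R w t)) ?x) \<le> exp (\<mu> * ?x) *
       (M * integral {?x..a} (\<lambda>t. ?\<delta> * (r t * h t)) + C * integral {a..} (\<lambda>t. ?\<delta> * (r t * h t)))"
      by (rule norm_green_le[OF ad]) simp
    also have "\<dots> \<le> exp (\<mu> * ?x) * (1 / 2 * ?\<delta> * h ?x)"
    proof (rule mult_left_mono)
      have "M * integral {?x..a} (\<lambda>t. r t * h t) \<le> h ?x / 4"
      proof (cases "?x \<le> a")
        case True
        have "((\<lambda>t. r t * h t) has_integral ((h ?x - 1) / (4 * M))) {?x..a}"
          unfolding h_def using M1 True by (intro has_integral_exp_integral r_on) auto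
        then have "M * integral {?x..a} (\<lambda>t. r t * h t) = (h ?x - 1) / 4"
          using M1 by (simp add: integral_unique)
        then show ?thesis by simp
      next
        case False
        then show ?thesis using hpos[of ?x] by simp
      qed
      moreover have "C * integral {a..} (\<lambda>t. r t * h t) \<le> h ?x / 4"
      proof -
        have "integral {a..} (\<lambda>t. r t * h t) = integral {a..} r"
          by (rule Henstock_Kurzweil_Integration.integral_cong) (simp add: ha)
        then show ?thesis using a(2) h1[of ?x] by simp
      qed
      ultimately have "?\<delta> * (M * integral {?x..a} (\<lambda>t. r t * h t) + C * integral {a..} (\<lambda>t. r t * h t)) \<le> ?\<delta> * (h ?x / 4 + h ?x / 4)"
        by (intro mult_left_mono add_mono) auto
      moreover have "integral U (\<lambda>t. ?\<delta> * (r t * h t)) = ?\<delta> * integral U (\<lambda>t. r t * h t)" for U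
        by (rule Henstock_Kurzweil_Integration.integral_mult_right)
      ultimately show "M * integral {?x..a} (\<lambda>t. ?\<delta> * (r t * h t)) + C * integral {a..} (\<lambda>t. ?\<delta> * (r t * h t)) \<le> 1 / 2 * ?\<delta> * h ?x"
        by (simp add: algebra_simps)
    qed simp
    finally have "norm (inverse (\<rho> ?x) *\<^sub>R green (\<lambda>t. R t ** (\<rho> t *\<^sub>R w t)) ?x) \<le> 1 / 2 * ?\<delta>"
      by (rule norm_F)
    then show "dist (T u x) (T v x) \<le> 1 / 2 * dist u v"
      unfolding T F_def dist_norm Sw green_diff[OF ad_u] by (simp add: scaleR_diff_right)
  qed
  have "\<exists>!u. T u = u"
    by (rule banach_fix_type[of "1 / 2"]) (use contr in auto)
  then obtain u where u: "T u = u" by blast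
  have fix_u: "\<rho> x *\<^sub>R apply_bcontfun u x = green (S (apply_bcontfun u)) x" if "x \<ge> 0" for x
  proof -
    have "apply_bcontfun u x = F (apply_bcontfun u) x" using T[of u] u by simp
    then show ?thesis using \<rho>pos[of x] that by (simp add: F_def)
  qed
  have cu: "continuous_on UNIV (apply_bcontfun u)" "\<And>t. norm (apply_bcontfun u t) \<le> norm u"
    by (auto simp: norm_bounded intro: continuous_on_apply_bcontfun)
  note ad = adm[OF cu]
  define g where "g t = \<Phi>i t ** S (apply_bcontfun u) t" for t
  \<comment> \<open>The initial value \<open>W + vs ...\<close> puts the sum of
    \<open>\<Phi> x ** W\<close> and the fixed point into variation of constants form.\<close>
  define c where "c = W + vs (S (apply_bcontfun u))"
  define Y where "Y x = \<Phi> x ** (c + integral {0..x} g)" for x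
  have Y_eq: "Y x = \<Phi> x ** W + green (S (apply_bcontfun u)) x" for x
    by (simp add: Y_def c_def green_def g_def[abs_def] mat_mult.add_right add.assoc)
  show thesis
  proof (rule that)
    show "is_solution (\<lambda>x. A x + R x) {0..} Y"
      unfolding Y_def
    proof (rule is_solution_fundamental_solution_mult_integral[OF fund])
      show "g absolutely_integrable_on {0..b}" for b
        unfolding g_def[abs_def] by (rule q_int[OF ad]) simp
      fix x :: real assume "x \<ge> 0"
      then have "S (apply_bcontfun u) x = R x ** Y x" by (simp add: S_def Y_eq fix_u)
      then show "\<Phi> x ** g x = R x ** (\<Phi> x ** (c + integral {0..x} g))"
        by (simp add: g_def Y_def)
    qed
    show "\<forall>x\<ge>0. norm (Y x - \<Phi> x ** W) \<le> H * norm u * exp (\<mu> * x)"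
    proof (intro allI impI)
      fix x :: real assume x: "x \<ge> 0"
      have "norm (Y x - \<Phi> x ** W) = \<rho> x * norm (apply_bcontfun u x)"
        using fix_u[OF x, symmetric] \<rho>pos[of x] by (simp add: Y_eq)
      also have "\<dots> \<le> (exp (\<mu> * x) * H) * norm u"
        unfolding \<rho>_def using hH[OF x] cu(2)[of x] hpos[of x] less_le_trans[OF hpos hH[OF x]]
        by (intro mult_mono) auto
      finally show "norm (Y x - \<Phi> x ** W) \<le> H * norm u * exp (\<mu> * x)" by (simp add: mult_ac)
    qed
  qed
qed

end

subsection \<open>Bohl and Lyapunov exponents\<close>

text \<open>Since \<open>x - x'\<close> is not positive, lowering a rate weakens the estimate. The
  set of rates is thus closed downwards, and every real number below the supremum is attained. The
  constant is replaced by its absolute value so that estimates can be multiplied.\<close>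

lemma less_lower_bohlE:
  assumes "ereal \<mu> < lower_bohl \<Phi> J P"
  obtains C where "C \<ge> 0" "\<And>x x'. x \<in> J \<Longrightarrow> x' \<in> J \<Longrightarrow> x \<le> x' \<Longrightarrow>
    norm (\<Phi> x ** P ** matrix_inv (\<Phi> x')) \<le> C * exp (\<mu> * (x - x'))"
proof -
  obtain \<kappa> C where \<kappa>: "\<mu> < \<kappa>" and C: "\<And>x x'. x \<in> J \<Longrightarrow> x' \<in> J \<Longrightarrow> x \<le> x' \<Longrightarrow>
    norm (\<Phi> x ** P ** matrix_inv (\<Phi> x')) \<le> C * exp (\<kappa> * (x - x'))"
    using assms unfolding lower_bohl_def less_Sup_iff by auto
  show thesis
  proof (rule that[of "\<bar>C\<bar>"])
    fix x x' assume x: "x \<in> J" "x' \<in> J" "x \<le> x'"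
    have "C * exp (\<kappa> * (x - x')) \<le> \<bar>C\<bar> * exp (\<mu> * (x - x'))"
      using x \<kappa> by (intro mult_mono) (auto intro: mult_right_mono_neg)
    with C[OF x] show "norm (\<Phi> x ** P ** matrix_inv (\<Phi> x')) \<le> \<bar>C\<bar> * exp (\<mu> * (x - x'))" by linarith
  qed simp
qed

lemma upper_bohl_lessE:
  assumes "upper_bohl \<Phi> J P < ereal \<mu>"
  obtains C where "C \<ge> 0" "\<And>x x'. x \<in> J \<Longrightarrow> x' \<in> J \<Longrightarrow> x' \<le> x \<Longrightarrow>
    norm (\<Phi> x ** P ** matrix_inv (\<Phi> x')) \<le> C * exp (\<mu> * (x - x'))"
proof -
  obtain \<kappa> C where \<kappa>: "\<kappa> < \<mu>" and C: "\<And>x x'. x \<in> J \<Longrightarrow> x' \<in> J \<Longrightarrow> x' \<le> x \<Longrightarrow>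
    norm (\<Phi> x ** P ** matrix_inv (\<Phi> x')) \<le> C * exp (\<kappa> * (x - x'))"
    using assms unfolding upper_bohl_def Inf_less_iff by auto
  show thesis
  proof (rule that[of "\<bar>C\<bar>"])
    fix x x' assume x: "x \<in> J" "x' \<in> J" "x' \<le> x"
    have "C * exp (\<kappa> * (x - x')) \<le> \<bar>C\<bar> * exp (\<mu> * (x - x'))"
      using x \<kappa> by (intro mult_mono) (auto intro: mult_right_mono)
    with C[OF x] show "norm (\<Phi> x ** P ** matrix_inv (\<Phi> x')) \<le> \<bar>C\<bar> * exp (\<mu> * (x - x'))" by linarith
  qed simp
qed

lemma lower_bohl_antimono: "J' \<subseteq> J \<Longrightarrow> lower_bohl \<Phi> J P \<le> lower_bohl \<Phi> J' P"
  unfolding lower_bohl_def by (intro Sup_subset_mono image_mono Collect_mono) blast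

lemma upper_bohl_mono: "J' \<subseteq> J \<Longrightarrow> upper_bohl \<Phi> J' P \<le> upper_bohl \<Phi> J P"
  unfolding upper_bohl_def by (intro Inf_superset_mono image_mono Collect_mono) blast

text \<open>Every rate works for the zero matrix. The reversed infinite endpoints mean that a member
  whose lower exponent does not exceed the upper one must be nonzero.\<close>

lemma bohl_zero: "lower_bohl \<Phi> J 0 = \<infinity>" "upper_bohl \<Phi> J 0 = -\<infinity>"
proof -
  have "ereal \<kappa> \<le> lower_bohl \<Phi> J 0" "upper_bohl \<Phi> J 0 \<le> ereal \<kappa>" for \<kappa>
    unfolding lower_bohl_def upper_bohl_def
    by (auto intro!: Sup_upper Inf_lower imageI exI[of _ 0])
  then show "lower_bohl \<Phi> J 0 = \<infinity>" "upper_bohl \<Phi> J 0 = -\<infinity>"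
    using ereal_top ereal_bot by blast+
qed

lemma norm_projection_ge_1:
  fixes E :: "complex ^ 'n ^ 'n"
  assumes "E ** E = E" "E \<noteq> 0"
  shows "norm E \<ge> 1"
  using norm_matrix_mult_le[of E E] assms by simp

text \<open>The conjugated projection at \<open>x\<close> factors through time 0. If the lower
  exponent exceeded the upper one, the forward and backward bounds would make its norm tend to 0,
  whereas a nonzero projection has norm at least 1.\<close>

lemma lower_bohl_le_upper_bohl:
  fixes \<Phi> :: "real \<Rightarrow> complex ^ 'n ^ 'n"
  assumes inv: "\<And>x. invertible (\<Phi> x)" and P: "P ** P = P" "P \<noteq> 0"
  shows "lower_bohl \<Phi> {0..} P \<le> upper_bohl \<Phi> {0..} P"
proof (rule ccontr)
  assume "\<not> lower_bohl \<Phi> {0..} P \<le> upper_bohl \<Phi> {0..} P"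
  then have "upper_bohl \<Phi> {0..} P < lower_bohl \<Phi> {0..} P" by simp
  then obtain \<mu> where \<mu>: "upper_bohl \<Phi> {0..} P < ereal \<mu>" "ereal \<mu> < lower_bohl \<Phi> {0..} P"
    using ereal_dense2 by blast
  from ereal_dense2[OF \<mu>(2)] obtain \<nu> where \<nu>: "\<mu> < \<nu>" "ereal \<nu> < lower_bohl \<Phi> {0..} P" by auto
  note inv_simps = matrix_inv_mult[OF inv] matrix_inv_mult_assoc[OF inv]
  obtain C where C: "C \<ge> 0" "\<And>x x'. x \<in> {0..} \<Longrightarrow> x' \<in> {0..} \<Longrightarrow> x' \<le> x \<Longrightarrow>
    norm (\<Phi> x ** P ** matrix_inv (\<Phi> x')) \<le> C * exp (\<mu> * (x - x'))"
    using upper_bohl_lessE[OF \<mu>(1)] by blast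
  obtain C' where C': "C' \<ge> 0" "\<And>x x'. x \<in> {0..} \<Longrightarrow> x' \<in> {0..} \<Longrightarrow> x \<le> x' \<Longrightarrow>
    norm (\<Phi> x ** P ** matrix_inv (\<Phi> x')) \<le> C' * exp (\<nu> * (x - x'))"
    using less_lower_bohlE[OF \<nu>(2)] by blast
  have le: "1 \<le> C * C' * exp ((\<mu> - \<nu>) * x)" if x: "x \<ge> 0" for x
  proof -
    let ?E = "\<Phi> x ** P ** matrix_inv (\<Phi> x)"
    have "?E ** ?E = \<Phi> x ** (P ** P) ** matrix_inv (\<Phi> x)"
      by (simp add: matrix_mul_assoc[symmetric] inv_simps)
    moreover have "matrix_inv (\<Phi> x) ** ?E ** \<Phi> x = P"
      by (simp add: matrix_mul_assoc[symmetric] inv_simps)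
    then have "?E \<noteq> 0" using P(2) by auto
    ultimately have "1 \<le> norm ?E" using P(1) by (intro norm_projection_ge_1) auto
    also have "?E = (\<Phi> x ** P ** matrix_inv (\<Phi> 0)) ** (\<Phi> 0 ** P ** matrix_inv (\<Phi> x))"
    proof -
      have "(\<Phi> x ** P ** matrix_inv (\<Phi> 0)) ** (\<Phi> 0 ** P ** matrix_inv (\<Phi> x)) = \<Phi> x ** (P ** P) ** matrix_inv (\<Phi> x)"
        by (simp add: matrix_mul_assoc[symmetric] inv_simps)
      then show ?thesis using P(1) by simp
    qed
    also have "norm \<dots> \<le> (C * exp (\<mu> * (x - 0))) * (C' * exp (\<nu> * (0 - x)))"
      using x C(1) C'(1) by (intro order_trans[OF norm_matrix_mult_le] mult_mono C(2) C'(2)) auto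
    also have "\<dots> = C * C' * exp ((\<mu> - \<nu>) * x)"
      by (simp add: exp_add[symmetric] algebra_simps)
    finally show ?thesis .
  qed
  have "\<forall>\<^sub>F x in at_top. 1 \<le> C * C' * exp ((\<mu> - \<nu>) * x)"
    using eventually_ge_at_top[of "0::real"] by eventually_elim (rule le)
  then have "(1::real) \<le> 0" by (rule le_0_of_exp_decay[OF \<nu>(1)])
  then show False by simp
qed

lemma Limsup_log_norm_less_imp:
  assumes "Limsup at_top (\<lambda>x. ereal (1 / x) * log_norm (Z x)) < ereal \<mu>"
  shows "\<forall>\<^sub>F x in at_top. norm (Z x) \<le> exp (\<mu> * x)"
proof -
  have "\<forall>\<^sub>F x in at_top. ereal (1 / x) * log_norm (Z x) < ereal \<mu>"
    using assms by (rule Limsup_lessD)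
  with eventually_gt_at_top[of 0] show ?thesis
  proof eventually_elim
    case (elim x)
    show ?case
    proof (cases "norm (Z x) = 0")
      case False
      then have "1 / x * ln (norm (Z x)) < \<mu>" using elim(2) by (simp add: log_norm_def)
      then have "ln (norm (Z x)) < \<mu> * x" using elim(1) by (simp add: field_simps)
      then have "exp (ln (norm (Z x))) \<le> exp (\<mu> * x)" by (subst exp_le_cancel_iff) simp
      moreover have "exp (ln (norm (Z x))) = norm (Z x)" using False by (intro exp_ln) simp
      ultimately show ?thesis by (simp only:)
    qed simp
  qed
qed

text \<open>The gap between \<mu> and \<nu> absorbs the constant \<open>K\<close>, since
  \<open>K * exp ((\<mu> - \<nu>) * x)\<close> is eventually below 1.\<close>

lemma Limsup_log_norm_le:
  assumes K: "\<And>x. x \<ge> 0 \<Longrightarrow> norm (Z x) \<le> K * exp (\<mu> * x)" and "\<mu> < \<nu>"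
  shows "Limsup at_top (\<lambda>x. ereal (1 / x) * log_norm (Z x)) \<le> ereal \<nu>"
proof (rule Limsup_bounded)
  have "\<forall>\<^sub>F x in at_top. K * exp ((\<mu> - \<nu>) * x) < 1"
    using exp_decay_tendsto_0[OF \<open>\<mu> < \<nu>\<close>] by (rule order_tendstoD) simp
  with eventually_gt_at_top[of 0]
  show "\<forall>\<^sub>F x in at_top. ereal (1 / x) * log_norm (Z x) \<le> ereal \<nu>"
  proof eventually_elim
    case (elim x)
    show ?case
    proof (cases "norm (Z x) = 0")
      case True
      then show ?thesis using elim by (simp add: log_norm_def)
    next
      case False
      have "norm (Z x) \<le> K * exp (\<mu> * x)" using K elim by simp
      also have "\<dots> = K * exp ((\<mu> - \<nu>) * x) * exp (\<nu> * x)"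
        by (simp add: exp_add[symmetric] algebra_simps)
      also have "\<dots> \<le> 1 * exp (\<nu> * x)" using elim by (intro mult_right_mono) auto
      finally have "norm (Z x) \<le> exp (\<nu> * x)" by simp
      then have "ln (norm (Z x)) \<le> ln (exp (\<nu> * x))" using False by (subst ln_le_cancel_iff) auto
      then have "1 / x * ln (norm (Z x)) \<le> \<nu>" using elim(1) by (simp add: field_simps)
      then show ?thesis using False by (simp add: log_norm_def)
    qed
  qed
qed

lemma exists_real_between:
  assumes "finite S" "\<forall>s\<in>S. s < (b::ereal)" "-\<infinity> < b"
  obtains \<mu> where "\<forall>s\<in>S. s < ereal \<mu>" "ereal \<mu> < b"
proof -
  \<comment> \<open>Inserting \<open>-\<infinity>\<close> keeps \<open>Max\<close> meaningful when
    \<open>S\<close> is empty.\<close>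
  have "Max (insert (-\<infinity>) S) < b" using assms by (subst Max_less_iff) auto
  then obtain \<mu> where "Max (insert (-\<infinity>) S) < ereal \<mu>" "ereal \<mu> < b"
    using ereal_dense2 by blast
  then show thesis using that assms(1) by (subst (asm) Max_less_iff) auto
qed

text \<open>The predicate \<open>S\<close> stands for the order of \<open>x\<close> and
  \<open>t\<close>, so that one argument serves the forward and the backward estimates.\<close>

lemma sum_kernel_bound:
  fixes \<Phi> :: "real \<Rightarrow> complex ^ 'n ^ 'n"
  assumes "finite I" and "\<And>i. i \<in> I \<Longrightarrow> \<exists>C. \<forall>x t. S x t \<longrightarrow> norm (\<Phi> x ** P i ** matrix_inv (\<Phi> t)) \<le> C * exp (\<mu> * (x - t))"
  shows "\<exists>C\<ge>0. \<forall>x t. S x t \<longrightarrow> norm (\<Phi> x ** (\<Sum>i\<in>I. P i) ** matrix_inv (\<Phi> t)) \<le> C * exp (\<mu> * (x - t))"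
proof -
  obtain C where C: "\<And>i x t. i \<in> I \<Longrightarrow> S x t \<Longrightarrow> norm (\<Phi> x ** P i ** matrix_inv (\<Phi> t)) \<le> C i * exp (\<mu> * (x - t))"
    using assms(2) by metis
  show ?thesis
  proof (rule exI[of _ "\<Sum>i\<in>I. \<bar>C i\<bar>"], intro conjI allI impI)
    show "(\<Sum>i\<in>I. \<bar>C i\<bar>) \<ge> 0" by (simp add: sum_nonneg)
    fix x t assume S: "S x t"
    have "\<Phi> x ** (\<Sum>i\<in>I. P i) ** matrix_inv (\<Phi> t) = (\<Sum>i\<in>I. \<Phi> x ** P i ** matrix_inv (\<Phi> t))"
      by (simp add: mat_mult.sum_left mat_mult.sum_right)
    also have "norm \<dots> \<le> (\<Sum>i\<in>I. \<bar>C i\<bar> * exp (\<mu> * (x - t)))"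
    proof (rule sum_norm_le)
      fix i assume "i \<in> I"
      have "C i * exp (\<mu> * (x - t)) \<le> \<bar>C i\<bar> * exp (\<mu> * (x - t))" by (intro mult_right_mono) auto
      with C[OF \<open>i \<in> I\<close> S] show "norm (\<Phi> x ** P i ** matrix_inv (\<Phi> t)) \<le> \<bar>C i\<bar> * exp (\<mu> * (x - t))"
        by linarith
    qed
    finally show "norm (\<Phi> x ** (\<Sum>i\<in>I. P i) ** matrix_inv (\<Phi> t)) \<le> (\<Sum>i\<in>I. \<bar>C i\<bar>) * exp (\<mu> * (x - t))"
      by (simp add: sum_distrib_right)
  qed
qed

lemma sum_bound_right:
  fixes \<Phi> :: "real \<Rightarrow> complex ^ 'n ^ 'n"
  assumes "finite I" and less: "\<And>i. i \<in> I \<Longrightarrow> upper_bohl \<Phi> {0..} (P i) < ereal \<mu>"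
  obtains C where "C \<ge> 0" "\<forall>t\<ge>0. \<forall>x\<ge>t.
    norm (\<Phi> x ** (\<Sum>i\<in>I. P i) ** matrix_inv (\<Phi> t)) \<le> C * exp (\<mu> * (x - t))"
proof -
  have "\<exists>C\<ge>0. \<forall>x t. 0 \<le> t \<and> t \<le> x \<longrightarrow> norm (\<Phi> x ** (\<Sum>i\<in>I. P i) ** matrix_inv (\<Phi> t)) \<le> C * exp (\<mu> * (x - t))"
  proof (rule sum_kernel_bound[OF \<open>finite I\<close>])
    fix i assume "i \<in> I"
    show "\<exists>C. \<forall>x t. 0 \<le> t \<and> t \<le> x \<longrightarrow> norm (\<Phi> x ** P i ** matrix_inv (\<Phi> t)) \<le> C * exp (\<mu> * (x - t))"
    proof (rule upper_bohl_lessE[OF less[OF \<open>i \<in> I\<close>]])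
      fix C assume C: "\<And>x x'. x \<in> {0..} \<Longrightarrow> x' \<in> {0..} \<Longrightarrow> x' \<le> x \<Longrightarrow>
        norm (\<Phi> x ** P i ** matrix_inv (\<Phi> x')) \<le> C * exp (\<mu> * (x - x'))"
      show ?thesis by (intro exI[of _ C] allI impI C) auto
    qed
  qed
  then show thesis by (elim exE conjE) (rule that, auto)
qed

lemma sum_bound_left:
  fixes \<Phi> :: "real \<Rightarrow> complex ^ 'n ^ 'n"
  assumes "finite I" and less: "\<And>i. i \<in> I \<Longrightarrow> ereal \<mu> < lower_bohl \<Phi> {0..} (P i)"
  obtains C where "C \<ge> 0" "\<forall>x\<ge>0. \<forall>t\<ge>x.
    norm (\<Phi> x ** (\<Sum>i\<in>I. P i) ** matrix_inv (\<Phi> t)) \<le> C * exp (\<mu> * (x - t))"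
proof -
  have "\<exists>C\<ge>0. \<forall>x t. 0 \<le> x \<and> x \<le> t \<longrightarrow> norm (\<Phi> x ** (\<Sum>i\<in>I. P i) ** matrix_inv (\<Phi> t)) \<le> C * exp (\<mu> * (x - t))"
  proof (rule sum_kernel_bound[OF \<open>finite I\<close>])
    fix i assume "i \<in> I"
    show "\<exists>C. \<forall>x t. 0 \<le> x \<and> x \<le> t \<longrightarrow> norm (\<Phi> x ** P i ** matrix_inv (\<Phi> t)) \<le> C * exp (\<mu> * (x - t))"
    proof (rule less_lower_bohlE[OF less[OF \<open>i \<in> I\<close>]])
      fix C assume C: "\<And>x x'. x \<in> {0..} \<Longrightarrow> x' \<in> {0..} \<Longrightarrow> x \<le> x' \<Longrightarrow>
        norm (\<Phi> x ** P i ** matrix_inv (\<Phi> x')) \<le> C * exp (\<mu> * (x - x'))"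
      show ?thesis by (intro exI[of _ C] allI impI C) auto
    qed
  qed
  then show thesis by (elim exE conjE) (rule that, auto)
qed

subsection \<open>Jost solutions on the positive half-line\<close>

text \<open>An eventual bound is enough, because on the remaining compact interval the ratio
  \<open>f / w\<close> is continuous and hence bounded.\<close>

lemma integrable_on_atLeast_of_continuous_bound:
  fixes r f w :: "real \<Rightarrow> real"
  assumes r: "\<And>b. r absolutely_integrable_on {0..b}" and r0: "\<And>t. r t \<ge> 0"
    and rw: "(\<lambda>t. r t * w t) integrable_on {0..}"
    and f: "\<And>b. continuous_on {0..b} f" and w: "\<And>b. continuous_on {0..b} w" "\<And>t. w t > 0"
    and le: "\<forall>\<^sub>F t in at_top. \<bar>f t\<bar> \<le> w t"
  shows "(\<lambda>t. r t * f t) integrable_on {0..}"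
proof -
  obtain T where T: "\<And>t. t \<ge> T \<Longrightarrow> \<bar>f t\<bar> \<le> w t"
    using le unfolding eventually_at_top_linorder by blast
  have "continuous_on {0..T} (\<lambda>t. f t / w t)"
    using w(2) by (intro continuous_on_divide f w(1)) (auto simp: less_imp_neq[symmetric])
  then have "bounded ((\<lambda>t. f t / w t) ` {0..T})"
    by (intro compact_imp_bounded compact_continuous_image) auto
  then obtain B where B: "\<And>t. t \<in> {0..T} \<Longrightarrow> norm (f t / w t) \<le> B"
    unfolding bounded_iff by (metis imageI)
  have "(\<lambda>t. r t * f t) absolutely_integrable_on {0..}"
  proof (rule absolutely_integrable_on_half_line)
    show "(\<lambda>t. r t * f t) integrable_on {0..b}" for b
      by (intro absolutely_integrable_imp_integrable_on absolutely_integrable_mult_continuous r f)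
    show "(\<lambda>t. max 1 B * (r t * w t)) integrable_on {0..}" by (intro integrable_on_mult_right rw)
    fix t :: real assume t: "t \<ge> 0"
    have "\<bar>f t\<bar> \<le> max 1 B * w t"
    proof (cases "t \<ge> T")
      case True
      have "\<bar>f t\<bar> \<le> 1 * w t" using T[OF True] by simp
      also have "\<dots> \<le> max 1 B * w t" using w(2)[of t] by (intro mult_right_mono) auto
      finally show ?thesis .
    next
      case False
      then have "\<bar>f t\<bar> \<le> B * w t" using B[of t] t w(2)[of t] by (simp add: abs_divide pos_divide_le_eq)
      also have "\<dots> \<le> max 1 B * w t" using w(2)[of t] by (intro mult_right_mono) auto
      finally show ?thesis .
    qed
    then have "r t * \<bar>f t\<bar> \<le> r t * (max 1 B * w t)" using r0 by (rule mult_left_mono)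
    then show "norm (r t * f t) \<le> max 1 B * (r t * w t)"
      using r0[of t] by (simp add: abs_mult mult_ac)
  qed
  then show ?thesis by (rule absolutely_integrable_imp_integrable_on)
qed

locale split_equation = perturbed_equation A R \<Phi>
  for A R \<Phi> :: "real \<Rightarrow> complex ^ 'n ^ 'n" +
  fixes Qs :: "nat \<Rightarrow> complex ^ 'n ^ 'n" and m :: nat
  assumes Q_idem: "i \<in> {1..m} \<Longrightarrow> Qs i ** Qs i = Qs i"
    and Q_sum: "(\<Sum>i=1..m. Qs i) = mat 1"
    and bohl_ordered: "i \<in> {1..m} \<Longrightarrow> j \<in> {1..m} \<Longrightarrow> i < j \<Longrightarrow>
        upper_bohl \<Phi> {0..} (Qs i) < lower_bohl \<Phi> {0..} (Qs j)"
    and bohl_le: "i \<in> {1..m} \<Longrightarrow> lower_bohl \<Phi> {0..} (Qs i) \<le> upper_bohl \<Phi> {0..} (Qs i)"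
begin

lemma lower_bohl_mono_index:
  "i \<in> {1..m} \<Longrightarrow> j \<in> {1..m} \<Longrightarrow> i \<le> j \<Longrightarrow> lower_bohl \<Phi> {0..} (Qs i) \<le> lower_bohl \<Phi> {0..} (Qs j)"
  using bohl_le[of i] bohl_ordered[of i j] by (cases "i = j") auto

lemma exists_jost_plus:
  assumes j: "j \<in> {1..m}"
    and \<beta>: "lyapunov_plus \<Phi> (Qs j) - lower_bohl \<Phi> {0..} (Qs j) < ereal \<beta>"
    and R\<beta>: "(\<lambda>x. r x * exp (\<beta> * x)) integrable_on {0..}"
  shows "\<exists>Y. jost_plus A R \<Phi> (Qs j) Y"
proof -
  let ?l = "lower_bohl \<Phi> {0..} (Qs j)" and ?L = "lyapunov_plus \<Phi> (Qs j)"
  \<comment> \<open>If the lower exponent were \<open>-\<infinity>\<close>, or both exponents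
    \<open>\<infinity>\<close>, the difference would be \<open>\<infinity>\<close> by the
    conventions for extended reals, contrary to the bound by \<beta>.\<close>
  have "?L < ereal \<beta> + ?l" "-\<infinity> < ?l"
    using \<beta> by (cases ?L; cases ?l; simp)+
  then obtain l where l: "?L < ereal l" "ereal l < ereal \<beta> + ?l" using ereal_dense2 by blast
  have "ereal (l - \<beta>) < ?l" using l(2) by (cases ?l) auto
  have fin: "finite (insert (ereal (l - \<beta>)) ((\<lambda>i. upper_bohl \<Phi> {0..} (Qs i)) ` {1..<j}))" by simp
  have lt: "\<forall>s\<in>insert (ereal (l - \<beta>)) ((\<lambda>i. upper_bohl \<Phi> {0..} (Qs i)) ` {1..<j}). s < ?l"
    using bohl_ordered[OF _ j] j \<open>ereal (l - \<beta>) < ?l\<close> by auto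
  \<comment> \<open>Three demands meet here: \<mu> exceeds \<open>l - \<beta>\<close> to make the
    source integrable, exceeds the upper exponents of the earlier members for the forward bound, and
    lies below the lower exponent of \<open>Qs j\<close> for the backward bound and the Jost
    condition.\<close>
  obtain \<mu> where "\<forall>s\<in>insert (ereal (l - \<beta>)) ((\<lambda>i. upper_bohl \<Phi> {0..} (Qs i)) ` {1..<j}). s < ereal \<mu>"
    and \<mu>3: "ereal \<mu> < ?l"
    by (rule exists_real_between[OF fin lt \<open>-\<infinity> < ?l\<close>])
  then have \<mu>: "l - \<beta> < \<mu>" "\<And>i. i \<in> {1..<j} \<Longrightarrow> upper_bohl \<Phi> {0..} (Qs i) < ereal \<mu>" "ereal \<mu> < ?l"
    by simp_all
  \<comment> \<open>A bound at rate \<mu> controls the upper limit by any rate above \<mu>; \<nu> is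
    one that is still below the lower exponent.\<close>
  from ereal_dense2[OF \<mu>(3)] obtain \<nu> where \<nu>: "\<mu> < \<nu>" "ereal \<nu> < ?l" by auto
  obtain C1 where C1': "C1 \<ge> 0" "\<forall>t\<ge>0. \<forall>x\<ge>t.
    norm (\<Phi> x ** (\<Sum>i\<in>{1..<j}. Qs i) ** \<Phi>i t) \<le> C1 * exp (\<mu> * (x - t))"
    by (rule sum_bound_right[OF finite_atLeastLessThan \<mu>(2)])
  note C1 = C1'(1) C1'(2)[rule_format]
  have "ereal \<mu> < lower_bohl \<Phi> {0..} (Qs i)" if "i \<in> {j..m}" for i
    using \<mu>(3) lower_bohl_mono_index[of j i] j that by (auto intro: less_le_trans)
  from this obtain C2 where C2': "C2 \<ge> 0" "\<forall>x\<ge>0. \<forall>t\<ge>x.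
    norm (\<Phi> x ** (\<Sum>i\<in>{j..m}. Qs i) ** \<Phi>i t) \<le> C2 * exp (\<mu> * (x - t))"
    by (rule sum_bound_left[OF finite_atLeastAtMost])
  note C2 = C2'(1) C2'(2)[rule_format]
  have int: "(\<lambda>t. r t * (norm (\<Phi> t ** Qs j) * exp (- \<mu> * t))) integrable_on {0..}"
  proof (rule integrable_on_atLeast_of_continuous_bound[OF r_on norm_ge_zero R\<beta>])
    have "\<forall>\<^sub>F t in at_top. norm (\<Phi> t ** Qs j) \<le> exp (l * t)"
      using l(1) unfolding lyapunov_plus_def by (rule Limsup_log_norm_less_imp)
    then show "\<forall>\<^sub>F t in at_top. \<bar>norm (\<Phi> t ** Qs j) * exp (- \<mu> * t)\<bar> \<le> exp (\<beta> * t)"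
      using eventually_ge_at_top[of 0]
    proof eventually_elim
      case (elim t)
      have "norm (\<Phi> t ** Qs j) * exp (- \<mu> * t) \<le> exp (l * t) * exp (- \<mu> * t)"
        using elim by (intro mult_right_mono) auto
      also have "\<dots> = exp ((l - \<mu>) * t)" by (simp add: exp_add[symmetric] algebra_simps)
      also have "\<dots> \<le> exp (\<beta> * t)" using \<mu>(1) elim by (simp add: mult_right_mono)
      finally show ?case by simp
    qed
  qed (auto intro!: continuous_intros mat_mult.continuous_on continuous_on_\<Phi>)
  have "(\<Sum>i\<in>{1..<j}. Qs i) + (\<Sum>i\<in>{j..m}. Qs i) = (\<Sum>i\<in>{1..<j} \<union> {j..m}. Qs i)"
    by (rule sum.union_disjoint[symmetric]) auto
  also have "{1..<j} \<union> {j..m} = {1..m}" using j by auto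
  finally have sum1: "(\<Sum>i\<in>{1..<j}. Qs i) + (\<Sum>i\<in>{j..m}. Qs i) = mat 1" using Q_sum by simp
  obtain Y K where Y: "is_solution (\<lambda>x. A x + R x) {0..} Y"
    and K: "\<forall>x\<ge>0. norm (Y x - \<Phi> x ** Qs j) \<le> K * exp (\<mu> * x)"
  proof (rule exists_solution_close_to[OF sum1 _ _ int, of "max C1 C2"])
    fix x t :: real
    show "norm (\<Phi> x ** (\<Sum>i\<in>{1..<j}. Qs i) ** \<Phi>i t) \<le> max C1 C2 * exp (\<mu> * (x - t))" if "0 \<le> t" "t \<le> x"
      by (rule order_trans[OF C1(2)[OF that]]) (intro mult_right_mono, auto)
    show "norm (\<Phi> x ** (\<Sum>i\<in>{j..m}. Qs i) ** \<Phi>i t) \<le> max C1 C2 * exp (\<mu> * (x - t))" if "0 \<le> x" "x \<le> t"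
      by (rule order_trans[OF C2(2)[OF that]]) (intro mult_right_mono, auto)
  qed
  have QQ: "Qs j ** Qs j = Qs j" using Q_idem j by simp
  have eq: "Y x ** Qs j - \<Phi> x ** Qs j = (Y x - \<Phi> x ** Qs j) ** Qs j" for x
    by (simp add: mat_mult.diff_left matrix_mul_assoc[symmetric] QQ)
  have "jost_plus A R \<Phi> (Qs j) (\<lambda>x. Y x ** Qs j)"
    unfolding jost_plus_def
  proof (intro conjI)
    show "is_solution (\<lambda>x. A x + R x) {0..} (\<lambda>x. Y x ** Qs j)" by (rule is_solution_mult_const[OF Y])
    have "Limsup at_top (\<lambda>x. ereal (1 / x) * log_norm (Y x ** Qs j - \<Phi> x ** Qs j)) \<le> ereal \<nu>"
    proof (rule Limsup_log_norm_le[OF _ \<nu>(1)])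
      fix x :: real assume "x \<ge> 0"
      then have "norm ((Y x - \<Phi> x ** Qs j) ** Qs j) \<le> (K * exp (\<mu> * x)) * norm (Qs j)"
        by (intro order_trans[OF norm_matrix_mult_le] mult_right_mono K[rule_format]) auto
      then show "norm (Y x ** Qs j - \<Phi> x ** Qs j) \<le> (K * norm (Qs j)) * exp (\<mu> * x)"
        unfolding eq by (simp add: mult_ac)
    qed
    also have "\<dots> < ?l" by (rule \<nu>(2))
    finally show "Limsup at_top (\<lambda>x. ereal (1 / x) * log_norm (Y x ** Qs j - \<Phi> x ** Qs j)) < ?l" .
    show "Y 0 ** Qs j = Y 0 ** Qs j ** Qs j" by (simp add: matrix_mul_assoc[symmetric] QQ)
  qed
  then show ?thesis by blast
qed

text \<open>Stated for all larger rates, so that estimates for several solutions or several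
  exponents can be brought to one common rate.\<close>

lemma jost_plus_growth:
  assumes "jost_plus A R \<Phi> (Qs j) Y"
  obtains \<mu> where "ereal \<mu> < lower_bohl \<Phi> {0..} (Qs j)"
    "\<forall>\<nu>\<ge>\<mu>. \<forall>\<^sub>F x in at_top. norm (Y x - \<Phi> x ** Qs j) \<le> exp (\<nu> * x)"
proof -
  have "Limsup at_top (\<lambda>x. ereal (1 / x) * log_norm (Y x - \<Phi> x ** Qs j)) < lower_bohl \<Phi> {0..} (Qs j)"
    using assms by (simp add: jost_plus_def)
  then obtain \<mu> where \<mu>: "Limsup at_top (\<lambda>x. ereal (1 / x) * log_norm (Y x - \<Phi> x ** Qs j)) < ereal \<mu>"
    "ereal \<mu> < lower_bohl \<Phi> {0..} (Qs j)" using ereal_dense2 by blast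
  show thesis
  proof (rule that[OF \<mu>(2)], intro allI impI)
    fix \<nu> assume "\<mu> \<le> \<nu>"
    then have "Limsup at_top (\<lambda>x. ereal (1 / x) * log_norm (Y x - \<Phi> x ** Qs j)) < ereal \<nu>"
      using \<mu>(1) by (simp add: less_le_trans)
    then show "\<forall>\<^sub>F x in at_top. norm (Y x - \<Phi> x ** Qs j) \<le> exp (\<nu> * x)"
      by (rule Limsup_log_norm_less_imp)
  qed
qed

lemma jost_plus_diff_growth:
  assumes "jost_plus A R \<Phi> (Qs j) Y" "jost_plus A R \<Phi> (Qs j) Y'"
  obtains \<mu> where "ereal \<mu> < lower_bohl \<Phi> {0..} (Qs j)"
    "\<forall>\<^sub>F x in at_top. norm (Y x - Y' x) \<le> 2 * exp (\<mu> * x)"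
    "is_solution (\<lambda>x. A x + R x) {0..} (\<lambda>x. Y x - Y' x)"
proof -
  obtain \<mu>1 where \<mu>1: "ereal \<mu>1 < lower_bohl \<Phi> {0..} (Qs j)"
    "\<forall>\<nu>\<ge>\<mu>1. \<forall>\<^sub>F x in at_top. norm (Y x - \<Phi> x ** Qs j) \<le> exp (\<nu> * x)"
    by (rule jost_plus_growth[OF assms(1)])
  obtain \<mu>2 where \<mu>2: "ereal \<mu>2 < lower_bohl \<Phi> {0..} (Qs j)"
    "\<forall>\<nu>\<ge>\<mu>2. \<forall>\<^sub>F x in at_top. norm (Y' x - \<Phi> x ** Qs j) \<le> exp (\<nu> * x)"
    by (rule jost_plus_growth[OF assms(2)])
  let ?\<mu> = "max \<mu>1 \<mu>2"
  show thesis
  proof (rule that[of ?\<mu>])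
    show "ereal ?\<mu> < lower_bohl \<Phi> {0..} (Qs j)" using \<mu>1(1) \<mu>2(1) by (simp add: max_def)
    have "\<mu>1 \<le> ?\<mu>" "\<mu>2 \<le> ?\<mu>" by auto
    from \<mu>1(2)[rule_format, OF this(1)] \<mu>2(2)[rule_format, OF this(2)]
    show "\<forall>\<^sub>F x in at_top. norm (Y x - Y' x) \<le> 2 * exp (?\<mu> * x)"
    proof eventually_elim
      case (elim x)
      have "norm (Y x - Y' x) = norm ((Y x - \<Phi> x ** Qs j) - (Y' x - \<Phi> x ** Qs j))" by simp
      also have "\<dots> \<le> norm (Y x - \<Phi> x ** Qs j) + norm (Y' x - \<Phi> x ** Qs j)" by (rule norm_triangle_ineq4)
      finally show ?case using elim by linarith
    qed
    show "is_solution (\<lambda>x. A x + R x) {0..} (\<lambda>x. Y x - Y' x)"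
      using assms by (intro is_solution_diff) (auto simp: jost_plus_def)
  qed
qed

text \<open>No exponent lies below that of the first member, so the backward bounds of all members
  add up to one for the full propagator, and the difference of two Jost solutions grows too slowly
  to be nonzero.\<close>

lemma jost_plus_unique:
  assumes m: "1 \<le> m" and Y: "jost_plus A R \<Phi> (Qs 1) Y" "jost_plus A R \<Phi> (Qs 1) Y'" and x: "x \<ge> 0"
  shows "Y x = Y' x"
proof -
  obtain \<mu> where \<mu>: "ereal \<mu> < lower_bohl \<Phi> {0..} (Qs 1)"
    "\<forall>\<^sub>F x in at_top. norm (Y x - Y' x) \<le> 2 * exp (\<mu> * x)"
    "is_solution (\<lambda>x. A x + R x) {0..} (\<lambda>x. Y x - Y' x)"
    by (rule jost_plus_diff_growth[OF Y])
  from ereal_dense2[OF \<mu>(1)] obtain \<nu> where \<nu>: "\<mu> < \<nu>" "ereal \<nu> < lower_bohl \<Phi> {0..} (Qs 1)" by auto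
  have "ereal \<nu> < lower_bohl \<Phi> {0..} (Qs i)" if "i \<in> {1..m}" for i
    using \<nu>(2) lower_bohl_mono_index[of 1 i] m that by (auto intro: less_le_trans)
  from this obtain C where "C \<ge> 0" and C': "\<forall>x\<ge>0. \<forall>t\<ge>x.
    norm (\<Phi> x ** (\<Sum>i\<in>{1..m}. Qs i) ** \<Phi>i t) \<le> C * exp (\<nu> * (x - t))"
    by (rule sum_bound_left[OF finite_atLeastAtMost])
  note C = C'[unfolded Q_sum matrix_mul_rid, rule_format]
  obtain x1 where x1: "\<And>x. x \<ge> x1 \<Longrightarrow> norm (Y x - Y' x) \<le> 2 * exp (\<mu> * x)"
    using \<mu>(2) unfolding eventually_at_top_linorder by blast
  have "Y x - Y' x = 0"
    by (rule solution_zero_of_growth[OF \<mu>(3) x1 C \<nu>(1) x])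
  then show ?thesis by simp
qed

end

section \<open>Ranges of the initial values\<close>

locale split_equation_perturbed = split_equation A R \<Phi> Qs m
  for A R \<Phi> :: "real \<Rightarrow> complex ^ 'n ^ 'n" and Qs :: "nat \<Rightarrow> complex ^ 'n ^ 'n" and m :: nat +
  fixes \<Psi> :: "real \<Rightarrow> complex ^ 'n ^ 'n" and P :: "nat \<Rightarrow> complex ^ 'n ^ 'n"
  assumes \<Psi>: "fundamental_solution (\<lambda>x. A x + R x) \<Psi>"
    and P_sum: "(\<Sum>i=1..m. P i) = mat 1"
    and lower_eq: "i \<in> {1..m} \<Longrightarrow> lower_bohl \<Psi> {0..} (P i) = lower_bohl \<Phi> {0..} (Qs i)"
    and upper_eq: "i \<in> {1..m} \<Longrightarrow> upper_bohl \<Psi> {0..} (P i) = upper_bohl \<Phi> {0..} (Qs i)"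
begin

lemma A_R: "loc_integrable (\<lambda>x. A x + R x)"
  using A by (auto simp: loc_integrable_def intro!: set_integral_add R_on)

lemma invertible_\<Psi>: "invertible (\<Psi> x)"
  by (rule invertible_fundamental_solution[OF A_R \<Psi>])

lemma \<Psi>0: "\<Psi> 0 = mat 1"
  using \<Psi> by (simp add: fundamental_solution_def)

lemma solution_eq_\<Psi>: "is_solution (\<lambda>x. A x + R x) {0..} Y \<Longrightarrow> x \<ge> 0 \<Longrightarrow> Y x = \<Psi> x ** Y 0"
  by (rule solution_eq_fundamental_solution[OF A_R \<Psi>])

text \<open>The rate is compared with the exponent of \<open>Qs i\<close> because growth is known
  from the unperturbed side; equality of the Bohl segments transfers it to
  \<open>P i\<close>.\<close>

lemma projection_initial_value_zero:
  assumes i: "i \<in> {1..m}" and Y: "is_solution (\<lambda>x. A x + R x) {0..} Y"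
    and growth: "\<forall>\<^sub>F x in at_top. norm (Y x) \<le> K * exp (\<mu> * x)"
    and less: "ereal \<mu> < lower_bohl \<Phi> {0..} (Qs i)"
  shows "P i ** Y 0 = 0"
proof -
  from ereal_dense2[OF less] obtain \<nu> where \<nu>: "\<mu> < \<nu>" "ereal \<nu> < lower_bohl \<Psi> {0..} (P i)"
    using lower_eq[OF i] by auto
  obtain C where C0: "C \<ge> 0" and C: "\<And>x x'. x \<in> {0..} \<Longrightarrow> x' \<in> {0..} \<Longrightarrow> x \<le> x' \<Longrightarrow>
    norm (\<Psi> x ** P i ** matrix_inv (\<Psi> x')) \<le> C * exp (\<nu> * (x - x'))"
    using less_lower_bohlE[OF \<nu>(2)] by metis
  have "\<forall>\<^sub>F x in at_top. norm (P i ** Y 0) \<le> C * K * exp ((\<mu> - \<nu>) * x)"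
    using growth eventually_ge_at_top[of 0]
  proof eventually_elim
    case (elim x)
    have "P i ** Y 0 = (\<Psi> 0 ** P i ** matrix_inv (\<Psi> x)) ** Y x"
      by (simp add: solution_eq_\<Psi>[OF Y elim(2)] \<Psi>0 matrix_mul_assoc[symmetric] matrix_inv_mult_assoc[OF invertible_\<Psi>])
    also have "norm \<dots> \<le> (C * exp (\<nu> * (0 - x))) * (K * exp (\<mu> * x))"
      using elim C0 by (intro order_trans[OF norm_matrix_mult_le] mult_mono C) auto
    also have "\<dots> = C * K * exp ((\<mu> - \<nu>) * x)"
      by (simp add: exp_add[symmetric] algebra_simps)
    finally show ?case .
  qed
  from le_0_of_exp_decay[OF \<nu>(1) this] show ?thesis by simp
qed

lemma range_subset_of_projections_zero:
  assumes j: "j \<le> m" and zero: "\<And>i. i \<in> {j+1..m} \<Longrightarrow> P i ** M = 0"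
  shows "mat_range M \<subseteq> mat_range (\<Sum>k=1..j. P k)"
proof -
  have "{1..m} = {1..j} \<union> {j+1..m}" using j by auto
  then have "(\<Sum>k=1..j. P k) + (\<Sum>k=j+1..m. P k) = mat 1"
    using sum.union_disjoint[of "{1..j}" "{j+1..m}" P] P_sum by auto
  then have "M = (\<Sum>k=1..j. P k) ** M + (\<Sum>k=j+1..m. P k) ** M"
    by (simp add: mat_mult.add_left[symmetric])
  also have "(\<Sum>k=j+1..m. P k) ** M = 0"
    using zero by (simp add: mat_mult.sum_left)
  finally have M: "M = (\<Sum>k=1..j. P k) ** M" by simp
  have "M *v v = (\<Sum>k=1..j. P k) *v (M *v v)" for v
    by (subst M) (simp add: matrix_vector_mul_assoc)
  then show ?thesis unfolding mat_range_def by blast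
qed

text \<open>For each \<open>i > j\<close> a rate \<mu> is placed in the spectral gap between
  \<open>Qs j\<close> and \<open>Qs i\<close>. The leading term \<open>\<Phi> x ** Qs j\<close> and
  the correction both grow at most at this rate, so \<open>P i\<close> annihilates the initial
  value.\<close>

lemma range_jost_plus_subset:
  assumes j: "j \<in> {1..m}" and Y: "jost_plus A R \<Phi> (Qs j) Y"
  shows "mat_range (Y 0) \<subseteq> mat_range (\<Sum>k=1..j. P k)"
proof (rule range_subset_of_projections_zero)
  fix i assume i: "i \<in> {j+1..m}"
  then have "upper_bohl \<Phi> {0..} (Qs j) < lower_bohl \<Phi> {0..} (Qs i)" using j by (intro bohl_ordered) auto
  then obtain \<mu> where \<mu>: "upper_bohl \<Phi> {0..} (Qs j) < ereal \<mu>" "ereal \<mu> < lower_bohl \<Phi> {0..} (Qs i)"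
    using ereal_dense2 by blast
  obtain C where C: "\<And>x x'. x \<in> {0..} \<Longrightarrow> x' \<in> {0..} \<Longrightarrow> x' \<le> x \<Longrightarrow>
    norm (\<Phi> x ** Qs j ** matrix_inv (\<Phi> x')) \<le> C * exp (\<mu> * (x - x'))"
    using upper_bohl_lessE[OF \<mu>(1)] by metis
  obtain \<mu>1 where \<mu>1: "ereal \<mu>1 < lower_bohl \<Phi> {0..} (Qs j)"
    "\<forall>\<nu>\<ge>\<mu>1. \<forall>\<^sub>F x in at_top. norm (Y x - \<Phi> x ** Qs j) \<le> exp (\<nu> * x)"
    by (rule jost_plus_growth[OF Y])
  have "ereal \<mu>1 < ereal \<mu>" using \<mu>1(1) bohl_le[OF j] \<mu>(1) by (meson le_less_trans less_trans)
  then have "\<mu>1 \<le> \<mu>" by simp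
  from \<mu>1(2)[rule_format, OF this] eventually_ge_at_top[of 0]
  have "\<forall>\<^sub>F x in at_top. norm (Y x) \<le> (1 + C) * exp (\<mu> * x)"
  proof eventually_elim
    case (elim x)
    have "norm (\<Phi> x ** Qs j) \<le> C * exp (\<mu> * x)"
      using C[of x 0] elim(2) \<Phi>_mult_inv(1)[of 0] by (simp add: \<Phi>0)
    then show ?case using elim(1) norm_triangle_sub[of "Y x" "\<Phi> x ** Qs j"] by (simp add: algebra_simps)
  qed
  then show "P i ** Y 0 = 0"
    using Y i \<mu>(2) by (intro projection_initial_value_zero) (auto simp: jost_plus_def)
qed (use j in simp)

text \<open>In the difference the leading terms cancel, and the growth drops below the lower
  exponent of \<open>Qs j\<close> itself. Thus \<open>P j\<close> annihilates the initial value too,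
  and the sum stops at \<open>j - 1\<close>.\<close>

lemma range_jost_plus_diff_subset:
  assumes j: "j \<in> {1..m}" and Y: "jost_plus A R \<Phi> (Qs j) Y" "jost_plus A R \<Phi> (Qs j) Y'"
  shows "mat_range (Y 0 - Y' 0) \<subseteq> mat_range (\<Sum>k=1..j-1. P k)"
proof (rule range_subset_of_projections_zero)
  fix i assume i: "i \<in> {j-1+1..m}"
  obtain \<mu> where \<mu>: "ereal \<mu> < lower_bohl \<Phi> {0..} (Qs j)"
    "\<forall>\<^sub>F x in at_top. norm (Y x - Y' x) \<le> 2 * exp (\<mu> * x)"
    "is_solution (\<lambda>x. A x + R x) {0..} (\<lambda>x. Y x - Y' x)"
    by (rule jost_plus_diff_growth[OF Y])
  have "ereal \<mu> < lower_bohl \<Phi> {0..} (Qs i)"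
    using \<mu>(1) lower_bohl_mono_index[of j i] i j by (auto intro: less_le_trans)
  then show "P i ** (Y 0 - Y' 0) = 0"
    using i j by (intro projection_initial_value_zero[OF _ \<mu>(3,2)]) auto
qed (use j in \<open>simp, arith\<close>)

text \<open>With initial value in the range of the first \<open>j - 1\<close> projections,
  \<open>Y x *v v\<close> grows below the lower exponent of \<open>Qs j\<close>. So does the Jost
  correction, hence also \<open>\<Phi> x ** Qs j\<close> applied to \<open>v\<close>. The backward
  bound then forces \<open>Qs j *v v = 0\<close>.\<close>

lemma range_jost_plus_inter:
  assumes j: "j \<in> {1..m}" and Y: "jost_plus A R \<Phi> (Qs j) Y"
    and y: "y \<in> mat_range (Y 0)" "y \<in> mat_range (\<Sum>k=1..j-1. P k)"
  shows "y = 0"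
proof -
  obtain v where v: "y = Y 0 *v v" using y(1) by (auto simp: mat_range_def)
  obtain z where z: "y = (\<Sum>k\<in>{1..j-1}. P k) *v z" using y(2) by (auto simp: mat_range_def)
  have sol: "is_solution (\<lambda>x. A x + R x) {0..} Y" and YQ: "Y 0 = Y 0 ** Qs j"
    using Y by (auto simp: jost_plus_def)
  obtain \<mu>1 where \<mu>1: "ereal \<mu>1 < lower_bohl \<Phi> {0..} (Qs j)"
    "\<forall>\<nu>\<ge>\<mu>1. \<forall>\<^sub>F x in at_top. norm (Y x - \<Phi> x ** Qs j) \<le> exp (\<nu> * x)"
    by (rule jost_plus_growth[OF Y])
  have "-\<infinity> < lower_bohl \<Phi> {0..} (Qs j)" using \<mu>1(1) by (cases "lower_bohl \<Phi> {0..} (Qs j)") auto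
  have fin: "finite (insert (ereal \<mu>1) ((\<lambda>i. upper_bohl \<Phi> {0..} (Qs i)) ` {1..j-1}))" by simp
  have lt: "\<forall>s\<in>insert (ereal \<mu>1) ((\<lambda>i. upper_bohl \<Phi> {0..} (Qs i)) ` {1..j-1}). s < lower_bohl \<Phi> {0..} (Qs j)"
    using bohl_ordered[OF _ j] j \<mu>1(1) by auto
  obtain \<mu> where "\<forall>s\<in>insert (ereal \<mu>1) ((\<lambda>i. upper_bohl \<Phi> {0..} (Qs i)) ` {1..j-1}). s < ereal \<mu>"
    and \<mu>3: "ereal \<mu> < lower_bohl \<Phi> {0..} (Qs j)"
    by (rule exists_real_between[OF fin lt \<open>-\<infinity> < lower_bohl \<Phi> {0..} (Qs j)\<close>])
  then have \<mu>: "\<mu>1 < \<mu>" "\<And>i. i \<in> {1..j-1} \<Longrightarrow> upper_bohl \<Phi> {0..} (Qs i) < ereal \<mu>"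
    "ereal \<mu> < lower_bohl \<Phi> {0..} (Qs j)"
    by simp_all
  from ereal_dense2[OF \<mu>(3)] obtain \<nu> where \<nu>: "\<mu> < \<nu>" "ereal \<nu> < lower_bohl \<Phi> {0..} (Qs j)" by auto
  have "upper_bohl \<Psi> {0..} (P i) < ereal \<mu>" if "i \<in> {1..j-1}" for i
    using \<mu>(2)[OF that] upper_eq[of i] j that by auto
  from this obtain C where "C \<ge> 0" and CC: "\<forall>t\<ge>0. \<forall>x\<ge>t.
    norm (\<Psi> x ** (\<Sum>i\<in>{1..j-1}. P i) ** matrix_inv (\<Psi> t)) \<le> C * exp (\<mu> * (x - t))"
    by (rule sum_bound_right[OF finite_atLeastAtMost])
  note C = CC[rule_format]
  obtain C' where C'0: "C' \<ge> 0" and C': "\<And>x x'. x \<in> {0..} \<Longrightarrow> x' \<in> {0..} \<Longrightarrow> x \<le> x' \<Longrightarrow>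
    norm (\<Phi> x ** Qs j ** matrix_inv (\<Phi> x')) \<le> C' * exp (\<nu> * (x - x'))"
    using less_lower_bohlE[OF \<nu>(2)] by metis
  have inv0: "matrix_inv (mat 1 :: complex ^ 'n ^ 'n) = mat 1"
    using \<Phi>_mult_inv(1)[of 0] by (simp add: \<Phi>0)
  have "\<mu>1 \<le> \<mu>" using \<mu>(1) by simp
  from \<mu>1(2)[rule_format, OF this] eventually_ge_at_top[of 0]
  have "\<forall>\<^sub>F x in at_top. norm (Qs j *v v) \<le> C' * (C * norm z + norm v) * exp ((\<mu> - \<nu>) * x)"
  proof eventually_elim
    case (elim x)
    have "Y x *v v = \<Psi> x *v y"
      by (simp add: solution_eq_\<Psi>[OF sol elim(2)] v matrix_vector_mul_assoc)
    then have eqv: "Y x *v v = (\<Psi> x ** (\<Sum>k\<in>{1..j-1}. P k)) *v z"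
      by (simp add: z matrix_vector_mul_assoc)
    have nb: "norm (\<Psi> x ** (\<Sum>k\<in>{1..j-1}. P k)) \<le> C * exp (\<mu> * x)"
      using C[of 0 x] elim(2) by (simp add: \<Psi>0 inv0)
    have Yv: "norm (Y x *v v) \<le> C * exp (\<mu> * x) * norm z"
      unfolding eqv by (intro order_trans[OF norm_matrix_vector_mult_le] mult_right_mono nb) simp
    have dv: "norm ((Y x - \<Phi> x ** Qs j) *v v) \<le> exp (\<mu> * x) * norm v"
      by (intro order_trans[OF norm_matrix_vector_mult_le] mult_right_mono elim(1)) simp
    have diff: "(\<Phi> x ** Qs j) *v v = Y x *v v - (Y x - \<Phi> x ** Qs j) *v v"
      by (simp add: matrix_vector_mult_diff_rdistrib)
    have "norm ((\<Phi> x ** Qs j) *v v) \<le> C * exp (\<mu> * x) * norm z + exp (\<mu> * x) * norm v"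
      by (subst diff) (rule order_trans[OF norm_triangle_ineq4 add_mono[OF Yv dv]])
    also have "\<dots> = (C * norm z + norm v) * exp (\<mu> * x)" by (simp add: algebra_simps)
    finally have \<Phi>v: "norm ((\<Phi> x ** Qs j) *v v) \<le> (C * norm z + norm v) * exp (\<mu> * x)" .
    \<comment> \<open>\<open>Qs j *v v\<close> is recovered from its value at time \<open>x\<close>
      by the backward kernel, which decays at the faster rate \<nu>.\<close>
    have "(\<Phi> 0 ** Qs j ** \<Phi>i x) ** (\<Phi> x ** Qs j) = Qs j"
      using Q_idem[OF j] by (simp add: \<Phi>0 matrix_mul_assoc[symmetric])
    then have "Qs j *v v = (\<Phi> 0 ** Qs j ** \<Phi>i x) *v ((\<Phi> x ** Qs j) *v v)"
      by (simp only: matrix_vector_mul_assoc)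
    also have "norm \<dots> \<le> (C' * exp (\<nu> * (0 - x))) * ((C * norm z + norm v) * exp (\<mu> * x))"
      using elim(2) C'0 by (intro order_trans[OF norm_matrix_vector_mult_le] mult_mono C' \<Phi>v) auto
    also have "\<dots> = C' * (C * norm z + norm v) * exp ((\<mu> - \<nu>) * x)"
      by (simp add: exp_add[symmetric] algebra_simps)
    finally show ?case .
  qed
  from le_0_of_exp_decay[OF \<nu>(1) this] have Qv: "Qs j *v v = 0" by simp
  \<comment> \<open>The normalization \<open>Y 0 = Y 0 ** Qs j\<close> enters here: only the
    \<open>Qs j\<close> part of \<open>v\<close> matters.\<close>
  have "y = Y 0 *v (Qs j *v v)" unfolding v by (subst YQ) (simp add: matrix_vector_mul_assoc)
  then show ?thesis by (simp add: Qv)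
qed

end

subsection \<open>Reflection of the real line\<close>

lemma division_of_reflect:
  fixes T :: "real set"
  assumes D: "D division_of T"
  shows "(`) uminus ` D division_of (uminus ` T)"
proof (rule division_ofI)
  show "finite ((`) uminus ` D)" using D by (auto simp: division_of_finite)
  show "\<Union>((`) uminus ` D) = uminus ` T" using division_ofD(6)[OF D] by auto
  fix K assume "K \<in> (`) uminus ` D"
  then obtain L where L: "L \<in> D" "K = uminus ` L" by blast
  obtain u v where uv: "u \<le> v" "L = {u..v}" "L \<subseteq> T"
    using division_of_real_intervals[OF D L(1)] by metis
  show "K \<subseteq> uminus ` T" unfolding L(2) by (rule image_mono[OF uv(3)])
  show "K \<noteq> {}" using L uv by simp
  show "\<exists>a b. K = cbox a b"
    unfolding L(2) uv(2) image_uminus_atLeastAtMost by (metis cbox_interval)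
  fix K' assume K': "K' \<in> (`) uminus ` D" "K \<noteq> K'"
  then obtain L' where L': "L' \<in> D" "K' = uminus ` L'" by blast
  have "L \<noteq> L'" using K'(2) L L' by blast
  then have "interior L \<inter> interior L' = {}" using division_ofD(5)[OF D L(1) L'(1)] by blast
  then show "interior K \<inter> interior K' = {}"
    unfolding L(2) L'(2) interior_negations by auto
qed

lemma abs_continuous_on_reflect:
  assumes f: "abs_continuous_on S f"
  shows "abs_continuous_on (uminus ` S) (\<lambda>x. f (- x))"
  unfolding abs_continuous_on_def
proof (intro allI impI)
  fix e :: real assume "e > 0"
  obtain \<delta> where "\<delta> > 0" and \<delta>:
    "\<forall>D T. D division_of T \<and> T \<subseteq> S \<and> (\<Sum>K\<in>D. Sup K - Inf K) < \<delta> \<longrightarrow>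
       (\<Sum>K\<in>D. norm (f (Sup K) - f (Inf K))) < e"
    using mp[OF spec[OF f[unfolded abs_continuous_on_def]] \<open>e > 0\<close>] by (elim exE conjE) (rule that)
  show "\<exists>\<delta>>0. \<forall>D T. D division_of T \<and> T \<subseteq> uminus ` S \<and> (\<Sum>K\<in>D. Sup K - Inf K) < \<delta> \<longrightarrow>
       (\<Sum>K\<in>D. norm (f (- Sup K) - f (- Inf K))) < e"
  proof (rule exI[of _ \<delta>], intro conjI allI impI \<open>\<delta> > 0\<close>)
    fix D T assume DT: "D division_of T \<and> T \<subseteq> uminus ` S \<and> (\<Sum>K\<in>D. Sup K - Inf K) < \<delta>"
    then have D: "D division_of T" by simp
    let ?D = "(`) uminus ` D"
    have inj: "inj_on ((`) (uminus :: real \<Rightarrow> real)) D"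
      by (rule inj_onI) (simp add: inj_image_eq_iff)
    have ends: "Sup (uminus ` K) = - Inf K" "Inf (uminus ` K) = - Sup K" if KD: "K \<in> D" for K
    proof -
      obtain u v where "u \<le> v" "K = {u..v}" "K \<subseteq> T"
        using division_of_real_intervals[OF D KD] by metis
      then show "Sup (uminus ` K) = - Inf K" "Inf (uminus ` K) = - Sup K"
        by (simp_all add: image_uminus_atLeastAtMost)
    qed
    have "(\<Sum>K\<in>?D. Sup K - Inf K) = (\<Sum>K\<in>D. Sup K - Inf K)"
      unfolding sum.reindex[OF inj] by (rule sum.cong) (simp_all add: ends)
    moreover have "uminus ` T \<subseteq> S"
    proof -
      have "uminus ` T \<subseteq> uminus ` uminus ` S" using DT by (intro image_mono) simp
      then show ?thesis by (simp add: image_image)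
    qed
    ultimately have "(\<Sum>K\<in>?D. norm (f (Sup K) - f (Inf K))) < e"
      using \<delta>[rule_format, of ?D "uminus ` T"] division_of_reflect[OF D] DT by simp
    also have "(\<Sum>K\<in>?D. norm (f (Sup K) - f (Inf K))) = (\<Sum>K\<in>D. norm (f (- Sup K) - f (- Inf K)))"
      unfolding sum.reindex[OF inj] by (rule sum.cong) (simp_all add: ends norm_minus_commute)
    finally show "(\<Sum>K\<in>D. norm (f (- Sup K) - f (- Inf K))) < e" .
  qed
qed

lemma negligible_reflect: "negligible S \<Longrightarrow> negligible (uminus ` S)" for S :: "real set"
  by (rule negligible_differentiable_image_negligible) (auto intro: derivative_intros)

lemma AE_lebesgue_reflect:
  assumes "AE x in lebesgue. P (x :: real)"
  shows "AE x in lebesgue. P (- x)"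
proof -
  obtain N where N: "negligible N" "\<And>x. \<not> P x \<Longrightarrow> x \<in> N"
    using assms unfolding eventually_ae_filter negligible_iff_null_sets by auto
  have "negligible (uminus ` N)" by (rule negligible_reflect[OF N(1)])
  moreover have "{x. \<not> P (- x)} \<subseteq> uminus ` N" using N(2) by force
  ultimately show ?thesis unfolding eventually_ae_filter negligible_iff_null_sets by auto
qed

text \<open>The minus sign of the new coefficient is the inner derivative of the reflection.\<close>

lemma is_solution_reflect:
  assumes Y: "is_solution A J Y"
  shows "is_solution (\<lambda>x. - A (- x)) (uminus ` J) (\<lambda>x. Y (- x))"
  unfolding is_solution_def
proof
  show "locally_abs_continuous_on (uminus ` J) (\<lambda>x. Y (- x))"
    unfolding locally_abs_continuous_on_def
  proof (intro allI impI)
    fix a b assume "{a..b} \<subseteq> uminus ` J"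
    then have "uminus ` {a..b} \<subseteq> uminus ` uminus ` J" by (rule image_mono)
    then have "{- b..- a} \<subseteq> J" by (simp add: image_uminus_atLeastAtMost image_image)
    then have "abs_continuous_on {- b..- a} Y" by (rule is_solution_imp_abs_continuous_on[OF Y])
    from abs_continuous_on_reflect[OF this] show "abs_continuous_on {a..b} (\<lambda>x. Y (- x))"
      by (simp add: image_uminus_atLeastAtMost)
  qed
  have "AE x in lebesgue. x \<in> J \<longrightarrow> (Y has_vector_derivative A x ** Y x) (at x within J)"
    using Y by (simp add: is_solution_def)
  from AE_lebesgue_reflect[OF this]
  show "AE x in lebesgue. x \<in> uminus ` J \<longrightarrow>
     ((\<lambda>x. Y (- x)) has_vector_derivative (- A (- x)) ** Y (- x)) (at x within uminus ` J)"
  proof eventually_elim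
    case (elim x)
    show ?case
    proof
      assume "x \<in> uminus ` J"
      then have "- x \<in> J" by auto
      with elim have "(Y has_vector_derivative A (- x) ** Y (- x)) (at (- x) within uminus ` uminus ` J)"
        by (simp add: image_image)
      moreover have "(uminus has_vector_derivative (- 1 :: real)) (at x within uminus ` J)"
        by (auto intro!: derivative_eq_intros)
      ultimately have "(Y \<circ> uminus has_vector_derivative (- 1) *\<^sub>R (A (- x) ** Y (- x))) (at x within uminus ` J)"
        by (intro vector_diff_chain_within)
      then show "((\<lambda>x. Y (- x)) has_vector_derivative (- A (- x)) ** Y (- x)) (at x within uminus ` J)"
        by (simp add: o_def mat_mult.minus_left)
    qed
  qed
qed

lemma uminus_image_half_lines: "uminus ` {0..} = {..(0::real)}" "uminus ` {..0} = {(0::real)..}"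
  by (simp_all add: image_uminus_atLeast image_uminus_atMost)

lemma fundamental_solution_reflect:
  "fundamental_solution A \<Phi> \<Longrightarrow> fundamental_solution (\<lambda>x. - A (- x)) (\<lambda>x. \<Phi> (- x))"
  using is_solution_reflect[of A UNIV \<Phi>] by (simp add: fundamental_solution_def surj_def)

text \<open>The product \<open>\<kappa> * (x - x')\<close> is unchanged when the rate and both times
  change sign, while the order of the times is reversed; forward rates become negatives of backward
  rates.\<close>

lemma lower_bohl_reflect: "lower_bohl (\<lambda>x. \<Phi> (- x)) J P = - upper_bohl \<Phi> (uminus ` J) P"
proof -
  let ?N = "\<lambda>x x'. norm (\<Phi> x ** P ** matrix_inv (\<Phi> x'))"
  let ?U = "{\<kappa>. \<exists>C. \<forall>x\<in>uminus ` J. \<forall>x'\<in>uminus ` J. x \<ge> x' \<longrightarrow> ?N x x' \<le> C * exp (\<kappa> * (x - x'))}"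
  let ?L = "{\<kappa>. \<exists>C. \<forall>x\<in>J. \<forall>x'\<in>J. x \<le> x' \<longrightarrow> ?N (- x) (- x') \<le> C * exp (\<kappa> * (x - x'))}"
  have e: "- \<kappa> * (- x - - x') = \<kappa> * (x - x')" for \<kappa> x x' :: real by (simp add: algebra_simps)
  have iff: "(\<forall>x\<in>uminus ` J. \<forall>x'\<in>uminus ` J. x \<ge> x' \<longrightarrow> ?N x x' \<le> C * exp (- \<kappa> * (x - x'))) \<longleftrightarrow>
      (\<forall>x\<in>J. \<forall>x'\<in>J. x \<le> x' \<longrightarrow> ?N (- x) (- x') \<le> C * exp (\<kappa> * (x - x')))" for C \<kappa>
    unfolding ball_simps neg_le_iff_le e ..
  have mem: "- \<kappa> \<in> ?U \<longleftrightarrow> \<kappa> \<in> ?L" for \<kappa>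
    unfolding mem_Collect_eq iff ..
  have "?L = uminus ` ?U"
  proof (intro set_eqI iffI)
    fix \<kappa> assume "\<kappa> \<in> ?L"
    then have "- \<kappa> \<in> ?U" by (rule mem[THEN iffD2])
    then have "- (- \<kappa>) \<in> uminus ` ?U" by (rule imageI)
    then show "\<kappa> \<in> uminus ` ?U" by (simp only: minus_minus)
  next
    fix \<kappa> assume "\<kappa> \<in> uminus ` ?U"
    then obtain l where "\<kappa> = - l" "l \<in> ?U" by (rule imageE)
    then have "- \<kappa> \<in> ?U" by (simp only: minus_minus)
    then show "\<kappa> \<in> ?L" by (rule mem[THEN iffD1])
  qed
  then have "lower_bohl (\<lambda>x. \<Phi> (- x)) J P = Sup (uminus ` ereal ` ?U)"
    unfolding lower_bohl_def by (simp only: image_image uminus_ereal.simps)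
  then show ?thesis unfolding ereal_Sup_uminus_image_eq upper_bohl_def .
qed

lemma upper_bohl_reflect: "upper_bohl (\<lambda>x. \<Phi> (- x)) J P = - lower_bohl \<Phi> (uminus ` J) P"
  using lower_bohl_reflect[of "\<lambda>x. \<Phi> (- x)" "uminus ` J" P] by (simp add: image_image)

lemma Limsup_at_bot_mirror: "Limsup at_bot f = Limsup at_top (\<lambda>x::real. f (- x))"
  unfolding at_bot_mirror by (rule Limsup_filtermap_eq) simp

lemma Liminf_at_bot_mirror: "Liminf at_bot f = Liminf at_top (\<lambda>x::real. f (- x))"
  unfolding at_bot_mirror by (rule Liminf_filtermap_eq) simp

lemma lyapunov_minus'_reflect: "lyapunov_minus' \<Phi> P = - lyapunov_plus (\<lambda>x. \<Phi> (- x)) P"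
proof -
  have "Limsup at_top (\<lambda>x. ereal (1 / \<bar>- x\<bar>) * log_norm (\<Phi> (- x) ** P)) =
        Limsup at_top (\<lambda>x. ereal (1 / x) * log_norm (\<Phi> (- x) ** P))"
    by (rule Limsup_eq) (use eventually_gt_at_top[of "0::real"] in \<open>eventually_elim, simp\<close>)
  then show ?thesis
    by (simp add: lyapunov_minus'_def lyapunov_plus_def Limsup_at_bot_mirror)
qed

text \<open>The factor \<open>1 / x\<close> changes sign, which turns the lower limit into minus an
  upper limit. As reflection is an involution, the same fact on solutions yields both
  directions.\<close>

lemma jost_minus_iff_jost_plus_reflect:
  "jost_minus A R \<Phi> Q Y \<longleftrightarrow> jost_plus (\<lambda>x. - A (- x)) (\<lambda>x. - R (- x)) (\<lambda>x. \<Phi> (- x)) Q (\<lambda>x. Y (- x))"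
proof -
  have "is_solution (\<lambda>x. A x + R x) {..0} Y \<longleftrightarrow> is_solution (\<lambda>x. - A (- x) + - R (- x)) {0..} (\<lambda>x. Y (- x))"
  proof
    assume "is_solution (\<lambda>x. A x + R x) {..0} Y"
    from is_solution_reflect[OF this] show "is_solution (\<lambda>x. - A (- x) + - R (- x)) {0..} (\<lambda>x. Y (- x))"
      by (simp add: uminus_image_half_lines)
  next
    assume "is_solution (\<lambda>x. - A (- x) + - R (- x)) {0..} (\<lambda>x. Y (- x))"
    from is_solution_reflect[OF this] show "is_solution (\<lambda>x. A x + R x) {..0} Y"
      by (simp add: uminus_image_half_lines add.commute)
  qed
  moreover have "Liminf at_bot (\<lambda>x. ereal (1 / x) * log_norm (Y x - \<Phi> x ** Q)) =
      - Limsup at_top (\<lambda>x. ereal (1 / x) * log_norm (Y (- x) - \<Phi> (- x) ** Q))"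
    unfolding Liminf_at_bot_mirror ereal_Liminf_uminus[symmetric]
  proof (rule Liminf_eq, rule always_eventually, rule allI)
    fix x :: real
    have "ereal (1 / - x) = - ereal (1 / x)" by simp
    then show "ereal (1 / - x) * log_norm (Y (- x) - \<Phi> (- x) ** Q) =
        - (ereal (1 / x) * log_norm (Y (- x) - \<Phi> (- x) ** Q))"
      by (simp only: ereal_mult_minus_left)
  qed
  ultimately show ?thesis
    by (simp add: jost_minus_def jost_plus_def lower_bohl_reflect uminus_image_half_lines ereal_less_uminus_reorder)
qed

text \<open>Writing \<open>P\<close> as the backward kernel from \<open>x\<close> to 0 applied to
  \<open>\<Phi> x ** P\<close> would give \<open>P = 0\<close> if \<open>\<Phi> x ** P\<close> grew
  more slowly than the lower exponent. The inequality is the source of the positivity of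
  \<beta>.\<close>

lemma lower_bohl_le_lyapunov_plus:
  fixes \<Phi> :: "real \<Rightarrow> complex ^ 'n ^ 'n"
  assumes inv: "\<And>x. invertible (\<Phi> x)" and P: "P ** P = P" "P \<noteq> 0" and \<Phi>0: "\<Phi> 0 = mat 1"
  shows "lower_bohl \<Phi> {0..} P \<le> lyapunov_plus \<Phi> P"
proof (rule ccontr)
  assume "\<not> lower_bohl \<Phi> {0..} P \<le> lyapunov_plus \<Phi> P"
  then have "lyapunov_plus \<Phi> P < lower_bohl \<Phi> {0..} P" by simp
  then obtain \<mu> where \<mu>: "lyapunov_plus \<Phi> P < ereal \<mu>" "ereal \<mu> < lower_bohl \<Phi> {0..} P"
    using ereal_dense2 by blast
  from ereal_dense2[OF \<mu>(2)] obtain \<nu> where \<nu>: "\<mu> < \<nu>" "ereal \<nu> < lower_bohl \<Phi> {0..} P" by auto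
  show False
  proof (rule less_lower_bohlE[OF \<nu>(2)])
    fix C assume C0: "C \<ge> 0" and C: "\<And>x x'. x \<in> {0..} \<Longrightarrow> x' \<in> {0..} \<Longrightarrow> x \<le> x' \<Longrightarrow>
      norm (\<Phi> x ** P ** matrix_inv (\<Phi> x')) \<le> C * exp (\<nu> * (x - x'))"
    have "\<forall>\<^sub>F x in at_top. norm (\<Phi> x ** P) \<le> exp (\<mu> * x)"
      using \<mu>(1) unfolding lyapunov_plus_def by (rule Limsup_log_norm_less_imp)
    then have "\<forall>\<^sub>F x in at_top. norm P \<le> C * exp ((\<mu> - \<nu>) * x)"
      using eventually_ge_at_top[of 0]
    proof eventually_elim
      case (elim x)
      have "P = (\<Phi> 0 ** P ** matrix_inv (\<Phi> x)) ** (\<Phi> x ** P)"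
        using P(1) by (simp add: \<Phi>0 matrix_mul_assoc[symmetric] matrix_inv_mult_assoc[OF inv])
      then have "norm P = norm ((\<Phi> 0 ** P ** matrix_inv (\<Phi> x)) ** (\<Phi> x ** P))" by (rule arg_cong)
      also have "\<dots> \<le> (C * exp (\<nu> * (0 - x))) * exp (\<mu> * x)"
        using elim C0
        by (intro order_trans[OF norm_matrix_mult_le[of "\<Phi> 0 ** P ** matrix_inv (\<Phi> x)" "\<Phi> x ** P"]] mult_mono C) auto
      also have "\<dots> = C * exp ((\<mu> - \<nu>) * x)"
        by (simp add: exp_add[symmetric] algebra_simps)
      finally show ?case .
    qed
    from le_0_of_exp_decay[OF \<nu>(1) this] show False using P(2) by simp
  qed
qed

lemma integrable_lebesgue_reflect:
  fixes f :: "real \<Rightarrow> 'a::euclidean_space"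
  assumes "integrable lebesgue f"
  shows "integrable lebesgue (\<lambda>x. f (- x))"
  using lebesgue_integrable_real_affine[OF assms, of "- 1" 0] by simp

section \<open>Common setting for both half-lines\<close>

lemma sum_reverse_index:
  fixes f :: "nat \<Rightarrow> 'a::comm_monoid_add"
  assumes "n \<le> m"
  shows "(\<Sum>i=1..n. f (m + 1 - i)) = (\<Sum>k=m+1-n..m. f k)"
  by (rule sum.reindex_bij_witness[where i = "\<lambda>k. m + 1 - k" and j = "\<lambda>i. m + 1 - i"])
     (use assms in auto)

text \<open>The hypotheses are chosen to be stable under reflection: exponents on the whole line, a
  weight in \<open>\<bar>x\<bar>\<close>, and an ordering that survives when the numbering is
  reversed. Each half-line then receives its own instance.\<close>

locale jost_setting =
  fixes A R \<Phi> :: "real \<Rightarrow> complex ^ 'n ^ 'n" and Qs :: "nat \<Rightarrow> complex ^ 'n ^ 'n" and m :: nat and \<beta> :: real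
  assumes A: "loc_integrable A" and fund: "fundamental_solution A \<Phi>"
    and R_integrable: "integrable lebesgue R" and R\<beta>: "integrable lebesgue (\<lambda>x. norm (R x) * exp (\<beta> * \<bar>x\<bar>))"
    and Q_idem: "\<And>i. i \<in> {1..m} \<Longrightarrow> Qs i ** Qs i = Qs i"
    and Q_nonzero: "\<And>i. i \<in> {1..m} \<Longrightarrow> Qs i \<noteq> 0"
    and Q_sum: "(\<Sum>i=1..m. Qs i) = mat 1"
    and bohl_ordered_UNIV: "\<And>i j. i \<in> {1..m} \<Longrightarrow> j \<in> {1..m} \<Longrightarrow> i < j \<Longrightarrow>
        upper_bohl \<Phi> UNIV (Qs i) < lower_bohl \<Phi> UNIV (Qs j)"
begin

sublocale split_equation A R \<Phi> Qs m
proof unfold_locales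
  show "R absolutely_integrable_on UNIV" using R_integrable by (simp add: set_integrable_def)
  fix i j assume i: "i \<in> {1..m}"
  show "lower_bohl \<Phi> {0..} (Qs i) \<le> upper_bohl \<Phi> {0..} (Qs i)"
    by (rule lower_bohl_le_upper_bohl[OF invertible_fundamental_solution[OF A fund] Q_idem[OF i] Q_nonzero[OF i]])
  assume j: "j \<in> {1..m}" "i < j"
  have "upper_bohl \<Phi> {0..} (Qs i) \<le> upper_bohl \<Phi> UNIV (Qs i)" by (rule upper_bohl_mono) simp
  also have "\<dots> < lower_bohl \<Phi> UNIV (Qs j)" by (rule bohl_ordered_UNIV[OF i j])
  also have "\<dots> \<le> lower_bohl \<Phi> {0..} (Qs j)" by (rule lower_bohl_antimono) simp
  finally show "upper_bohl \<Phi> {0..} (Qs i) < lower_bohl \<Phi> {0..} (Qs j)" .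
qed (use A fund Q_idem Q_sum in auto)

lemma R\<beta>_half_line: "(\<lambda>x. norm (R x) * exp (\<beta> * x)) integrable_on {0..}"
proof -
  have "(\<lambda>x. norm (R x) * exp (\<beta> * \<bar>x\<bar>)) absolutely_integrable_on UNIV"
    using R\<beta> by (simp add: set_integrable_def)
  then have "(\<lambda>x. norm (R x) * exp (\<beta> * \<bar>x\<bar>)) absolutely_integrable_on {0..}"
    by (rule set_integrable_subset) auto
  then have "(\<lambda>x. norm (R x) * exp (\<beta> * \<bar>x\<bar>)) integrable_on {0..}"
    by (rule absolutely_integrable_imp_integrable_on)
  then show ?thesis by (rule integrable_eq) simp
qed

lemma jost_setting_reflect:
  "jost_setting (\<lambda>x. - A (- x)) (\<lambda>x. - R (- x)) (\<lambda>x. \<Phi> (- x)) (\<lambda>i. Qs (m + 1 - i)) m \<beta>"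
proof
  show "loc_integrable (\<lambda>x. - A (- x))"
    unfolding loc_integrable_def
  proof (intro allI)
    fix a b :: real
    have "A absolutely_integrable_on {- b..- a}" using A by (simp add: loc_integrable_def)
    then have "(\<lambda>x. A (- x)) absolutely_integrable_on {- (- a)..- (- b)}"
      by (simp only: absolutely_integrable_reflect_real)
    then show "(\<lambda>x. - A (- x)) absolutely_integrable_on {a..b}" by (simp add: set_integrable_def)
  qed
  show "fundamental_solution (\<lambda>x. - A (- x)) (\<lambda>x. \<Phi> (- x))" by (rule fundamental_solution_reflect[OF fund])
  show "integrable lebesgue (\<lambda>x. - R (- x))" using integrable_lebesgue_reflect[OF R_integrable] by simp
  show "integrable lebesgue (\<lambda>x. norm (- R (- x)) * exp (\<beta> * \<bar>x\<bar>))"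
    using integrable_lebesgue_reflect[OF R\<beta>] by simp
  show "(\<Sum>i=1..m. Qs (m + 1 - i)) = mat 1" using sum_reverse_index[of m m Qs] Q_sum by simp
  fix i assume i: "i \<in> {1..m}"
  then have i': "m + 1 - i \<in> {1..m}" by auto
  show "Qs (m + 1 - i) ** Qs (m + 1 - i) = Qs (m + 1 - i)" by (rule Q_idem[OF i'])
  show "Qs (m + 1 - i) \<noteq> 0" by (rule Q_nonzero[OF i'])
  fix j assume j: "j \<in> {1..m}" "i < j"
  then have j': "m + 1 - j \<in> {1..m}" "m + 1 - j < m + 1 - i" using i by auto
  have "upper_bohl \<Phi> UNIV (Qs (m + 1 - j)) < lower_bohl \<Phi> UNIV (Qs (m + 1 - i))"
    by (rule bohl_ordered_UNIV[OF j'(1) i' j'(2)])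
  then show "upper_bohl (\<lambda>x. \<Phi> (- x)) UNIV (Qs (m + 1 - i)) < lower_bohl (\<lambda>x. \<Phi> (- x)) UNIV (Qs (m + 1 - j))"
    by (simp add: lower_bohl_reflect upper_bohl_reflect surj_def)
qed

end

text \<open>Empty segments coincide whatever their endpoints are; the inequality makes the segment
  nonempty, so its endpoints can be read off.\<close>

lemma bohl_segment_eqD:
  assumes "bohl_segment \<Psi> J P = bohl_segment \<Phi> J Q" "lower_bohl \<Phi> J Q \<le> upper_bohl \<Phi> J Q"
  shows "lower_bohl \<Psi> J P = lower_bohl \<Phi> J Q" "upper_bohl \<Psi> J P = upper_bohl \<Phi> J Q"
  using assms by (auto simp: bohl_segment_def Icc_eq_Icc)

lemma (in jost_setting) split_equation_perturbedI:
  assumes \<Psi>: "fundamental_solution (\<lambda>x. A x + R x) \<Psi>" and P: "matching_splitting \<Phi> \<Psi> {0..} m Qs P"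
  shows "split_equation_perturbed A R \<Phi> Qs m \<Psi> P"
proof unfold_locales
  have sp: "exp_splitting \<Psi> {0..} m P" using P by (simp add: matching_splitting_def)
  show "fundamental_solution (\<lambda>x. A x + R x) \<Psi>" by fact
  show "(\<Sum>i=1..m. P i) = mat 1" using sp by (simp add: exp_splitting_def)
  fix i assume i: "i \<in> {1..m}"
  have seg: "bohl_segment \<Psi> {0..} (P i) = bohl_segment \<Phi> {0..} (Qs i)"
    using P i by (simp add: matching_splitting_def)
  show "lower_bohl \<Psi> {0..} (P i) = lower_bohl \<Phi> {0..} (Qs i)" "upper_bohl \<Psi> {0..} (P i) = upper_bohl \<Phi> {0..} (Qs i)"
    by (rule bohl_segment_eqD[OF seg bohl_le[OF i]])+
qed

lemma (in jost_setting) split_equation_perturbed_reflectI: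
  assumes \<Psi>: "fundamental_solution (\<lambda>x. A x + R x) \<Psi>" and P: "matching_splitting \<Phi> \<Psi> {..0} m Qs P"
  shows "split_equation_perturbed (\<lambda>x. - A (- x)) (\<lambda>x. - R (- x)) (\<lambda>x. \<Phi> (- x)) (\<lambda>i. Qs (m + 1 - i)) m
    (\<lambda>x. \<Psi> (- x)) (\<lambda>i. P (m + 1 - i))"
proof -
  interpret refl: jost_setting "\<lambda>x. - A (- x)" "\<lambda>x. - R (- x)" "\<lambda>x. \<Phi> (- x)" "\<lambda>i. Qs (m + 1 - i)" m \<beta>
    by (rule jost_setting_reflect)
  have sp: "exp_splitting \<Psi> {..0} m P" using P by (simp add: matching_splitting_def)
  have "fundamental_solution (\<lambda>x. - (A (- x) + R (- x))) (\<lambda>x. \<Psi> (- x))"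
    using fundamental_solution_reflect[OF \<Psi>] .
  then have fund': "fundamental_solution (\<lambda>x. - A (- x) + - R (- x)) (\<lambda>x. \<Psi> (- x))"
    by (simp only: minus_add_distrib)
  show ?thesis
  proof (unfold_locales, fact fund')
    show "(\<Sum>i=1..m. P (m + 1 - i)) = mat 1"
      using sum_reverse_index[of m m P] sp by (simp add: exp_splitting_def)
    fix i assume i: "i \<in> {1..m}"
    then have i': "m + 1 - i \<in> {1..m}" by auto
    have seg: "bohl_segment \<Psi> {..0} (P (m + 1 - i)) = bohl_segment \<Phi> {..0} (Qs (m + 1 - i))"
      using P i' unfolding matching_splitting_def by blast
    have le: "lower_bohl \<Phi> {..0} (Qs (m + 1 - i)) \<le> upper_bohl \<Phi> {..0} (Qs (m + 1 - i))"
      using refl.bohl_le[OF i] by (simp add: lower_bohl_reflect upper_bohl_reflect uminus_image_half_lines)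
    show "lower_bohl (\<lambda>x. \<Psi> (- x)) {0..} (P (m + 1 - i)) = lower_bohl (\<lambda>x. \<Phi> (- x)) {0..} (Qs (m + 1 - i))"
      "upper_bohl (\<lambda>x. \<Psi> (- x)) {0..} (P (m + 1 - i)) = upper_bohl (\<lambda>x. \<Phi> (- x)) {0..} (Qs (m + 1 - i))"
      unfolding lower_bohl_reflect upper_bohl_reflect uminus_image_half_lines bohl_segment_eqD[OF seg le]
      by (rule refl)+
  qed
qed

lemma (in split_equation_perturbed) range_jost_plus:
  assumes j: "j \<in> {1..m}" and Y: "jost_plus A R \<Phi> (Qs j) Y"
  shows "mat_range (Y 0) - {0} \<subseteq> mat_range (\<Sum>k=1..j. P k) - mat_range (\<Sum>k=1..j-1. P k)"
  using range_jost_plus_subset[OF j Y] range_jost_plus_inter[OF j Y] by blast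

theorem theorem7p3:
  fixes A R \<Phi> :: "real \<Rightarrow> complex ^ 'n ^ 'n"
    and Q :: "complex ^ 'n ^ 'n"
    and Qs :: "nat \<Rightarrow> complex ^ 'n ^ 'n"
    and d' k\<^sub>0 :: nat
    and \<beta> :: real
  assumes "CARD('n) \<ge> 2"
    and "loc_integrable A"
    and "fundamental_solution A \<Phi>"
    and "exp_bounded \<Phi>"
    and "exp_dichotomy \<Phi> Q"
    and "2 \<le> d'" and "d' \<le> CARD('n)"
    and "1 \<le> k\<^sub>0" and "k\<^sub>0 \<le> d' - 1"
    and "exp_splitting \<Phi> UNIV d' Qs"
    and "Q = (\<Sum>j=1..k\<^sub>0. Qs j)"
    and "mat 1 - Q = (\<Sum>j=k\<^sub>0+1..d'. Qs j)"
    and "\<forall>j\<in>{1..d'-1}.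
           lower_bohl \<Phi> UNIV (Qs j) \<le> upper_bohl \<Phi> UNIV (Qs j) \<and>
           upper_bohl \<Phi> UNIV (Qs j) < lower_bohl \<Phi> UNIV (Qs (j+1)) \<and>
           lower_bohl \<Phi> UNIV (Qs (j+1)) \<le> upper_bohl \<Phi> UNIV (Qs (j+1))"
    and "R \<in> borel_measurable lebesgue"
    and "integrable lebesgue (\<lambda>x. norm (R x) * exp (\<beta> * \<bar>x\<bar>))"
    and "ereal \<beta> >
           max (MAX j\<in>{1..k\<^sub>0}. lyapunov_plus \<Phi> (Qs j) - lower_bohl \<Phi> {0..} (Qs j))
               (MAX j\<in>{k\<^sub>0+1..d'}. upper_bohl \<Phi> {..0} (Qs j) - lyapunov_minus' \<Phi> (Qs j))"
  shows
    \<comment> \<open>(i)\<close>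
    "(\<exists>Y\<^sub>p Y\<^sub>m. (\<forall>j\<in>{1..k\<^sub>0}. jost_plus A R \<Phi> (Qs j) (Y\<^sub>p j)) \<and>
              (\<forall>j\<in>{k\<^sub>0+1..d'}. jost_minus A R \<Phi> (Qs j) (Y\<^sub>m j))) \<and>
     \<comment> \<open>(ii)\<close>
     (\<forall>Y Y'. jost_plus A R \<Phi> (Qs 1) Y \<and> jost_plus A R \<Phi> (Qs 1) Y' \<longrightarrow> (\<forall>x\<ge>0. Y x = Y' x)) \<and>
     (\<forall>Y Y'. jost_minus A R \<Phi> (Qs d') Y \<and> jost_minus A R \<Phi> (Qs d') Y' \<longrightarrow> (\<forall>x\<le>0. Y x = Y' x)) \<and>
     (\<forall>\<Psi> P. fundamental_solution (\<lambda>x. A x + R x) \<Psi> \<and> perturbed_projections \<Phi> \<Psi> k\<^sub>0 d' Qs P \<longrightarrow>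
        (\<forall>Y. jost_plus A R \<Phi> (Qs 1) Y \<longrightarrow> mat_range (Y 0) \<subseteq> mat_range (P 1)) \<and>
        (\<forall>Y. jost_minus A R \<Phi> (Qs d') Y \<longrightarrow> mat_range (Y 0) \<subseteq> mat_range (P d')) \<and>
        \<comment> \<open>(iii)\<close>
        (\<forall>j\<in>{2..k\<^sub>0}. \<forall>Y. jost_plus A R \<Phi> (Qs j) Y \<longrightarrow>
           mat_range (Y 0) - {0} \<subseteq> mat_range (\<Sum>k=1..j. P k) - mat_range (\<Sum>k=1..j-1. P k)) \<and>
        (\<forall>j\<in>{k\<^sub>0+1..d'-1}. \<forall>Y. jost_minus A R \<Phi> (Qs j) Y \<longrightarrow>
           mat_range (Y 0) - {0} \<subseteq> mat_range (\<Sum>k=j..d'. P k) - mat_range (\<Sum>k=j+1..d'. P k)) \<and>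
        \<comment> \<open>(iv)\<close>
        (\<forall>j\<in>{2..k\<^sub>0}. \<forall>Y Y'. jost_plus A R \<Phi> (Qs j) Y \<and> jost_plus A R \<Phi> (Qs j) Y' \<longrightarrow>
           mat_range (Y 0 - Y' 0) \<subseteq> mat_range (\<Sum>k=1..j-1. P k)) \<and>
        (\<forall>j\<in>{k\<^sub>0+1..d'-1}. \<forall>Y Y'. jost_minus A R \<Phi> (Qs j) Y \<and> jost_minus A R \<Phi> (Qs j) Y' \<longrightarrow>
           mat_range (Y 0 - Y' 0) \<subseteq> mat_range (\<Sum>k=j+1..d'. P k)))"
proof -
  note A = assms(2) and fund = assms(3) and d'2 = assms(6) and k0 = assms(8,9) and splitting = assms(10)
    and chain = assms(13) and R_meas = assms(14) and R\<beta> = assms(15) and \<beta> = assms(16)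
  have k0_less: "k\<^sub>0 < d'" using k0 d'2 by simp
  have \<beta>p: "lyapunov_plus \<Phi> (Qs j) - lower_bohl \<Phi> {0..} (Qs j) < ereal \<beta>" if "j \<in> {1..k\<^sub>0}" for j
  proof -
    have "lyapunov_plus \<Phi> (Qs j) - lower_bohl \<Phi> {0..} (Qs j)
        \<le> (MAX j\<in>{1..k\<^sub>0}. lyapunov_plus \<Phi> (Qs j) - lower_bohl \<Phi> {0..} (Qs j))"
      using that by (intro Max_ge) auto
    with \<beta> show ?thesis by (meson le_less_trans max.strict_boundedE)
  qed
  have \<beta>m: "upper_bohl \<Phi> {..0} (Qs j) - lyapunov_minus' \<Phi> (Qs j) < ereal \<beta>" if "j \<in> {k\<^sub>0+1..d'}" for j
  proof -
    have "upper_bohl \<Phi> {..0} (Qs j) - lyapunov_minus' \<Phi> (Qs j)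
        \<le> (MAX j\<in>{k\<^sub>0+1..d'}. upper_bohl \<Phi> {..0} (Qs j) - lyapunov_minus' \<Phi> (Qs j))"
      using that by (intro Max_ge) auto
    with \<beta> show ?thesis by (meson le_less_trans max.strict_boundedE)
  qed
  have le: "lower_bohl \<Phi> UNIV (Qs i) \<le> upper_bohl \<Phi> UNIV (Qs i)" if "i \<in> {1..d'}" for i
  \<comment> \<open>The chain of inequalities runs only to \<open>d' - 1\<close>; the index
    \<open>d'\<close> appears in it as the successor of \<open>d' - 1\<close>.\<close>
  proof (cases "i = d'")
    case True
    then show ?thesis using chain[rule_format, of "d' - 1"] d'2 by simp
  next
    case False
    then have "i \<in> {1..d'-1}" using that by auto
    then show ?thesis using chain by blast
  qed
  have ordered: "upper_bohl \<Phi> UNIV (Qs i) < lower_bohl \<Phi> UNIV (Qs j)"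
    if ij: "i \<in> {1..d'}" "j \<in> {1..d'}" "i < j" for i j
  proof -
    from ij(3) have "Suc i \<le> j" by simp
    then show ?thesis using ij(2)
    proof (induction j rule: dec_induct)
      case base
      then show ?case using chain[rule_format, of i] ij(1) by simp
    next
      case (step n)
      have "upper_bohl \<Phi> UNIV (Qs i) < lower_bohl \<Phi> UNIV (Qs n)" using step by simp
      also have "\<dots> \<le> upper_bohl \<Phi> UNIV (Qs n)" using step by (intro le) simp
      also have "\<dots> < lower_bohl \<Phi> UNIV (Qs (Suc n))" using chain[rule_format, of n] step by simp
      finally show ?case .
    qed
  qed
  have idem: "Qs i ** Qs i = Qs i" if "i \<in> {1..d'}" for i
    using splitting that by (simp add: exp_splitting_def uniformly_conjugated_def is_projection_def)
  \<comment> \<open>A zero member would have lower exponent \<open>\<infinity>\<close> and upper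
    exponent \<open>-\<infinity>\<close>.\<close>
  have nonzero: "Qs i \<noteq> 0" if "i \<in> {1..d'}" for i
    using le[OF that] by (auto simp: bohl_zero)
  \<comment> \<open>The term with index 1 in the first maximum is already nonnegative. Hence the
    weight is at least 1, and \<open>R\<close> itself is integrable.\<close>
  have "\<beta> > 0"
  proof -
    have 1: "1 \<in> {1..d'}" "1 \<in> {1..k\<^sub>0}" using k0 d'2 by auto
    have "lower_bohl \<Phi> {0..} (Qs 1) \<le> lyapunov_plus \<Phi> (Qs 1)"
      by (rule lower_bohl_le_lyapunov_plus[OF invertible_fundamental_solution[OF A fund] idem[OF 1(1)] nonzero[OF 1(1)]])
         (use fund in \<open>simp add: fundamental_solution_def\<close>)
    with \<beta>p[OF 1(2)] show ?thesis
      by (cases "lower_bohl \<Phi> {0..} (Qs 1)"; cases "lyapunov_plus \<Phi> (Qs 1)") auto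
  qed
  have R: "integrable lebesgue R"
  proof (rule Bochner_Integration.integrable_bound[OF R\<beta> R_meas], rule AE_I2)
    fix x
    have "norm (R x) * 1 \<le> norm (R x) * exp (\<beta> * \<bar>x\<bar>)" using \<open>\<beta> > 0\<close> by (intro mult_left_mono) auto
    then show "norm (R x) \<le> norm (norm (R x) * exp (\<beta> * \<bar>x\<bar>))" by simp
  qed
  interpret S: jost_setting A R \<Phi> Qs d' \<beta>
    by unfold_locales (use A fund R R\<beta> idem nonzero ordered splitting in \<open>auto simp: exp_splitting_def\<close>)
  \<comment> \<open>The numbering \<open>d' + 1 - i\<close> makes the reflected exponents increase
    again; in particular the member \<open>d'\<close> becomes the first one, to which the uniqueness
    result applies.\<close>
  let ?A = "\<lambda>x. - A (- x)" and ?R = "\<lambda>x. - R (- x)" and ?\<Phi> = "\<lambda>x. \<Phi> (- x)" and ?Qs = "\<lambda>i. Qs (d' + 1 - i)"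
  interpret T: jost_setting ?A ?R ?\<Phi> ?Qs d' \<beta> by (rule S.jost_setting_reflect)
  have jm: "jost_minus A R \<Phi> (Qs j) Y \<longleftrightarrow> jost_plus ?A ?R ?\<Phi> (?Qs (d' + 1 - j)) (\<lambda>x. Y (- x))"
    if "j \<in> {1..d'}" for j Y
    unfolding jost_minus_iff_jost_plus_reflect using that by simp
  have ex_plus: "\<exists>Y. jost_plus A R \<Phi> (Qs j) Y" if j: "j \<in> {1..k\<^sub>0}" for j
    by (rule S.exists_jost_plus[OF _ \<beta>p[OF j] S.R\<beta>_half_line]) (use j k0_less in auto)
  have ex_minus: "\<exists>Y. jost_minus A R \<Phi> (Qs j) Y" if j: "j \<in> {k\<^sub>0+1..d'}" for j
  proof -
    have j': "j \<in> {1..d'}" "d' + 1 - j \<in> {1..d'}" "d' + 1 - (d' + 1 - j) = j" using j by auto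
    \<comment> \<open>Both reflected exponents are negatives of the original ones, so their
      difference is the term of the second maximum with its order restored.\<close>
    have "lyapunov_plus ?\<Phi> (Qs j) - lower_bohl ?\<Phi> {0..} (Qs j) < ereal \<beta>"
      using \<beta>m[OF j]
      by (simp add: lower_bohl_reflect lyapunov_minus'_reflect uminus_image_half_lines minus_ereal_def add.commute)
    then have "lyapunov_plus ?\<Phi> (?Qs (d' + 1 - j)) - lower_bohl ?\<Phi> {0..} (?Qs (d' + 1 - j)) < ereal \<beta>"
      unfolding j'(3) .
    from T.exists_jost_plus[OF j'(2) this T.R\<beta>_half_line]
    obtain Y where "jost_plus ?A ?R ?\<Phi> (?Qs (d' + 1 - j)) Y" by blast
    then have "jost_minus A R \<Phi> (Qs j) (\<lambda>x. Y (- x))" unfolding jm[OF j'(1)] by simp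
    then show ?thesis by blast
  qed
  have i: "\<exists>Y\<^sub>p Y\<^sub>m. (\<forall>j\<in>{1..k\<^sub>0}. jost_plus A R \<Phi> (Qs j) (Y\<^sub>p j)) \<and>
              (\<forall>j\<in>{k\<^sub>0+1..d'}. jost_minus A R \<Phi> (Qs j) (Y\<^sub>m j))"
  proof -
    have "\<exists>Y\<^sub>p. \<forall>j\<in>{1..k\<^sub>0}. jost_plus A R \<Phi> (Qs j) (Y\<^sub>p j)"
      by (rule bchoice) (use ex_plus in blast)
    moreover have "\<exists>Y\<^sub>m. \<forall>j\<in>{k\<^sub>0+1..d'}. jost_minus A R \<Phi> (Qs j) (Y\<^sub>m j)"
      by (rule bchoice) (use ex_minus in blast)
    ultimately show ?thesis by blast
  qed
  have one: "1 \<le> d'" "1 \<in> {1..d'}" "d' \<in> {1..d'}" using d'2 by auto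
  have ii_plus: "Y x = Y' x" if "jost_plus A R \<Phi> (Qs 1) Y" "jost_plus A R \<Phi> (Qs 1) Y'" "x \<ge> 0" for Y Y' x
    by (rule S.jost_plus_unique[OF one(1) that])
  have ii_minus: "Y x = Y' x" if Y: "jost_minus A R \<Phi> (Qs d') Y" "jost_minus A R \<Phi> (Qs d') Y'" "x \<le> 0" for Y Y' x
  proof -
    have "jost_plus ?A ?R ?\<Phi> (?Qs 1) (\<lambda>x. Y (- x))" "jost_plus ?A ?R ?\<Phi> (?Qs 1) (\<lambda>x. Y' (- x))"
      using Y(1,2) unfolding jm[OF one(3)] by simp_all
    from T.jost_plus_unique[OF one(1) this, of "- x"] show ?thesis using Y(3) by simp
  qed
  show ?thesis
    (is "_ \<and> _ \<and> _ \<and> (\<forall>\<Psi> P. _ \<Psi> P \<longrightarrow> ?rest \<Psi> P)")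
  proof (rule conjI[OF i], intro conjI)
    show "\<forall>Y Y'. jost_plus A R \<Phi> (Qs 1) Y \<and> jost_plus A R \<Phi> (Qs 1) Y' \<longrightarrow> (\<forall>x\<ge>0. Y x = Y' x)"
      by (intro allI impI, elim conjE, rule ii_plus)
    show "\<forall>Y Y'. jost_minus A R \<Phi> (Qs d') Y \<and> jost_minus A R \<Phi> (Qs d') Y' \<longrightarrow> (\<forall>x\<le>0. Y x = Y' x)"
      by (intro allI impI, elim conjE, rule ii_minus)
  next
    show "\<forall>\<Psi> P. fundamental_solution (\<lambda>x. A x + R x) \<Psi> \<and> perturbed_projections \<Phi> \<Psi> k\<^sub>0 d' Qs P \<longrightarrow> ?rest \<Psi> P"
    proof (intro allI impI, elim conjE)
      fix \<Psi> P
      assume \<Psi>: "fundamental_solution (\<lambda>x. A x + R x) \<Psi>" and pert: "perturbed_projections \<Phi> \<Psi> k\<^sub>0 d' Qs P"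
      obtain Pp Pm where Pp: "matching_splitting \<Phi> \<Psi> {0..} d' Qs Pp" and Pm: "matching_splitting \<Phi> \<Psi> {..0} d' Qs Pm"
        and P_p: "\<forall>j\<in>{1..k\<^sub>0}. P j = Pp j" and P_m: "\<forall>j\<in>{k\<^sub>0+1..d'}. P j = Pm j"
        using pert unfolding perturbed_projections_def by blast
      interpret SP: split_equation_perturbed A R \<Phi> Qs d' \<Psi> Pp
        by (rule S.split_equation_perturbedI[OF \<Psi> Pp])
      interpret TP: split_equation_perturbed ?A ?R ?\<Phi> ?Qs d' "\<lambda>x. \<Psi> (- x)" "\<lambda>i. Pm (d' + 1 - i)"
        by (rule S.split_equation_perturbed_reflectI[OF \<Psi> Pm])
      have sum_p: "(\<Sum>k=1..j. Pp k) = (\<Sum>k=1..j. P k)" if "j \<le> k\<^sub>0" for j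
        by (rule sum.cong) (use P_p that in auto)
      \<comment> \<open>The bound on \<open>n\<close> keeps all indices above
        \<open>k\<^sub>0\<close>, where \<open>P\<close> is taken from the splitting on the negative
        half-line.\<close>
      have sum_m: "(\<Sum>i=1..n. Pm (d' + 1 - i)) = (\<Sum>k=d'+1-n..d'. P k)" if "n \<le> d' - k\<^sub>0" for n
      proof -
        have "(\<Sum>i=1..n. Pm (d' + 1 - i)) = (\<Sum>k=d'+1-n..d'. Pm k)" using that by (intro sum_reverse_index) simp
        also have "\<dots> = (\<Sum>k=d'+1-n..d'. P k)"
        proof (rule sum.cong[OF refl])
          fix k assume "k \<in> {d'+1-n..d'}"
          then have "k \<in> {k\<^sub>0+1..d'}" using that k0_less by auto
          then show "Pm k = P k" using P_m by simp
        qed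
        finally show ?thesis .
      qed
      have plus1: "mat_range (Y 0) \<subseteq> mat_range (P 1)" if "jost_plus A R \<Phi> (Qs 1) Y" for Y
        using SP.range_jost_plus_subset[OF one(2) that] unfolding sum_p[OF k0(1)] by simp
      have minus_range: "mat_range (Y 0) \<subseteq> mat_range (\<Sum>k=j..d'. P k)"
        "mat_range (Y 0) - {0} \<subseteq> mat_range (\<Sum>k=j..d'. P k) - mat_range (\<Sum>k=j+1..d'. P k)"
        if j: "j \<in> {k\<^sub>0+1..d'}" and Y: "jost_minus A R \<Phi> (Qs j) Y" for j Y
      proof -
        let ?j = "d' + 1 - j"
        \<comment> \<open>Reversing back, the first \<open>?j\<close> members become
          \<open>{j..d'}\<close> and the first \<open>?j - 1\<close> become
          \<open>{j+1..d'}\<close>, which is empty for \<open>j = d'\<close>.\<close>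
        have j': "j \<in> {1..d'}" "?j \<in> {1..d'}" "?j \<le> d' - k\<^sub>0" "?j - 1 \<le> d' - k\<^sub>0"
          "d' + 1 - ?j = j" "d' + 1 - (?j - 1) = j + 1" using j by auto
        have Y': "jost_plus ?A ?R ?\<Phi> (?Qs ?j) (\<lambda>x. Y (- x))" using Y unfolding jm[OF j'(1)] .
        show "mat_range (Y 0) \<subseteq> mat_range (\<Sum>k=j..d'. P k)"
          using TP.range_jost_plus_subset[OF j'(2) Y'] unfolding sum_m[OF j'(3)] j'(5) by simp
        show "mat_range (Y 0) - {0} \<subseteq> mat_range (\<Sum>k=j..d'. P k) - mat_range (\<Sum>k=j+1..d'. P k)"
          using TP.range_jost_plus[OF j'(2) Y'] unfolding sum_m[OF j'(3)] sum_m[OF j'(4)] j'(5,6) by simp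
      qed
      have minus_diff: "mat_range (Y 0 - Y' 0) \<subseteq> mat_range (\<Sum>k=j+1..d'. P k)"
        if j: "j \<in> {k\<^sub>0+1..d'}" and Y: "jost_minus A R \<Phi> (Qs j) Y" "jost_minus A R \<Phi> (Qs j) Y'" for j Y Y'
      proof -
        let ?j = "d' + 1 - j"
        have j': "j \<in> {1..d'}" "?j \<in> {1..d'}" "?j - 1 \<le> d' - k\<^sub>0" "d' + 1 - (?j - 1) = j + 1" using j by auto
        have Y1: "jost_plus ?A ?R ?\<Phi> (?Qs ?j) (\<lambda>x. Y (- x))" using Y(1) unfolding jm[OF j'(1)] .
        have Y2: "jost_plus ?A ?R ?\<Phi> (?Qs ?j) (\<lambda>x. Y' (- x))" using Y(2) unfolding jm[OF j'(1)] .
        show ?thesis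
          using TP.range_jost_plus_diff_subset[OF j'(2) Y1 Y2] unfolding sum_m[OF j'(3)] j'(4) by simp
      qed
      have plus_range: "mat_range (Y 0) - {0} \<subseteq> mat_range (\<Sum>k=1..j. P k) - mat_range (\<Sum>k=1..j-1. P k)"
        if j: "j \<in> {2..k\<^sub>0}" and Y: "jost_plus A R \<Phi> (Qs j) Y" for j Y
      proof -
        have j': "j \<in> {1..d'}" "j \<le> k\<^sub>0" "j - 1 \<le> k\<^sub>0" using j k0_less by auto
        show ?thesis using SP.range_jost_plus[OF j'(1) Y] unfolding sum_p[OF j'(2)] sum_p[OF j'(3)] .
      qed
      have plus_diff: "mat_range (Y 0 - Y' 0) \<subseteq> mat_range (\<Sum>k=1..j-1. P k)"
        if j: "j \<in> {2..k\<^sub>0}" and Y: "jost_plus A R \<Phi> (Qs j) Y" "jost_plus A R \<Phi> (Qs j) Y'" for j Y Y'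
      proof -
        have j': "j \<in> {1..d'}" "j - 1 \<le> k\<^sub>0" using j k0_less by auto
        show ?thesis using SP.range_jost_plus_diff_subset[OF j'(1) Y] unfolding sum_p[OF j'(2)] .
      qed
      have minus1: "mat_range (Y 0) \<subseteq> mat_range (P d')" if "jost_minus A R \<Phi> (Qs d') Y" for Y
        using minus_range(1)[OF _ that] k0_less by simp
      have sub: "j \<in> {k\<^sub>0+1..d'}" if "j \<in> {k\<^sub>0+1..d'-1}" for j using that by auto
      show "?rest \<Psi> P"
        by (intro conjI allI ballI impI)
           (erule plus1 minus1, erule minus1, erule (1) plus_range, erule minus_range(2)[OF sub], assumption,
            elim conjE, erule (2) plus_diff, elim conjE, erule minus_diff[OF sub], assumption+)
    qed
  qed
qed

end
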